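(* Fix weights $\omega_j \geq 1$, $j \in [N]$, and $s \in \mathbb{N}$, and suppose that $\gamma > 0$ is such that $\omega_j \geq \max\left\{1, \sqrt{2\gamma \log(j/s)}\right\}$ for all $j \in [N]$. Let $\mathbf{A} \in \mathbb{R}^{m\times N}$ be a random matrix with i.i.d. entries $a_{ij} \sim \mathcal{N}(0,1)$, and let $\zeta > 0$. Consider a (fixed) signal $\mathbf{x} \in \mathbb{R}^N$ supported on $\mathcal{S} \subset [N]$ with $|\mathcal{S}| \leq k$ and $\omega(\mathcal{S}) = \sum_{j\in\mathcal{S}} \omega_j^2 \leq s$. Assume that noisy measurements $\mathbf{y} = \mathbf{A}\mathbf{x} + \mathbf{e}$ are taken, with $\|\mathbf{e}\|_2 \leq \eta$. Suppose that, for some $0 < \delta < 1$, $$\frac{m}{\sqrt{m+1}} \geq \sqrt{\frac{2s}{\gamma}} + \sqrt{k} + \sqrt{\gamma s} + \sqrt{2\log\left(\frac{1}{\delta}\right)} + \zeta .$$ Then with probability exceeding $1-\delta$, any solution $\widehat{\mathbf{x}}$ of the weighted $\ell_1$-minimization problem $$\min_{\mathbf{z}\in\mathbb{R}^N} \|\mathbf{z}\|_{\omega,1} \quad \text{subject to} \quad \|\mathbf{A}\mathbf{z} - \mathbf{y}\|_2 \leq \eta$$ satisfies $$\|\widehat{\mathbf{x}} - \mathbf{x}\|_2 \leq \frac{2\eta}{\zeta} \quad \text{and} \quad \|\widehat{\mathbf{x}} - \mathbf{x}\|_{\omega,1} \leq \frac{4\sqrt{s}\,\eta}{\zeta}.$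$
   Context: $[N] = \{1,\dots,N\}$. The weighted $\ell_1$-norm is $\|\mathbf{z}\|_{\omega,1} = \sum_{j=1}^N \omega_j |z_j|$. The weighted cardinality of $\mathcal{S} \subset [N]$ is $\omega(\mathcal{S}) = \sum_{j\in\mathcal{S}} \omega_j^2$. A vector $\mathbf{x}$ is supported on $\mathcal{S}$ if $x_j = 0$ for all $j \notin \mathcal{S}$. For indices $j$ with $j < s$ (where $\log(j/s) < 0$), the expression $\sqrt{2\gamma\log(j/s)}$ is read as $0$, so the weight condition there is just $\omega_j \geq 1$. The result is nonuniform: $\mathbf{x}$ and $\mathcal{S}$ are fixed before $\mathbf{A}$ is drawn, and the probability is over $\mathbf{A}$. *)

theory Defs
  imports "HOL-Probability.Probability"
begin

text \<open>
  A vector in \<open>\<real>\<^sup>N\<close> is a function \<open>nat \<Rightarrow> real\<close> of which only the values at the indices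
  \<open>1, \<dots>, N\<close> matter; an \<open>m \<times> N\<close> matrix is likewise a function of a row index in \<open>{1..m}\<close>
  and a column index in \<open>{1..N}\<close>. The Euclidean norm is \<^const>\<open>L2_set\<close> over the index range.
\<close>

definition mat_vec :: "nat \<Rightarrow> (nat \<Rightarrow> nat \<Rightarrow> real) \<Rightarrow> (nat \<Rightarrow> real) \<Rightarrow> nat \<Rightarrow> real" where
  "mat_vec N A z i = (\<Sum>j\<in>{1..N}. A i j * z j)"

definition weighted_l1 :: "nat \<Rightarrow> (nat \<Rightarrow> real) \<Rightarrow> (nat \<Rightarrow> real) \<Rightarrow> real" where
  "weighted_l1 N \<omega> z = (\<Sum>j\<in>{1..N}. \<omega> j * \<bar>z j\<bar>)"

definition weighted_card :: "(nat \<Rightarrow> real) \<Rightarrow> nat set \<Rightarrow> real" where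
  "weighted_card \<omega> S = (\<Sum>j\<in>S. (\<omega> j)\<^sup>2)"

definition supported_on :: "nat \<Rightarrow> (nat \<Rightarrow> real) \<Rightarrow> nat set \<Rightarrow> bool" where
  "supported_on N x S \<longleftrightarrow> (\<forall>j\<in>{1..N} - S. x j = 0)"

definition weighted_l1_solution ::
  "nat \<Rightarrow> nat \<Rightarrow> (nat \<Rightarrow> real) \<Rightarrow> (nat \<Rightarrow> nat \<Rightarrow> real) \<Rightarrow> (nat \<Rightarrow> real) \<Rightarrow> real \<Rightarrow> (nat \<Rightarrow> real) \<Rightarrow> bool"
where
  "weighted_l1_solution m N \<omega> A y \<eta> xh \<longleftrightarrow>
     is_arg_min (weighted_l1 N \<omega>) (\<lambda>z. L2_set (\<lambda>i. mat_vec N A z i - y i) {1..m} \<le> \<eta>) xh"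

text \<open>A random matrix is a function of the outcome; \<open>A u i j\<close> is its \<open>(i, j)\<close> entry at outcome \<open>u\<close>.\<close>

definition gaussian_matrix ::
  "'a measure \<Rightarrow> nat \<Rightarrow> nat \<Rightarrow> ('a \<Rightarrow> nat \<Rightarrow> nat \<Rightarrow> real) \<Rightarrow> bool"
where
  "gaussian_matrix M m N A \<longleftrightarrow>
     prob_space.indep_vars M (\<lambda>_. borel) (\<lambda>(i, j) u. A u i j) ({1..m} \<times> {1..N}) \<and>
     (\<forall>i\<in>{1..m}. \<forall>j\<in>{1..N}.
        distributed M lborel (\<lambda>u. A u i j) (\<lambda>t. ennreal (std_normal_density t)))"

end

theory Submission
  imports Defs
begin

text \<open>
  Why the theorem holds. Let \<open>v = xh - x\<close> be the error of a minimizer. Optimality and the support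
  of \<open>x\<close> put \<open>v\<close> into the cone where the weighted norm off \<open>S\<close> is at most the weighted norm on
  \<open>S\<close>, and both \<open>xh\<close> and \<open>x\<close> are feasible, so \<open>\<parallel>A v\<parallel> \<le> 2 \<eta>\<close>. If \<open>\<parallel>A z\<parallel> \<ge> \<zeta>\<close> for every unit vector
  \<open>z\<close> of the cone, both error bounds follow (\<open>recovery_from_cone_bound\<close>). The cone depends only on
  \<open>S\<close> and \<open>\<omega>\<close>, so the remaining question is how small a Gaussian matrix can be on a fixed set of
  unit vectors.

  That question is settled by an exponential form of Gordon's comparison. With independent standard
  Gaussian vectors \<open>g\<close> in dimension \<open>m\<close> and \<open>h\<close> in dimension \<open>N\<close> and a standard Gaussian number
  \<open>g0\<close>, for every \<open>l \<ge> 0\<close> and every finite set of unit vectors \<open>z\<close>,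
  \<open>E max exp (- l (\<parallel>A z\<parallel> + g0)) \<le> E exp (- l \<parallel>g\<parallel>) * E max exp (- l \<langle>h, z\<rangle>)\<close>.
  It is proved by rotating one Gaussian process into the other and differentiating: integration by
  parts turns the derivative into second derivatives of a smoothed maximum, and their signs are right
  (\<open>gaussian_interpolation\<close>, \<open>gordon_exponential_comparison\<close>). The left side contains the factor
  \<open>E exp (- l g0) = exp (l\<^sup>2 / 2)\<close>. The two factors on the right are bounded by
  \<open>exp (- l m / sqrt (m + 1) + l\<^sup>2 / 2)\<close> and \<open>exp (l W + l\<^sup>2 / 2)\<close>, where \<open>W\<close> bounds the Gaussian width of
  the cone. One variance term cancels, and Markov's inequality with \<open>l = \<tau>\<close> gives the tail
  \<open>exp (- \<tau>\<^sup>2 / 2)\<close> with the sharp constant. No separate concentration theorem for Lipschitz functions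
  enters: only the two explicit exponential moments are needed.

  The first moment (\<open>gaussian_norm_mgf\<close>) comes from a recursion between \<open>E \<parallel>g\<parallel>\<^sup>k exp (- l \<parallel>g\<parallel>)\<close> for
  \<open>k \<le> 3\<close> and the Cauchy-Schwarz inequality. For the second, fix \<open>t = sqrt (2 / \<gamma>)\<close>. On \<open>S\<close> and off
  \<open>S\<close> the excess \<open>max 0 (\<bar>h j\<bar> - t \<omega> j)\<close> is paired with \<open>z\<close> by Cauchy-Schwarz, while the
  truncated part costs \<open>t\<close> times the weighted norm of \<open>z\<close> off \<open>S\<close>, hence at most
  \<open>t sqrt s = sqrt (2 s / \<gamma>)\<close> (\<open>descent_sphere_width\<close>). The lower bound on the weights makes the
  excesses so rare that all coordinates off \<open>S\<close> together count as at most \<open>3/4 \<gamma> s\<close> coordinates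
  (\<open>thresholded_norm_mgf\<close>, \<open>weighted_tail_sum_le\<close>). So
  \<open>W = sqrt (2 s / \<gamma>) + sqrt (card S + 3/4 \<gamma> s)\<close>, which is strictly less than the width allowed by the
  hypothesis; this is where the strict inequality for the probability comes from. A countable dense
  subset of the cone carries the estimate from finite sets to the whole cone
  (\<open>gaussian_matrix_descent_sphere\<close>).
\<close>

section \<open>Standard Gaussian vectors and integration by parts\<close>

definition gauss :: "real measure" where
  "gauss = density lborel (\<lambda>t. ennreal (std_normal_density t))"

abbreviation gaussN :: "'i set \<Rightarrow> ('i \<Rightarrow> real) measure" where
  "gaussN I \<equiv> Pi\<^sub>M I (\<lambda>_. gauss)"

lemma sets_gauss [simp, measurable_cong]: "sets gauss = sets borel"
  by (simp add: gauss_def)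

lemma space_gauss [simp]: "space gauss = UNIV"
  by (simp add: gauss_def)

lemma prob_space_gauss: "prob_space gauss"
  unfolding gauss_def by (rule prob_space_normal_density) simp

interpretation gauss: prob_space gauss
  by (rule prob_space_gauss)

interpretation gaussN: product_prob_space "\<lambda>_. gauss" I for I :: "'i set"
  by unfold_locales

lemma prob_space_gaussN: "prob_space (gaussN I)"
  by unfold_locales

lemma integrable_gauss_iff:
  fixes f :: "real \<Rightarrow> real"
  assumes [measurable]: "f \<in> borel_measurable borel"
  shows "integrable gauss f \<longleftrightarrow> integrable lborel (\<lambda>t. std_normal_density t * f t)"
  unfolding gauss_def by (subst integrable_density) auto

lemma integral_gauss:
  fixes f :: "real \<Rightarrow> real"
  assumes [measurable]: "f \<in> borel_measurable borel"
  shows "integral\<^sup>L gauss f = (\<integral>t. std_normal_density t * f t \<partial>lborel)"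
  unfolding gauss_def by (subst integral_density) auto

lemma std_normal_density_shift:
  "std_normal_density t * exp (c * t) = exp (c\<^sup>2 / 2) * normal_density c 1 t"
proof -
  have "- t\<^sup>2 / 2 + c * t = c\<^sup>2 / 2 + - (t - c)\<^sup>2 / 2"
    by (simp add: power2_eq_square field_simps)
  then have "exp (- t\<^sup>2 / 2) * exp (c * t) = exp (c\<^sup>2 / 2) * exp (- (t - c)\<^sup>2 / 2)"
    by (simp only: exp_add[symmetric])
  then show ?thesis
    by (simp add: std_normal_density_def normal_density_def)
qed

lemma integrable_gauss_exp: "integrable gauss (\<lambda>t. exp (c * t))"
  by (subst integrable_gauss_iff) (simp_all add: std_normal_density_shift)

lemma integral_gauss_exp: "(\<integral>t. exp (c * t) \<partial>gauss) = exp (c\<^sup>2 / 2)"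
  by (subst integral_gauss) (simp_all add: std_normal_density_shift)

lemma integrable_gauss_exp_abs: "integrable gauss (\<lambda>t. exp (c * \<bar>t\<bar>))"
proof (rule Bochner_Integration.integrable_bound)
  show "integrable gauss (\<lambda>t. exp (c * t) + exp (- c * t))"
    by (intro Bochner_Integration.integrable_add integrable_gauss_exp)
  have "exp (c * \<bar>t\<bar>) \<le> exp (c * t) + exp (- c * t)" for t
    by (cases "t \<ge> 0") auto
  then show "AE t in gauss. norm (exp (c * \<bar>t\<bar>)) \<le> norm (exp (c * t) + exp (- c * t))"
    by (intro AE_I2) (simp add: order_trans[OF _ abs_ge_self])
qed simp

lemma integrable_gaussN_exp:
  assumes "finite I"
  shows "integrable (gaussN I) (\<lambda>\<xi>. exp (c * (\<Sum>\<kappa>\<in>I. \<bar>\<xi> \<kappa>\<bar>)))"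
proof -
  have "integrable (gaussN I) (\<lambda>\<xi>. \<Prod>\<kappa>\<in>I. exp (c * \<bar>\<xi> \<kappa>\<bar>))"
    using assms by (intro gaussN.product_integrable_prod integrable_gauss_exp_abs)
  then show ?thesis
    using assms by (simp add: exp_sum sum_distrib_left)
qed

text \<open>
  Functions of at most exponential growth are integrable; the smoothed functionals of this development all
  have such growth.
\<close>
lemma integrable_gaussN_bound:
  fixes f :: "('i \<Rightarrow> real) \<Rightarrow> real"
  assumes "finite I" "f \<in> borel_measurable (gaussN I)"
    and "\<And>\<xi>. \<bar>f \<xi>\<bar> \<le> K * exp (c * (\<Sum>\<kappa>\<in>I. \<bar>\<xi> \<kappa>\<bar>))"
  shows "integrable (gaussN I) f"
proof (rule Bochner_Integration.integrable_bound)
  show "integrable (gaussN I) (\<lambda>\<xi>. K * exp (c * (\<Sum>\<kappa>\<in>I. \<bar>\<xi> \<kappa>\<bar>)))"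
    using integrable_gaussN_exp[OF assms(1)] by simp
  show "AE \<xi> in gaussN I. norm (f \<xi>) \<le> norm (K * exp (c * (\<Sum>\<kappa>\<in>I. \<bar>\<xi> \<kappa>\<bar>)))"
    using assms(3) by (intro AE_I2) (metis abs_ge_self order_trans real_norm_def)
qed fact

lemma exp_linear_times_std_normal_tendsto_0:
  "((\<lambda>n. K * exp (c * real n) * std_normal_density (real n)) \<longlongrightarrow> 0) sequentially"
proof -
  have "((\<lambda>x::real. exp (c * x - x\<^sup>2 / 2)) \<longlongrightarrow> 0) at_top"
  proof (rule filterlim_compose[OF exp_at_bot])
    have "filterlim (\<lambda>x::real. x * (- c + x * (1 / 2))) at_top at_top"
      by (intro filterlim_at_top_mult_at_top filterlim_ident filterlim_tendsto_add_at_top[OF tendsto_const]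
          filterlim_at_top_mult_tendsto_pos[OF tendsto_const]) auto
    then show "filterlim (\<lambda>x::real. c * x - x\<^sup>2 / 2) at_bot at_top"
      by (subst filterlim_uminus_at_bot) (simp add: power2_eq_square algebra_simps)
  qed
  from filterlim_compose[OF this filterlim_real_sequentially]
  have "(\<lambda>n. exp (c * real n - (real n)\<^sup>2 / 2)) \<longlonglongrightarrow> 0" .
  moreover have "K * exp (c * real n) * std_normal_density (real n) =
      K / sqrt (2 * pi) * exp (c * real n - (real n)\<^sup>2 / 2)" for n
    unfolding std_normal_density_def diff_conv_add_uminus exp_add by simp
  ultimately show ?thesis
    using tendsto_mult_left[of _ 0 _ "K / sqrt (2 * pi)"] by force
qed

text \<open>
  The density \<open>\<phi>\<close> satisfies \<open>\<phi>' t = - t \<phi> t\<close>, so \<open>t f t \<phi> t\<close> and \<open>f' t \<phi> t\<close> differ by the derivative of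
  \<open>f \<phi>\<close>, whose integral over the line vanishes because \<open>f\<close> grows at most exponentially.
\<close>
lemma gauss_integration_by_parts:
  fixes f f' :: "real \<Rightarrow> real"
  assumes df: "\<And>t. (f has_real_derivative f' t) (at t)"
    and cont: "continuous_on UNIV f'"
    and bf: "\<And>t. \<bar>f t\<bar> \<le> K * exp (c * \<bar>t\<bar>)"
    and bf': "\<And>t. \<bar>f' t\<bar> \<le> K * exp (c * \<bar>t\<bar>)"
  shows "(\<integral>t. t * f t \<partial>gauss) = (\<integral>t. f' t \<partial>gauss)"
proof -
  let ?p = std_normal_density
  have cf: "continuous_on UNIV f"
    by (meson DERIV_continuous_on df has_field_derivative_at_within)
  have [measurable]: "f \<in> borel_measurable borel" "f' \<in> borel_measurable borel"
    using cf cont by (auto intro: borel_measurable_continuous_onI)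
  have i1: "integrable gauss f'"
    using integrable_gauss_exp_abs[of c]
    by (rule Bochner_Integration.integrable_bound[where f = "\<lambda>t. K * exp (c * \<bar>t\<bar>)", OF integrable_mult_right])
       (use bf' in \<open>auto intro!: AE_I2 intro: order_trans[OF _ abs_ge_self]\<close>)
  have i2: "integrable gauss (\<lambda>t. t * f t)"
  proof (rule Bochner_Integration.integrable_bound)
    show "integrable gauss (\<lambda>t. K * exp ((c + 1) * \<bar>t\<bar>))"
      using integrable_gauss_exp_abs by simp
    have "\<bar>t\<bar> * \<bar>f t\<bar> \<le> exp \<bar>t\<bar> * (K * exp (c * \<bar>t\<bar>))" for t
      using bf[of t] exp_ge_add_one_self[of "\<bar>t\<bar>"] by (intro mult_mono) linarith+
    then have "\<bar>t * f t\<bar> \<le> K * exp ((c + 1) * \<bar>t\<bar>)" for t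
      by (simp add: abs_mult exp_add algebra_simps)
    then show "AE t in gauss. norm (t * f t) \<le> norm (K * exp ((c + 1) * \<bar>t\<bar>))"
      by (intro AE_I2) (metis abs_ge_self order_trans real_norm_def)
  qed simp
  define D where "D t = ?p t * f' t - ?p t * (t * f t)" for t
  have iD: "integrable lborel D"
    unfolding D_def using i1 i2 by (intro Bochner_Integration.integrable_diff) (simp_all add: integrable_gauss_iff)
  have [measurable]: "D \<in> borel_measurable borel"
    using borel_measurable_integrable[OF iD] by simp
  have dp: "(?p has_real_derivative - t * ?p t) (at t)" for t
  proof -
    have "((\<lambda>t::real. exp (- t\<^sup>2 / 2)) has_real_derivative - t * exp (- t\<^sup>2 / 2)) (at t)"
      by (auto intro!: derivative_eq_intros)
    from DERIV_cmult[OF this, of "1 / sqrt (2 * pi)"] show ?thesis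
      by (simp add: std_normal_density_def[abs_def] mult_ac)
  qed
  have FTC: "(\<integral>t. D t * indicator {- real n..real n} t \<partial>lborel) = ?p n * f n - ?p (- real n) * f (- real n)" for n
  proof (rule integral_FTC_Icc_real)
    fix t
    show "((\<lambda>t. ?p t * f t) has_real_derivative D t) (at t)"
      unfolding D_def by (auto intro!: derivative_eq_intros dp df)
    have "continuous_on UNIV D"
      unfolding D_def std_normal_density_def by (intro continuous_intros cf cont) auto
    then show "isCont D t"
      by (simp add: continuous_on_eq_continuous_at)
  qed simp
  have "(\<lambda>n. \<integral>t. D t * indicator {- real n..real n} t \<partial>lborel) \<longlonglongrightarrow> (\<integral>t. D t \<partial>lborel)"
  proof (rule integral_dominated_convergence[where w = "\<lambda>t. \<bar>D t\<bar>"])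
    show "AE t in lborel. (\<lambda>n. D t * indicator {- real n..real n} t) \<longlonglongrightarrow> D t"
    proof (intro AE_I2)
      fix t :: real
      obtain n0 where "\<bar>t\<bar> \<le> real n0" using real_arch_simple by blast
      then have "eventually (\<lambda>n. D t = D t * indicator {- real n..real n} t) sequentially"
        by (intro eventually_sequentiallyI[of n0]) (auto simp: indicator_def)
      then show "(\<lambda>n. D t * indicator {- real n..real n} t) \<longlonglongrightarrow> D t"
        by (rule Lim_transform_eventually[rotated]) simp
    qed
  qed (use iD in \<open>auto simp: indicator_def\<close>)
  moreover have "(\<lambda>n. ?p (real n) * f (real n) - ?p (- real n) * f (- real n)) \<longlonglongrightarrow> 0 - 0"
  proof (intro tendsto_diff)
    have "\<bar>?p x * f x\<bar> \<le> K * exp (c * \<bar>x\<bar>) * ?p x" for x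
      using mult_left_mono[OF bf[of x] normal_density_nonneg[of 0 1 x]] by (simp add: abs_mult mult_ac)
    moreover have "?p (- x) = ?p x" for x
      by (simp add: std_normal_density_def)
    ultimately have "norm (?p (real n) * f (real n)) \<le> K * exp (c * real n) * ?p (real n)"
        "norm (?p (- real n) * f (- real n)) \<le> K * exp (c * real n) * ?p (real n)" for n
      by (metis abs_of_nat abs_minus_cancel real_norm_def)+
    then show "(\<lambda>n. ?p (real n) * f (real n)) \<longlonglongrightarrow> 0"
      and "(\<lambda>n. ?p (- real n) * f (- real n)) \<longlonglongrightarrow> 0"
      by (auto intro!: Lim_null_comparison[OF always_eventually exp_linear_times_std_normal_tendsto_0[of K c]])
  qed
  ultimately have "(\<integral>t. D t \<partial>lborel) = 0"
    unfolding FTC using LIMSEQ_unique by fastforce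
  moreover have "(\<integral>t. D t \<partial>lborel) = (\<integral>t. f' t \<partial>gauss) - (\<integral>t. t * f t \<partial>gauss)"
    unfolding D_def using i1 i2 by (subst Bochner_Integration.integral_diff) (simp_all add: integrable_gauss_iff integral_gauss)
  ultimately show ?thesis by simp
qed

lemma sum_abs_upd: 
  assumes "finite I" "\<kappa> \<in> I"
  shows "(\<Sum>i\<in>I. \<bar>(\<xi>(\<kappa> := t)) i\<bar>) = \<bar>t::real\<bar> + (\<Sum>i\<in>I - {\<kappa>}. \<bar>\<xi> i\<bar>)"
  using assms by (simp add: sum.remove)

text \<open>
  Fubini singles out the coordinate \<open>\<kappa>\<close>; the others enter the one-dimensional formula as a constant
  factor in the growth bound.
\<close>
lemma gaussN_integration_by_parts:
  fixes f f' :: "('i \<Rightarrow> real) \<Rightarrow> real"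
  assumes I: "finite I" "\<kappa> \<in> I"
    and [measurable]: "f \<in> borel_measurable (gaussN I)" "f' \<in> borel_measurable (gaussN I)"
    and df: "\<And>\<xi> t. ((\<lambda>t. f (\<xi>(\<kappa> := t))) has_real_derivative f' (\<xi>(\<kappa> := t))) (at t)"
    and cont: "\<And>\<xi>. continuous_on UNIV (\<lambda>t. f' (\<xi>(\<kappa> := t)))"
    and bf: "\<And>\<xi>. \<bar>f \<xi>\<bar> \<le> K * exp (c * (\<Sum>i\<in>I. \<bar>\<xi> i\<bar>))"
    and bf': "\<And>\<xi>. \<bar>f' \<xi>\<bar> \<le> K * exp (c * (\<Sum>i\<in>I. \<bar>\<xi> i\<bar>))"
  shows "(\<integral>\<xi>. \<xi> \<kappa> * f \<xi> \<partial>gaussN I) = (\<integral>\<xi>. f' \<xi> \<partial>gaussN I)"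
    and "integrable (gaussN I) (\<lambda>\<xi>. \<xi> \<kappa> * f \<xi>)"
    and "integrable (gaussN I) f'"
proof -
  show i1: "integrable (gaussN I) f'"
    by (rule integrable_gaussN_bound[OF I(1)]) (auto intro: bf')
  show i2: "integrable (gaussN I) (\<lambda>\<xi>. \<xi> \<kappa> * f \<xi>)"
  proof (rule integrable_gaussN_bound[OF I(1)])
    fix \<xi> :: "'i \<Rightarrow> real"
    let ?s = "\<Sum>i\<in>I. \<bar>\<xi> i\<bar>"
    have "\<bar>\<xi> \<kappa>\<bar> \<le> ?s" using I by (intro member_le_sum) auto
    also have "\<dots> \<le> exp ?s" using exp_ge_add_one_self[of ?s] by linarith
    finally have "\<bar>\<xi> \<kappa>\<bar> * \<bar>f \<xi>\<bar> \<le> exp ?s * (K * exp (c * ?s))"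
      using bf[of \<xi>] by (intro mult_mono) auto
    then show "\<bar>\<xi> \<kappa> * f \<xi>\<bar> \<le> K * exp ((c + 1) * ?s)"
      by (simp add: abs_mult exp_add algebra_simps)
  qed (use I in measurable)
  define J where "J = I - {\<kappa>}"
  have J: "finite J" "\<kappa> \<notin> J" "I = insert \<kappa> J" using I by (auto simp: J_def)
  have "(\<integral>\<xi>. \<xi> \<kappa> * f \<xi> \<partial>gaussN I) = (\<integral>\<xi>. (\<integral>t. t * f (\<xi>(\<kappa> := t)) \<partial>gauss) \<partial>gaussN J)"
    using i2 unfolding J(3) by (subst gaussN.product_integral_insert[OF J(1,2)]) auto
  also have "\<dots> = (\<integral>\<xi>. (\<integral>t. f' (\<xi>(\<kappa> := t)) \<partial>gauss) \<partial>gaussN J)"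
  proof (rule Bochner_Integration.integral_cong[OF refl])
    fix \<xi> :: "'i \<Rightarrow> real"
    let ?K = "K * exp (c * (\<Sum>i\<in>J. \<bar>\<xi> i\<bar>))"
    show "(\<integral>t. t * f (\<xi>(\<kappa> := t)) \<partial>gauss) = (\<integral>t. f' (\<xi>(\<kappa> := t)) \<partial>gauss)"
    proof (rule gauss_integration_by_parts[OF df cont, where K = ?K and c = c])
      fix t
      show "\<bar>f (\<xi>(\<kappa> := t))\<bar> \<le> ?K * exp (c * \<bar>t\<bar>)"
        using bf[of "\<xi>(\<kappa> := t)"] unfolding sum_abs_upd[OF I] J_def[symmetric]
        by (simp add: exp_add distrib_left mult_ac)
      show "\<bar>f' (\<xi>(\<kappa> := t))\<bar> \<le> ?K * exp (c * \<bar>t\<bar>)"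
        using bf'[of "\<xi>(\<kappa> := t)"] unfolding sum_abs_upd[OF I] J_def[symmetric]
        by (simp add: exp_add distrib_left mult_ac)
    qed
  qed
  also have "\<dots> = (\<integral>\<xi>. f' \<xi> \<partial>gaussN I)"
    using i1 unfolding J(3) by (subst gaussN.product_integral_insert[OF J(1,2)]) auto
  finally show "(\<integral>\<xi>. \<xi> \<kappa> * f \<xi> \<partial>gaussN I) = (\<integral>\<xi>. f' \<xi> \<partial>gaussN I)" .
qed

text \<open>
  Differentiation under the integral sign: by the mean value theorem \<open>w\<close> dominates the difference
  quotients.
\<close>
lemma has_real_derivative_integral:
  fixes f f' :: "real \<Rightarrow> 'a \<Rightarrow> real"
  assumes int: "\<And>\<theta>. integrable M (f \<theta>)"
    and meas: "f' \<theta> \<in> borel_measurable M"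
    and df: "\<And>\<theta> x. x \<in> space M \<Longrightarrow> ((\<lambda>\<theta>. f \<theta> x) has_real_derivative f' \<theta> x) (at \<theta>)"
    and bound: "\<And>\<theta>' x. x \<in> space M \<Longrightarrow> \<bar>\<theta>' - \<theta>\<bar> \<le> 1 \<Longrightarrow> \<bar>f' \<theta>' x\<bar> \<le> w x"
    and w: "integrable M w"
  shows "((\<lambda>\<theta>. \<integral>x. f \<theta> x \<partial>M) has_real_derivative (\<integral>x. f' \<theta> x \<partial>M)) (at \<theta>)"
proof -
  have "(\<lambda>n. ((\<integral>x. f (\<theta> + h n) x \<partial>M) - (\<integral>x. f \<theta> x \<partial>M)) / h n) \<longlonglongrightarrow> (\<integral>x. f' \<theta> x \<partial>M)"
    if h: "h \<longlonglongrightarrow> 0" and nz: "\<And>n. h n \<noteq> 0" and le: "\<And>n. \<bar>h n\<bar> \<le> 1" for h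
  proof -
    have "(\<lambda>n. \<integral>x. (f (\<theta> + h n) x - f \<theta> x) / h n \<partial>M) \<longlonglongrightarrow> (\<integral>x. f' \<theta> x \<partial>M)"
    proof (rule integral_dominated_convergence[OF _ _ w])
      show "AE x in M. (\<lambda>n. (f (\<theta> + h n) x - f \<theta> x) / h n) \<longlonglongrightarrow> f' \<theta> x"
      proof (rule AE_I2)
        fix x assume "x \<in> space M"
        from df[OF this, of \<theta>]
        have "((\<lambda>h. (f (\<theta> + h) x - f \<theta> x) / h) \<longlongrightarrow> f' \<theta> x) (at 0)"
          by (simp add: DERIV_def)
        then show "(\<lambda>n. (f (\<theta> + h n) x - f \<theta> x) / h n) \<longlonglongrightarrow> f' \<theta> x"
          by (rule filterlim_compose) (use h nz in \<open>auto simp: filterlim_at\<close>)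
      qed
      show "AE x in M. norm ((f (\<theta> + h n) x - f \<theta> x) / h n) \<le> w x" for n
      proof (rule AE_I2)
        fix x assume x: "x \<in> space M"
        have "norm (f (\<theta> + h n) x - f \<theta> x) \<le> w x * norm (\<theta> + h n - \<theta>)"
        proof (rule field_differentiable_bound[where S = "cball \<theta> 1"])
          show "((\<lambda>\<theta>. f \<theta> x) has_field_derivative f' z x) (at z within cball \<theta> 1)" for z
            using df[OF x] by (rule has_field_derivative_at_within)
          show "norm (f' z x) \<le> w x" if "z \<in> cball \<theta> 1" for z
            using bound[OF x, of z] that by (simp add: dist_real_def abs_minus_commute)
        qed (use le in \<open>auto simp: dist_real_def\<close>)
        then show "norm ((f (\<theta> + h n) x - f \<theta> x) / h n) \<le> w x"
          using nz[of n] by (simp add: field_simps abs_divide)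
      qed
    qed (use meas int in auto)
    then show ?thesis
      using int by (simp add: Bochner_Integration.integral_diff)
  qed
  note seq = this
  have "((\<lambda>h. ((\<integral>x. f (\<theta> + h) x \<partial>M) - (\<integral>x. f \<theta> x \<partial>M)) / h) \<longlongrightarrow> (\<integral>x. f' \<theta> x \<partial>M)) (at 0)"
  proof (subst tendsto_at_iff_sequentially, intro allI impI)
    fix X :: "nat \<Rightarrow> real"
    assume X: "\<forall>i. X i \<in> UNIV - {0}" "X \<longlonglongrightarrow> 0"
    then have "eventually (\<lambda>n. \<bar>X n\<bar> < 1) sequentially"
      using tendstoD[OF X(2), of 1] by (simp add: dist_real_def)
    then obtain n0 where n0: "\<And>n. n \<ge> n0 \<Longrightarrow> \<bar>X n\<bar> < 1" by (auto simp: eventually_sequentially)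
    have "(\<lambda>n. ((\<integral>x. f (\<theta> + X (n + n0)) x \<partial>M) - (\<integral>x. f \<theta> x \<partial>M)) / X (n + n0)) \<longlonglongrightarrow> (\<integral>x. f' \<theta> x \<partial>M)"
      using X n0 by (intro seq LIMSEQ_ignore_initial_segment) (auto intro: less_imp_le)
    then show "((\<lambda>h. ((\<integral>x. f (\<theta> + h) x \<partial>M) - (\<integral>x. f \<theta> x \<partial>M)) / h) \<circ> X) \<longlonglongrightarrow> (\<integral>x. f' \<theta> x \<partial>M)"
      unfolding o_def by (rule LIMSEQ_offset)
  qed
  then show ?thesis by (simp add: DERIV_def)
qed

section \<open>Interpolation between two Gaussian processes\<close>

lemma abs_linear_form_le:
  fixes l x :: "'i \<Rightarrow> real"
  assumes "\<And>\<kappa>. \<kappa> \<in> I \<Longrightarrow> \<bar>l \<kappa>\<bar> \<le> B"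
  shows "\<bar>\<Sum>\<kappa>\<in>I. l \<kappa> * x \<kappa>\<bar> \<le> B * (\<Sum>\<kappa>\<in>I. \<bar>x \<kappa>\<bar>)"
  unfolding sum_distrib_left
  by (rule order_trans[OF sum_abs]) (auto simp: abs_mult intro!: sum_mono mult_right_mono assms)

text \<open>
  The comparison principle behind Slepian's and Gordon's inequalities. Along a path \<open>X \<theta>\<close> of Gaussian
  vectors, given as linear images of one standard Gaussian vector, integration by parts shows that
  \<open>E G (X \<theta>)\<close> has derivative \<open>\<Sum>a b. c a b * E (G2 a b (X \<theta>))\<close> with
  \<open>c a b = \<Sum>\<kappa>. L' a \<kappa> \<theta> * L b \<kappa> \<theta>\<close>. If this is nowhere positive, \<open>E G\<close> decreases along the path.
  The derivatives \<open>G1\<close> and \<open>G2\<close> are postulated along differentiable curves; for explicit \<open>G\<close> this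
  chain rule is checked directly, and no topology on the space of functions is involved.
\<close>
lemma gaussian_interpolation:
  fixes G :: "('a \<Rightarrow> real) \<Rightarrow> real" and G1 :: "'a \<Rightarrow> ('a \<Rightarrow> real) \<Rightarrow> real"
    and G2 :: "'a \<Rightarrow> 'a \<Rightarrow> ('a \<Rightarrow> real) \<Rightarrow> real"
    and I :: "'i set" and T :: "'a set" and L L' :: "'a \<Rightarrow> 'i \<Rightarrow> real \<Rightarrow> real"
  defines "X \<equiv> \<lambda>\<theta> \<xi> a. \<Sum>\<kappa>\<in>I. L a \<kappa> \<theta> * \<xi> \<kappa>"
  assumes fin: "finite I" "finite T"
    and dL: "\<And>a \<kappa> \<theta>. (L a \<kappa> has_real_derivative L' a \<kappa> \<theta>) (at \<theta>)"
    and bL: "\<And>a \<kappa> \<theta>. a \<in> T \<Longrightarrow> \<kappa> \<in> I \<Longrightarrow> \<bar>L a \<kappa> \<theta>\<bar> \<le> B"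
    and bL': "\<And>a \<kappa> \<theta>. a \<in> T \<Longrightarrow> \<kappa> \<in> I \<Longrightarrow> \<bar>L' a \<kappa> \<theta>\<bar> \<le> B"
    and dG: "\<And>x x' t. (\<And>a. a \<in> T \<Longrightarrow> (x a has_real_derivative x' a) (at t)) \<Longrightarrow>
        ((\<lambda>s. G (\<lambda>a. x a s)) has_real_derivative (\<Sum>a\<in>T. G1 a (\<lambda>a. x a t) * x' a)) (at t)"
    and dG1: "\<And>a x x' t. a \<in> T \<Longrightarrow> (\<And>a. a \<in> T \<Longrightarrow> (x a has_real_derivative x' a) (at t)) \<Longrightarrow>
        ((\<lambda>s. G1 a (\<lambda>a. x a s)) has_real_derivative (\<Sum>b\<in>T. G2 a b (\<lambda>a. x a t) * x' b)) (at t)"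
    and cG2: "\<And>a b x. a \<in> T \<Longrightarrow> b \<in> T \<Longrightarrow> (\<And>a. a \<in> T \<Longrightarrow> continuous_on UNIV (x a)) \<Longrightarrow>
        continuous_on UNIV (\<lambda>s::real. G2 a b (\<lambda>a. x a s))"
    and mG: "\<And>x. (\<And>a. a \<in> T \<Longrightarrow> x a \<in> borel_measurable (gaussN I)) \<Longrightarrow>
        (\<lambda>\<xi>. G (\<lambda>a. x a \<xi>)) \<in> borel_measurable (gaussN I)"
    and mG1: "\<And>a x. a \<in> T \<Longrightarrow> (\<And>a. a \<in> T \<Longrightarrow> x a \<in> borel_measurable (gaussN I)) \<Longrightarrow>
        (\<lambda>\<xi>. G1 a (\<lambda>a. x a \<xi>)) \<in> borel_measurable (gaussN I)"
    and mG2: "\<And>a b x. a \<in> T \<Longrightarrow> b \<in> T \<Longrightarrow> (\<And>a. a \<in> T \<Longrightarrow> x a \<in> borel_measurable (gaussN I)) \<Longrightarrow>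
        (\<lambda>\<xi>. G2 a b (\<lambda>a. x a \<xi>)) \<in> borel_measurable (gaussN I)"
    and bG: "\<And>x. \<bar>G x\<bar> \<le> K * exp (\<Sum>a\<in>T. \<bar>x a\<bar>)"
    and bG1: "\<And>a x. a \<in> T \<Longrightarrow> \<bar>G1 a x\<bar> \<le> K * exp (\<Sum>a\<in>T. \<bar>x a\<bar>)"
    and bG2: "\<And>a b x. a \<in> T \<Longrightarrow> b \<in> T \<Longrightarrow> \<bar>G2 a b x\<bar> \<le> K * exp (\<Sum>a\<in>T. \<bar>x a\<bar>)"
    and sign: "\<And>\<theta> x. \<alpha> \<le> \<theta> \<Longrightarrow> \<theta> \<le> \<beta> \<Longrightarrow>
        (\<Sum>a\<in>T. \<Sum>b\<in>T. (\<Sum>\<kappa>\<in>I. L' a \<kappa> \<theta> * L b \<kappa> \<theta>) * G2 a b x) \<le> 0"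
    and "\<alpha> \<le> \<beta>"
  shows "(\<integral>\<xi>. G (X \<beta> \<xi>) \<partial>gaussN I) \<le> (\<integral>\<xi>. G (X \<alpha> \<xi>) \<partial>gaussN I)"
    and "\<And>\<theta>. integrable (gaussN I) (\<lambda>\<xi>. G (X \<theta> \<xi>))"
proof -
  have K: "K \<ge> 0"
    using bG[of "\<lambda>_. 0"] by simp
  define B' where "B' = \<bar>B\<bar>"
  have B: "\<bar>L a \<kappa> \<theta>\<bar> \<le> B'" "\<bar>L' a \<kappa> \<theta>\<bar> \<le> B'" "B' \<ge> 0" if "a \<in> T" "\<kappa> \<in> I" for a \<kappa> \<theta>
    using order_trans[OF bL[OF that] abs_ge_self] order_trans[OF bL'[OF that] abs_ge_self]
    by (auto simp: B'_def)
  have B0: "B' \<ge> 0" by (simp add: B'_def)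
  have mX: "(\<lambda>\<xi>. X \<theta> \<xi> a) \<in> borel_measurable (gaussN I)" for \<theta> a
    unfolding X_def by measurable
  define C where "C = real (card T) * B'"
  have C0: "C \<ge> 0" by (simp add: C_def B0)
  have sX: "(\<Sum>a\<in>T. \<bar>X \<theta> \<xi> a\<bar>) \<le> C * (\<Sum>\<kappa>\<in>I. \<bar>\<xi> \<kappa>\<bar>)" for \<theta> \<xi>
  proof -
    have "(\<Sum>a\<in>T. \<bar>X \<theta> \<xi> a\<bar>) \<le> (\<Sum>a\<in>T. B' * (\<Sum>\<kappa>\<in>I. \<bar>\<xi> \<kappa>\<bar>))"
      unfolding X_def by (intro sum_mono abs_linear_form_le B)
    then show ?thesis by (simp add: C_def mult.assoc)
  qed
  have eX: "K * exp (\<Sum>a\<in>T. \<bar>X \<theta> \<xi> a\<bar>) \<le> K * exp (C * (\<Sum>\<kappa>\<in>I. \<bar>\<xi> \<kappa>\<bar>))" for \<theta> \<xi>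
    using sX K by (intro mult_left_mono) auto
  have bGX: "\<bar>G (X \<theta> \<xi>)\<bar> \<le> K * exp (C * (\<Sum>\<kappa>\<in>I. \<bar>\<xi> \<kappa>\<bar>))" for \<theta> \<xi>
    using bG eX by (rule order_trans)
  have bG1X: "\<bar>G1 a (X \<theta> \<xi>)\<bar> \<le> K * exp (C * (\<Sum>\<kappa>\<in>I. \<bar>\<xi> \<kappa>\<bar>))" if "a \<in> T" for a \<theta> \<xi>
    using bG1[OF that] eX by (rule order_trans)
  have bG2X: "\<bar>G2 a b (X \<theta> \<xi>)\<bar> \<le> K * exp (C * (\<Sum>\<kappa>\<in>I. \<bar>\<xi> \<kappa>\<bar>))" if "a \<in> T" "b \<in> T" for a b \<theta> \<xi>
    using bG2[OF that] eX by (rule order_trans)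
  show int: "integrable (gaussN I) (\<lambda>\<xi>. G (X \<theta> \<xi>))" for \<theta>
    by (rule integrable_gaussN_bound[OF fin(1) _ bGX]) (intro mG mX)
  define D where "D \<theta> \<xi> = (\<Sum>a\<in>T. G1 a (X \<theta> \<xi>) * (\<Sum>\<kappa>\<in>I. L' a \<kappa> \<theta> * \<xi> \<kappa>))" for \<theta> \<xi>
  have dX: "((\<lambda>\<theta>. X \<theta> \<xi> a) has_real_derivative (\<Sum>\<kappa>\<in>I. L' a \<kappa> \<theta> * \<xi> \<kappa>)) (at \<theta>)" for \<theta> \<xi> a
    unfolding X_def by (intro DERIV_sum DERIV_cmult_right dL)
  have bD: "\<bar>D \<theta> \<xi>\<bar> \<le> (card T * K * B') * exp ((C + 1) * (\<Sum>\<kappa>\<in>I. \<bar>\<xi> \<kappa>\<bar>))" for \<theta> \<xi>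
  proof -
    let ?s = "\<Sum>\<kappa>\<in>I. \<bar>\<xi> \<kappa>\<bar>"
    have "?s \<le> exp ?s" using exp_ge_add_one_self[of ?s] by linarith
    moreover have "?s \<ge> 0" by (intro sum_nonneg) auto
    ultimately have "\<bar>G1 a (X \<theta> \<xi>) * (\<Sum>\<kappa>\<in>I. L' a \<kappa> \<theta> * \<xi> \<kappa>)\<bar> \<le> (K * exp (C * ?s)) * (B' * exp ?s)"
      if "a \<in> T" for a
      unfolding abs_mult using that bG1X[OF that] K B0
      by (intro mult_mono order_trans[OF abs_linear_form_le[OF B(2)[OF that]]] mult_left_mono) auto
    then have "\<bar>D \<theta> \<xi>\<bar> \<le> (\<Sum>a\<in>T. (K * exp (C * ?s)) * (B' * exp ?s))"
      unfolding D_def by (intro order_trans[OF sum_abs] sum_mono)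
    then show ?thesis by (simp add: exp_add distrib_right mult_ac)
  qed
  have mD: "D \<theta> \<in> borel_measurable (gaussN I)" for \<theta>
    unfolding D_def by (intro borel_measurable_sum borel_measurable_times mG1 mX) measurable
  have deriv: "((\<lambda>\<theta>. \<integral>\<xi>. G (X \<theta> \<xi>) \<partial>gaussN I) has_real_derivative (\<integral>\<xi>. D \<theta> \<xi> \<partial>gaussN I)) (at \<theta>)" for \<theta>
  proof (rule has_real_derivative_integral[OF int mD])
    show "((\<lambda>\<theta>. G (X \<theta> \<xi>)) has_real_derivative D \<theta> \<xi>) (at \<theta>)" for \<theta> \<xi>
      unfolding D_def by (rule dG) (rule dX)
    show "integrable (gaussN I) (\<lambda>\<xi>. (card T * K * B') * exp ((C + 1) * (\<Sum>\<kappa>\<in>I. \<bar>\<xi> \<kappa>\<bar>)))"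
      by (intro integrable_mult_right integrable_gaussN_exp fin)
  qed (rule bD)
  have ibp: "(\<integral>\<xi>. \<xi> \<kappa> * G1 a (X \<theta> \<xi>) \<partial>gaussN I) = (\<integral>\<xi>. (\<Sum>b\<in>T. G2 a b (X \<theta> \<xi>) * L b \<kappa> \<theta>) \<partial>gaussN I)"
      "integrable (gaussN I) (\<lambda>\<xi>. \<xi> \<kappa> * G1 a (X \<theta> \<xi>))"
      "integrable (gaussN I) (\<lambda>\<xi>. \<Sum>b\<in>T. G2 a b (X \<theta> \<xi>) * L b \<kappa> \<theta>)"
    if a: "a \<in> T" and \<kappa>: "\<kappa> \<in> I" for a \<kappa> \<theta>
  proof -
    have upd: "X \<theta> (\<xi>(\<kappa> := t)) b = L b \<kappa> \<theta> * t + (\<Sum>\<kappa>'\<in>I - {\<kappa>}. L b \<kappa>' \<theta> * \<xi> \<kappa>')" for \<xi> t b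
      unfolding X_def using fin \<kappa> by (simp add: sum.remove)
    have df: "((\<lambda>t. G1 a (X \<theta> (\<xi>(\<kappa> := t)))) has_real_derivative
        (\<Sum>b\<in>T. G2 a b (X \<theta> (\<xi>(\<kappa> := t))) * L b \<kappa> \<theta>)) (at t)" for \<xi> t
    proof (rule dG1[OF a])
      show "((\<lambda>t. X \<theta> (\<xi>(\<kappa> := t)) b) has_real_derivative L b \<kappa> \<theta>) (at t)" for b
        unfolding upd by (auto intro!: derivative_eq_intros)
    qed
    have cont: "continuous_on UNIV (\<lambda>t. \<Sum>b\<in>T. G2 a b (X \<theta> (\<xi>(\<kappa> := t))) * L b \<kappa> \<theta>)" for \<xi>
    proof (intro continuous_intros cG2[OF a])
      show "continuous_on UNIV (\<lambda>t. X \<theta> (\<xi>(\<kappa> := t)) b)" for b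
        unfolding upd by (intro continuous_intros)
    qed
    define K' where "K' = K + card T * (K * B')"
    have KK: "K \<le> K'" "card T * (K * B') \<le> K'" using K B0 by (auto simp: K'_def)
    have b1: "\<bar>G1 a (X \<theta> \<xi>)\<bar> \<le> K' * exp (C * (\<Sum>i\<in>I. \<bar>\<xi> i\<bar>))" for \<xi>
      using bG1X[OF a] KK(1) by (rule order_trans[OF _ mult_right_mono]) auto
    have b2: "\<bar>\<Sum>b\<in>T. G2 a b (X \<theta> \<xi>) * L b \<kappa> \<theta>\<bar> \<le> K' * exp (C * (\<Sum>i\<in>I. \<bar>\<xi> i\<bar>))" for \<xi>
    proof -
      have "\<bar>\<Sum>b\<in>T. G2 a b (X \<theta> \<xi>) * L b \<kappa> \<theta>\<bar> \<le> (\<Sum>b\<in>T. (K * exp (C * (\<Sum>i\<in>I. \<bar>\<xi> i\<bar>))) * B')"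
        using K by (intro order_trans[OF sum_abs] sum_mono)
          (auto simp: abs_mult intro!: mult_mono bG2X a B(1) \<kappa>)
      also have "\<dots> = card T * (K * B') * exp (C * (\<Sum>i\<in>I. \<bar>\<xi> i\<bar>))" by simp
      also have "\<dots> \<le> K' * exp (C * (\<Sum>i\<in>I. \<bar>\<xi> i\<bar>))"
        using KK(2) by (rule mult_right_mono) auto
      finally show ?thesis .
    qed
    have m1: "(\<lambda>\<xi>. G1 a (X \<theta> \<xi>)) \<in> borel_measurable (gaussN I)"
      by (intro mG1 mX a)
    have m2: "(\<lambda>\<xi>. \<Sum>b\<in>T. G2 a b (X \<theta> \<xi>) * L b \<kappa> \<theta>) \<in> borel_measurable (gaussN I)"
      by (intro borel_measurable_sum borel_measurable_times mG2 mX a) auto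
    note * = gaussN_integration_by_parts[OF fin(1) \<kappa> m1 m2 df cont b1 b2]
    show "(\<integral>\<xi>. \<xi> \<kappa> * G1 a (X \<theta> \<xi>) \<partial>gaussN I) = (\<integral>\<xi>. (\<Sum>b\<in>T. G2 a b (X \<theta> \<xi>) * L b \<kappa> \<theta>) \<partial>gaussN I)"
      "integrable (gaussN I) (\<lambda>\<xi>. \<xi> \<kappa> * G1 a (X \<theta> \<xi>))"
      "integrable (gaussN I) (\<lambda>\<xi>. \<Sum>b\<in>T. G2 a b (X \<theta> \<xi>) * L b \<kappa> \<theta>)"
      by (rule *)+
  qed
  have neg: "(\<integral>\<xi>. D \<theta> \<xi> \<partial>gaussN I) \<le> 0" if "\<alpha> \<le> \<theta>" "\<theta> \<le> \<beta>" for \<theta>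
  proof -
    have "(\<integral>\<xi>. D \<theta> \<xi> \<partial>gaussN I) =
        (\<integral>\<xi>. (\<Sum>a\<in>T. \<Sum>\<kappa>\<in>I. L' a \<kappa> \<theta> * (\<xi> \<kappa> * G1 a (X \<theta> \<xi>))) \<partial>gaussN I)"
      unfolding D_def by (simp add: sum_distrib_left mult_ac)
    also have "\<dots> = (\<Sum>a\<in>T. \<Sum>\<kappa>\<in>I. L' a \<kappa> \<theta> * (\<integral>\<xi>. \<xi> \<kappa> * G1 a (X \<theta> \<xi>) \<partial>gaussN I))"
      using ibp(2) by (simp add: Bochner_Integration.integral_sum)
    also have "\<dots> = (\<Sum>a\<in>T. \<Sum>\<kappa>\<in>I. L' a \<kappa> \<theta> * (\<integral>\<xi>. (\<Sum>b\<in>T. G2 a b (X \<theta> \<xi>) * L b \<kappa> \<theta>) \<partial>gaussN I))"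
      using ibp(1) by simp
    also have "\<dots> = (\<integral>\<xi>. (\<Sum>a\<in>T. \<Sum>\<kappa>\<in>I. L' a \<kappa> \<theta> * (\<Sum>b\<in>T. G2 a b (X \<theta> \<xi>) * L b \<kappa> \<theta>)) \<partial>gaussN I)"
      using ibp(3) by (simp add: Bochner_Integration.integral_sum)
    also have "\<dots> = - (\<integral>\<xi>. - (\<Sum>a\<in>T. \<Sum>b\<in>T. (\<Sum>\<kappa>\<in>I. L' a \<kappa> \<theta> * L b \<kappa> \<theta>) * G2 a b (X \<theta> \<xi>)) \<partial>gaussN I)"
      by (simp add: sum_distrib_left sum_distrib_right sum.swap[of _ I] mult_ac)
    also have "\<dots> \<le> 0"
      using sign[OF that] by (simp add: Bochner_Integration.integral_nonneg del: Bochner_Integration.integral_minus)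
    finally show ?thesis .
  qed
  show "(\<integral>\<xi>. G (X \<beta> \<xi>) \<partial>gaussN I) \<le> (\<integral>\<xi>. G (X \<alpha> \<xi>) \<partial>gaussN I)"
    using \<open>\<alpha> \<le> \<beta>\<close> by (rule DERIV_nonpos_imp_nonincreasing) (use deriv neg in blast)
qed

section \<open>Gordon's comparison for a smoothed minimum of norms\<close>

text \<open>
  The index \<open>z\<close> stands for a unit vector. A point \<open>x\<close> assigns to each \<open>z\<close> a vector
  \<open>x (z, 1), \<dots>, x (z, m)\<close> and an extra number \<open>x (z, 0)\<close>, and the quantity of interest is the minimum over
  \<open>z\<close> of \<open>\<parallel>x (z, _)\<parallel> + x (z, 0)\<close>. The parameter \<open>\<epsilon>\<close> smooths the Euclidean norm at the origin, and \<open>\<beta>\<close>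
  is the inverse temperature that smooths the minimum.
\<close>
locale softmin =
  fixes F :: "'z set" and m :: nat and \<epsilon> \<beta> :: real
  assumes finF: "finite F" and neF: "F \<noteq> {}" and \<epsilon>: "\<epsilon> > 0" and \<beta>: "\<beta> \<ge> 1"
begin

definition coords :: "('z \<times> nat) set" where "coords = F \<times> {0..m}"

definition snorm :: "('z \<times> nat \<Rightarrow> real) \<Rightarrow> 'z \<Rightarrow> real" where
  "snorm x z = sqrt (\<epsilon>\<^sup>2 + (\<Sum>i\<in>{1..m}. (x (z, i))\<^sup>2))"

definition gibbs_weight :: "('z \<times> nat \<Rightarrow> real) \<Rightarrow> 'z \<Rightarrow> real" where
  "gibbs_weight x z = exp (- \<beta> * (snorm x z + x (z, 0)))"

definition partition_sum :: "('z \<times> nat \<Rightarrow> real) \<Rightarrow> real" where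
  "partition_sum x = (\<Sum>z\<in>F. gibbs_weight x z)"

text \<open>
  This tends to \<open>max exp (- (\<parallel>x (z, _)\<parallel> + x (z, 0)))\<close> as \<open>\<beta> \<rightarrow> \<infinity>\<close> and \<open>\<epsilon> \<rightarrow> 0\<close>.
\<close>
definition softmax :: "('z \<times> nat \<Rightarrow> real) \<Rightarrow> real" where
  "softmax x = exp (ln (partition_sum x) / \<beta>)"

definition gibbs_prob :: "('z \<times> nat \<Rightarrow> real) \<Rightarrow> 'z \<Rightarrow> real" where
  "gibbs_prob x z = gibbs_weight x z / partition_sum x"

text \<open>
  The gradient in \<open>x (z, _)\<close> of the exponent \<open>snorm x z + x (z, 0)\<close>; the next function is its Hessian.
\<close>
definition norm_grad :: "('z \<times> nat \<Rightarrow> real) \<Rightarrow> 'z \<times> nat \<Rightarrow> real" where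
  "norm_grad x a = (if snd a = 0 then 1 else x a / snorm x (fst a))"

definition norm_hess :: "('z \<times> nat \<Rightarrow> real) \<Rightarrow> 'z \<times> nat \<Rightarrow> 'z \<times> nat \<Rightarrow> real" where
  "norm_hess x a b = (if snd a = 0 \<or> snd b = 0 then 0
     else ((if a = b then 1 else 0) - norm_grad x a * norm_grad x b) / snorm x (fst a))"

definition softmax_d :: "'z \<times> nat \<Rightarrow> ('z \<times> nat \<Rightarrow> real) \<Rightarrow> real" where
  "softmax_d a x = - (softmax x * gibbs_prob x (fst a) * norm_grad x a)"

text \<open>
  In \<open>softmax_dd\<close> the first summand has the sign of \<open>1 - \<beta>\<close> apart from the gradients: raising the exponent
  of one \<open>z\<close> shifts weight to the others. The second summand collects the derivatives of the weight and of the
  gradient that belong to \<open>fst a\<close> itself.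
\<close>
definition softmax_dd :: "'z \<times> nat \<Rightarrow> 'z \<times> nat \<Rightarrow> ('z \<times> nat \<Rightarrow> real) \<Rightarrow> real" where
  "softmax_dd a b x = (1 - \<beta>) * (softmax x * gibbs_prob x (fst a) * gibbs_prob x (fst b) * norm_grad x a * norm_grad x b)
     + (if fst a = fst b then \<beta> * (softmax x * gibbs_prob x (fst a) * norm_grad x a * norm_grad x b) - softmax x * gibbs_prob x (fst a) * norm_hess x a b else 0)"

lemma finite_coords: "finite coords"
  by (simp add: coords_def finF)

lemma coordsI: "z \<in> F \<Longrightarrow> i \<le> m \<Longrightarrow> (z, i) \<in> coords"
  by (simp add: coords_def)

lemma sum_coords: "(\<Sum>a\<in>coords. f a) = (\<Sum>z\<in>F. \<Sum>i\<in>{0..m}. f (z, i))"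
  by (simp add: coords_def sum.cartesian_product)

lemma sum_split_first: "(\<Sum>i\<in>{0..m}. f i) = f 0 + (\<Sum>i\<in>{1..m}. f i)" for f :: "nat \<Rightarrow> real"
  by (simp add: sum.atLeast_Suc_atMost)

lemma snorm_ge: "snorm x z \<ge> \<epsilon>"
proof -
  have "sqrt (\<epsilon>\<^sup>2) \<le> snorm x z"
    unfolding snorm_def by (intro real_sqrt_le_mono) (simp add: sum_nonneg)
  then show ?thesis using \<epsilon> by simp
qed

lemma snorm_pos: "snorm x z > 0" 
  using snorm_ge[of x z] \<epsilon> by linarith

lemma snorm_neq0 [simp]: "snorm x z \<noteq> 0"
  using snorm_pos[of x z] by simp

lemma snorm_sq: "(snorm x z)\<^sup>2 = \<epsilon>\<^sup>2 + (\<Sum>i\<in>{1..m}. (x (z, i))\<^sup>2)"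
  unfolding snorm_def by (simp add: sum_nonneg)

text \<open>
  The smoothed norm is still 1-Lipschitz, so inner products of its gradients are at most \<open>1\<close>, which
  decides the sign in Gordon's comparison.
\<close>
lemma sum_norm_grad_sq_le: "(\<Sum>i\<in>{1..m}. (norm_grad x (z, i))\<^sup>2) \<le> 1"
proof -
  have "(\<Sum>i\<in>{1..m}. (norm_grad x (z, i))\<^sup>2) = (\<Sum>i\<in>{1..m}. (x (z, i))\<^sup>2) / (snorm x z)\<^sup>2"
    by (simp add: norm_grad_def power_divide sum_divide_distrib)
  also have "\<dots> \<le> 1"
    using zero_less_power[OF snorm_pos, of x z 2] by (subst divide_le_eq_1_pos) (simp_all add: snorm_sq)
  finally show ?thesis .
qed

lemma abs_norm_grad_le: "a \<in> coords \<Longrightarrow> \<bar>norm_grad x a\<bar> \<le> 1"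
proof (cases "snd a = 0")
  case False
  assume "a \<in> coords"
  then obtain z i where a: "a = (z, i)" "i \<in> {1..m}" using False by (auto simp: coords_def)
  have "(norm_grad x (z, i))\<^sup>2 \<le> (\<Sum>i\<in>{1..m}. (norm_grad x (z, i))\<^sup>2)"
    using a by (intro member_le_sum) auto
  then have "(norm_grad x a)\<^sup>2 \<le> 1" using sum_norm_grad_sq_le[of x z] a by simp
  then show ?thesis by (simp add: abs_square_le_1)
qed (simp add: norm_grad_def)

lemma gibbs_weight_pos: "gibbs_weight x z > 0"
  by (simp add: gibbs_weight_def)

lemma partition_sum_pos: "partition_sum x > 0"
  unfolding partition_sum_def using finF neF by (intro sum_pos gibbs_weight_pos) auto

lemma partition_sum_neq0 [simp]: "partition_sum x \<noteq> 0"
  using partition_sum_pos[of x] by simp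

lemma softmax_pos: "softmax x > 0"
  by (simp add: softmax_def)

lemma gibbs_prob_nonneg: "gibbs_prob x z \<ge> 0"
  using partition_sum_pos[of x] gibbs_weight_pos[of x z] by (simp add: gibbs_prob_def)

lemma gibbs_prob_le_1: "z \<in> F \<Longrightarrow> gibbs_prob x z \<le> 1"
proof -
  assume "z \<in> F"
  then have "gibbs_weight x z \<le> partition_sum x"
    unfolding partition_sum_def using finF gibbs_weight_pos by (intro member_le_sum) (auto intro: less_imp_le)
  then show ?thesis using partition_sum_pos[of x] by (simp add: gibbs_prob_def)
qed

text \<open>
  This and the next two lemmas are the growth bounds needed for interpolation: the logarithm of \<open>softmax\<close>
  grows at most linearly, and weights, gradients and Hessians are bounded.
\<close>
lemma softmax_bound: "softmax x \<le> card F * exp (\<Sum>a\<in>coords. \<bar>x a\<bar>)"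
proof -
  let ?s = "\<Sum>a\<in>coords. \<bar>x a\<bar>"
  have card: "real (card F) \<ge> 1"
    using finF neF by (simp add: Suc_leI card_gt_0_iff)
  have "gibbs_weight x z \<le> exp (\<beta> * ?s)" if "z \<in> F" for z
  proof -
    have "- x (z, 0) \<le> \<bar>x (z, 0)\<bar>" by simp
    also have "\<dots> \<le> ?s" using that coordsI[of z 0] finite_coords by (intro member_le_sum) auto
    finally show ?thesis
      using \<beta> snorm_pos[of x z] unfolding gibbs_weight_def
      by (auto simp: mult_minus_right[symmetric] simp del: mult_minus_right)
  qed
  then have "partition_sum x \<le> card F * exp (\<beta> * ?s)"
    unfolding partition_sum_def by (rule sum_bounded_above)
  then have "ln (partition_sum x) \<le> ln (card F * exp (\<beta> * ?s))"
    using partition_sum_pos by (simp add: ln_mono)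
  also have "\<dots> = ln (card F) + \<beta> * ?s"
    using card by (simp add: ln_mult)
  finally have "ln (partition_sum x) / \<beta> \<le> ln (card F) / \<beta> + ?s"
    using \<beta> by (simp add: field_simps)
  also have "ln (card F) / \<beta> \<le> ln (card F)"
    using card \<beta> by (simp add: divide_le_eq mult_le_cancel_left1)
  finally have "softmax x \<le> exp (ln (card F) + ?s)" unfolding softmax_def by simp
  then show ?thesis using card by (simp add: exp_add)
qed

lemma softmax_d_bound: "a \<in> coords \<Longrightarrow> \<bar>softmax_d a x\<bar> \<le> softmax x"
proof -
  assume a: "a \<in> coords"
  then have "gibbs_prob x (fst a) * \<bar>norm_grad x a\<bar> \<le> 1 * 1"
    using gibbs_prob_nonneg by (intro mult_mono gibbs_prob_le_1 abs_norm_grad_le) (auto simp: coords_def)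
  from mult_left_mono[OF this, of "softmax x"] show ?thesis
    using softmax_pos[of x] gibbs_prob_nonneg[of x "fst a"] by (simp add: softmax_d_def abs_mult mult_ac)
qed

lemma softmax_dd_bound: "a \<in> coords \<Longrightarrow> b \<in> coords \<Longrightarrow> \<bar>softmax_dd a b x\<bar> \<le> (2 * \<beta> + 2 / \<epsilon>) * softmax x"
proof -
  assume a: "a \<in> coords" and b: "b \<in> coords"
  have pa: "0 \<le> gibbs_prob x (fst a)" "gibbs_prob x (fst a) \<le> 1" "0 \<le> gibbs_prob x (fst b)" "gibbs_prob x (fst b) \<le> 1"
    using a b by (auto simp: coords_def gibbs_prob_nonneg gibbs_prob_le_1)
  have uu: "\<bar>norm_grad x a * norm_grad x b\<bar> \<le> 1"
    using abs_norm_grad_le[OF a] abs_norm_grad_le[OF b] by (simp add: abs_mult mult_le_one)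
  have norm_hess: "\<bar>norm_hess x a b\<bar> \<le> 2 / \<epsilon>"
  proof -
    have "\<bar>(if a = b then 1 else 0) - norm_grad x a * norm_grad x b\<bar> \<le> 2"
      using uu by (auto simp: abs_le_iff)
    then have "\<bar>(if a = b then 1 else 0) - norm_grad x a * norm_grad x b\<bar> / snorm x (fst a) \<le> 2 / \<epsilon>"
      using snorm_ge \<epsilon> by (intro frac_le) auto
    then show ?thesis using snorm_pos[of x "fst a"] \<epsilon> by (simp add: norm_hess_def abs_divide)
  qed
  have 1: "\<bar>gibbs_prob x (fst a) * gibbs_prob x (fst b) * (norm_grad x a * norm_grad x b)\<bar> \<le> 1"
    using pa uu by (simp add: abs_mult mult_le_one)
  have 2: "\<bar>gibbs_prob x (fst a) * (norm_grad x a * norm_grad x b)\<bar> \<le> 1"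
    using pa uu by (simp add: abs_mult mult_le_one)
  have 3: "\<bar>gibbs_prob x (fst a) * norm_hess x a b\<bar> \<le> 2 / \<epsilon>"
    using pa norm_hess mult_mono[of "gibbs_prob x (fst a)" 1 "\<bar>norm_hess x a b\<bar>" "2 / \<epsilon>"] by (simp add: abs_mult)
  define A where "A = gibbs_prob x (fst a) * gibbs_prob x (fst b) * (norm_grad x a * norm_grad x b)"
  define B where "B = gibbs_prob x (fst a) * (norm_grad x a * norm_grad x b)"
  define C where "C = gibbs_prob x (fst a) * norm_hess x a b"
  have "softmax_dd a b x = softmax x * ((1 - \<beta>) * A + (if fst a = fst b then \<beta> * B - C else 0))"
    by (simp add: softmax_dd_def A_def B_def C_def algebra_simps)
  moreover have "\<bar>(1 - \<beta>) * A\<bar> \<le> \<beta>" "\<bar>\<beta> * B\<bar> \<le> \<beta>" "\<bar>C\<bar> \<le> 2 / \<epsilon>"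
    using 1 2 3 \<beta> mult_mono[of "\<bar>1 - \<beta>\<bar>" \<beta> "\<bar>A\<bar>" 1] mult_left_mono[of "\<bar>B\<bar>" 1 \<beta>]
    by (auto simp: A_def B_def C_def abs_mult)
  then have "\<bar>(1 - \<beta>) * A + (if fst a = fst b then \<beta> * B - C else 0)\<bar> \<le> 2 * \<beta> + 2 / \<epsilon>"
    using \<beta> \<epsilon> by auto
  ultimately show ?thesis
    using softmax_pos[of x] by (simp add: abs_mult mult.commute)
qed

context
  fixes x :: "'z \<times> nat \<Rightarrow> real \<Rightarrow> real" and x' :: "'z \<times> nat \<Rightarrow> real" and t :: real
  assumes dx: "\<And>a. a \<in> coords \<Longrightarrow> (x a has_real_derivative x' a) (at t)"
begin

abbreviation (input) y :: "real \<Rightarrow> 'z \<times> nat \<Rightarrow> real" where "y \<equiv> \<lambda>s a. x a s"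

lemma deriv_snorm:
  assumes "z \<in> F"
  shows "((\<lambda>s. snorm (y s) z) has_real_derivative (\<Sum>i\<in>{1..m}. norm_grad (y t) (z, i) * x' (z, i))) (at t)"
proof -
  have "((\<lambda>s. \<Sum>i\<in>{1..m}. (x (z, i) s)\<^sup>2) has_real_derivative (\<Sum>i\<in>{1..m}. 2 * x (z, i) t * x' (z, i))) (at t)"
    using assms by (intro DERIV_sum) (auto intro!: derivative_eq_intros dx coordsI)
  from DERIV_chain2[OF DERIV_real_sqrt DERIV_add[OF DERIV_const this], of "\<epsilon>\<^sup>2"]
  have "((\<lambda>s. snorm (y s) z) has_real_derivative
      (\<Sum>i\<in>{1..m}. 2 * x (z, i) t * x' (z, i)) / (2 * snorm (y t) z)) (at t)"
    using \<epsilon> by (simp add: snorm_def add_pos_nonneg sum_nonneg field_simps)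
  also have "(\<Sum>i\<in>{1..m}. 2 * x (z, i) t * x' (z, i)) / (2 * snorm (y t) z) =
      (\<Sum>i\<in>{1..m}. norm_grad (y t) (z, i) * x' (z, i))"
    by (simp add: norm_grad_def sum_divide_distrib mult.assoc)
  finally show ?thesis .
qed

lemma deriv_gibbs_weight:
  assumes "z \<in> F"
  shows "((\<lambda>s. gibbs_weight (y s) z) has_real_derivative
    - \<beta> * gibbs_weight (y t) z * (\<Sum>i\<in>{0..m}. norm_grad (y t) (z, i) * x' (z, i))) (at t)"
proof -
  have "((\<lambda>s. - \<beta> * (snorm (y s) z + x (z, 0) s)) has_real_derivative
      - \<beta> * ((\<Sum>i\<in>{1..m}. norm_grad (y t) (z, i) * x' (z, i)) + x' (z, 0))) (at t)"
    using assms by (intro DERIV_cmult DERIV_add deriv_snorm dx coordsI) auto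
  from DERIV_fun_exp[OF this] show ?thesis
    unfolding gibbs_weight_def sum_split_first by (rule DERIV_cong) (simp add: norm_grad_def algebra_simps)
qed

lemma deriv_partition_sum:
  "((\<lambda>s. partition_sum (y s)) has_real_derivative
    - \<beta> * (\<Sum>z\<in>F. gibbs_weight (y t) z * (\<Sum>i\<in>{0..m}. norm_grad (y t) (z, i) * x' (z, i)))) (at t)"
  unfolding partition_sum_def
  by (rule DERIV_cong[OF DERIV_sum[OF deriv_gibbs_weight]]) (auto simp: sum_distrib_left mult_ac)

abbreviation (input) "P \<equiv> (\<Sum>z\<in>F. gibbs_prob (y t) z * (\<Sum>i\<in>{0..m}. norm_grad (y t) (z, i) * x' (z, i)))"

lemma deriv_partition_sum': "((\<lambda>s. partition_sum (y s)) has_real_derivative - \<beta> * partition_sum (y t) * P) (at t)"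
  by (rule DERIV_cong[OF deriv_partition_sum]) (simp add: gibbs_prob_def sum_distrib_left sum_divide_distrib)

lemma deriv_softmax_mean: "((\<lambda>s. softmax (y s)) has_real_derivative - softmax (y t) * P) (at t)"
  unfolding softmax_def
  by (rule DERIV_cong[OF DERIV_fun_exp[OF DERIV_cdivide[OF DERIV_chain2[OF DERIV_ln[OF partition_sum_pos] deriv_partition_sum']]]])
     (use \<beta> in \<open>simp add: field_simps\<close>)

lemma deriv_gibbs_prob:
  assumes "z \<in> F"
  shows "((\<lambda>s. gibbs_prob (y s) z) has_real_derivative
    \<beta> * gibbs_prob (y t) z * (P - (\<Sum>i\<in>{0..m}. norm_grad (y t) (z, i) * x' (z, i)))) (at t)"
proof -
  have "((\<lambda>s. gibbs_prob (y s) z) has_real_derivative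
     (- \<beta> * gibbs_weight (y t) z * (\<Sum>i\<in>{0..m}. norm_grad (y t) (z, i) * x' (z, i)) * partition_sum (y t) -
       gibbs_weight (y t) z * (- \<beta> * partition_sum (y t) * P)) / (partition_sum (y t) * partition_sum (y t))) (at t)"
    using DERIV_divide[OF deriv_gibbs_weight[OF assms] deriv_partition_sum' partition_sum_neq0] by (simp only: gibbs_prob_def[of "y _" z])
  then show ?thesis
    by (rule DERIV_cong) (simp add: gibbs_prob_def[of _ z] divide_simps, simp add: algebra_simps)
qed

lemma deriv_norm_grad:
  assumes "z \<in> F" "i \<le> m"
  shows "((\<lambda>s. norm_grad (y s) (z, i)) has_real_derivative
    (\<Sum>j\<in>{0..m}. norm_hess (y t) (z, i) (z, j) * x' (z, j))) (at t)"
proof (cases "i = 0")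
  case True
  then show ?thesis by (simp add: norm_grad_def norm_hess_def)
next
  case False
  let ?D = "\<Sum>j\<in>{1..m}. norm_grad (y t) (z, j) * x' (z, j)" and ?n = "snorm (y t) z"
  have "((\<lambda>s. x (z, i) s / snorm (y s) z) has_real_derivative
      (x' (z, i) * ?n - x (z, i) t * ?D) / (?n * ?n)) (at t)"
    using assms by (intro DERIV_divide deriv_snorm dx coordsI) auto
  moreover have "(x' (z, i) * ?n - x (z, i) t * ?D) / (?n * ?n) = (x' (z, i) - norm_grad (y t) (z, i) * ?D) / ?n"
    using False by (simp add: norm_grad_def divide_simps)
  moreover have "(\<Sum>j\<in>{0..m}. norm_hess (y t) (z, i) (z, j) * x' (z, j)) = (x' (z, i) - norm_grad (y t) (z, i) * ?D) / ?n"
  proof -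
    have "(\<Sum>j\<in>{0..m}. norm_hess (y t) (z, i) (z, j) * x' (z, j)) =
        (\<Sum>j\<in>{1..m}. ((if i = j then x' (z, j) else 0) - norm_grad (y t) (z, i) * (norm_grad (y t) (z, j) * x' (z, j))) / ?n)"
      using False by (subst sum_split_first) (auto simp: norm_hess_def algebra_simps intro!: sum.cong)
    also have "\<dots> = (x' (z, i) - norm_grad (y t) (z, i) * ?D) / ?n"
      using assms False by (simp add: sum_divide_distrib[symmetric] sum_subtractf sum_distrib_left[symmetric])
    finally show ?thesis .
  qed
  ultimately show ?thesis using False by (simp add: norm_grad_def)
qed

lemma deriv_softmax: "((\<lambda>s. softmax (y s)) has_real_derivative (\<Sum>a\<in>coords. softmax_d a (y t) * x' a)) (at t)"
  by (rule DERIV_cong[OF deriv_softmax_mean]) (simp add: sum_coords softmax_d_def sum_distrib_left sum_negf mult_ac)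

lemma deriv_softmax_d:
  assumes "a \<in> coords"
  shows "((\<lambda>s. softmax_d a (y s)) has_real_derivative (\<Sum>b\<in>coords. softmax_dd a b (y t) * x' b)) (at t)"
proof -
  obtain z i where a: "a = (z, i)" "z \<in> F" "i \<le> m" using assms by (auto simp: coords_def)
  let ?G = "softmax (y t)" and ?p = "gibbs_prob (y t) z" and ?u = "norm_grad (y t) (z, i)"
  let ?C = "\<lambda>z. \<Sum>i\<in>{0..m}. norm_grad (y t) (z, i) * x' (z, i)"
  let ?V = "\<Sum>j\<in>{0..m}. norm_hess (y t) (z, i) (z, j) * x' (z, j)"
  have "((\<lambda>s. softmax_d a (y s)) has_real_derivative
     (1 - \<beta>) * (?G * ?p * ?u) * P + (\<beta> * (?G * ?p * ?u) * ?C z - ?G * ?p * ?V)) (at t)"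
    unfolding softmax_d_def a fst_conv
    by (rule DERIV_cong[OF DERIV_minus[OF DERIV_mult[OF DERIV_mult[OF deriv_softmax_mean deriv_gibbs_prob[OF a(2)]] deriv_norm_grad[OF a(2,3)]]]])
       (simp add: algebra_simps)
  moreover have "(\<Sum>b\<in>coords. softmax_dd a b (y t) * x' b) =
     (1 - \<beta>) * (?G * ?p * ?u) * P + (\<beta> * (?G * ?p * ?u) * ?C z - ?G * ?p * ?V)"
  proof -
    have "(\<Sum>b\<in>coords. softmax_dd a b (y t) * x' b) =
      (\<Sum>z'\<in>F. (1 - \<beta>) * (?G * ?p * ?u) * (gibbs_prob (y t) z' * ?C z')
         + (if z = z' then \<beta> * (?G * ?p * ?u) * ?C z - ?G * ?p * ?V else 0))"
      unfolding sum_coords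
    proof (rule sum.cong[OF refl])
      fix z' assume "z' \<in> F"
      show "(\<Sum>j\<in>{0..m}. softmax_dd a (z', j) (y t) * x' (z', j)) =
        (1 - \<beta>) * (?G * ?p * ?u) * (gibbs_prob (y t) z' * ?C z')
         + (if z = z' then \<beta> * (?G * ?p * ?u) * ?C z - ?G * ?p * ?V else 0)"
        unfolding softmax_dd_def a
        by (auto simp: sum_distrib_left sum.distrib[symmetric] sum_subtractf[symmetric] algebra_simps intro!: sum.cong)
    qed
    also have "\<dots> = (1 - \<beta>) * (?G * ?p * ?u) * P + (\<beta> * (?G * ?p * ?u) * ?C z - ?G * ?p * ?V)"
      using finF a(2) by (simp add: sum.distrib sum_distrib_left)
    finally show ?thesis .
  qed
  ultimately show ?thesis by simp
qed

end

lemma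
  assumes "\<And>a. a \<in> coords \<Longrightarrow> x a \<in> borel_measurable N"
  shows measurable_snorm: "z \<in> F \<Longrightarrow> (\<lambda>\<xi>. snorm (\<lambda>a. x a \<xi>) z) \<in> borel_measurable N"
    and measurable_norm_grad: "a \<in> coords \<Longrightarrow> (\<lambda>\<xi>. norm_grad (\<lambda>a. x a \<xi>) a) \<in> borel_measurable N"
    and measurable_gibbs_prob: "z \<in> F \<Longrightarrow> (\<lambda>\<xi>. gibbs_prob (\<lambda>a. x a \<xi>) z) \<in> borel_measurable N"
    and measurable_softmax: "(\<lambda>\<xi>. softmax (\<lambda>a. x a \<xi>)) \<in> borel_measurable N"
proof -
  have [measurable]: "x (z, i) \<in> borel_measurable N" if "z \<in> F" "i \<le> m" for z i
    using that by (intro assms coordsI)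
  show n: "(\<lambda>\<xi>. snorm (\<lambda>a. x a \<xi>) z) \<in> borel_measurable N" if "z \<in> F" for z
    unfolding snorm_def using that by (intro measurable_compose[OF _ borel_measurable_sqrt] borel_measurable_add borel_measurable_const borel_measurable_sum borel_measurable_power) auto
  have w: "(\<lambda>\<xi>. gibbs_weight (\<lambda>a. x a \<xi>) z) \<in> borel_measurable N" if "z \<in> F" for z
    unfolding gibbs_weight_def using that n[OF that] by measurable
  have partition_sum: "(\<lambda>\<xi>. partition_sum (\<lambda>a. x a \<xi>)) \<in> borel_measurable N"
    unfolding partition_sum_def by (intro borel_measurable_sum w)
  show "(\<lambda>\<xi>. norm_grad (\<lambda>a. x a \<xi>) a) \<in> borel_measurable N" if "a \<in> coords"
    unfolding norm_grad_def using that by (cases "snd a = 0") (auto intro!: borel_measurable_divide assms n simp: coords_def)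
  show "(\<lambda>\<xi>. gibbs_prob (\<lambda>a. x a \<xi>) z) \<in> borel_measurable N" if "z \<in> F"
    unfolding gibbs_prob_def by (intro borel_measurable_divide w partition_sum that)
  show "(\<lambda>\<xi>. softmax (\<lambda>a. x a \<xi>)) \<in> borel_measurable N"
    unfolding softmax_def using partition_sum by measurable
qed

lemma measurable_softmax_d:
  assumes "a \<in> coords" "\<And>a. a \<in> coords \<Longrightarrow> x a \<in> borel_measurable N"
  shows "(\<lambda>\<xi>. softmax_d a (\<lambda>a. x a \<xi>)) \<in> borel_measurable N"
  unfolding softmax_d_def using assms
  by (intro borel_measurable_times borel_measurable_uminus measurable_norm_grad measurable_gibbs_prob measurable_softmax) (auto simp: coords_def)

lemma measurable_softmax_dd:
  assumes "a \<in> coords" "b \<in> coords" "\<And>a. a \<in> coords \<Longrightarrow> x a \<in> borel_measurable N"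
  shows "(\<lambda>\<xi>. softmax_dd a b (\<lambda>a. x a \<xi>)) \<in> borel_measurable N"
proof -
  have F: "fst a \<in> F" "fst b \<in> F" using assms by (auto simp: coords_def)
  note [measurable] = measurable_norm_grad[OF assms(3) assms(1)] measurable_norm_grad[OF assms(3) assms(2)]
    measurable_gibbs_prob[OF assms(3) F(1)] measurable_gibbs_prob[OF assms(3) F(2)] measurable_softmax[OF assms(3)] measurable_snorm[OF assms(3) F(1)]
  show ?thesis unfolding softmax_dd_def norm_hess_def by measurable
qed

lemma continuous_softmax_dd:
  fixes x :: "'z \<times> nat \<Rightarrow> real \<Rightarrow> real"
  assumes a: "a \<in> coords" and b: "b \<in> coords" and x: "\<And>a. a \<in> coords \<Longrightarrow> continuous_on UNIV (x a)"
  shows "continuous_on UNIV (\<lambda>s. softmax_dd a b (\<lambda>a. x a s))"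
proof -
  have n: "continuous_on UNIV (\<lambda>s. snorm (\<lambda>a. x a s) z)" if "z \<in> F" for z
    unfolding snorm_def using that by (intro continuous_intros x coordsI) auto
  have w: "continuous_on UNIV (\<lambda>s. gibbs_weight (\<lambda>a. x a s) z)" if "z \<in> F" for z
    unfolding gibbs_weight_def using that by (intro continuous_intros x coordsI n) auto
  have partition_sum: "continuous_on UNIV (\<lambda>s. partition_sum (\<lambda>a. x a s))"
    unfolding partition_sum_def by (intro continuous_intros w)
  have norm_grad: "continuous_on UNIV (\<lambda>s. norm_grad (\<lambda>a. x a s) a)" if "a \<in> coords" for a
    unfolding norm_grad_def using that by (cases "snd a = 0") (auto intro!: continuous_intros x n simp: coords_def)
  have gibbs_prob: "continuous_on UNIV (\<lambda>s. gibbs_prob (\<lambda>a. x a s) z)" if "z \<in> F" for z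
    unfolding gibbs_prob_def using that by (intro continuous_intros w partition_sum) auto
  have g: "continuous_on UNIV (\<lambda>s. softmax (\<lambda>a. x a s))"
    unfolding softmax_def using \<beta> by (intro continuous_intros partition_sum) auto
  have norm_hess: "continuous_on UNIV (\<lambda>s. norm_hess (\<lambda>a. x a s) a b)"
    unfolding norm_hess_def using a b by (cases "snd a = 0 \<or> snd b = 0") (auto intro!: continuous_intros norm_grad n simp: coords_def)
  have "fst a \<in> F" "fst b \<in> F" using a b by (auto simp: coords_def)
  then show ?thesis
    unfolding softmax_dd_def using a b by (cases "fst a = fst b") (auto intro!: continuous_intros norm_grad gibbs_prob g norm_hess)
qed

lemma norm_grad_inner_le_1: "(\<Sum>i\<in>{1..m}. norm_grad x (z, i) * norm_grad x (z', i)) \<le> 1"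
proof -
  have "(\<Sum>i\<in>{1..m}. norm_grad x (z, i) * norm_grad x (z', i)) \<le> (\<Sum>i\<in>{1..m}. ((norm_grad x (z, i))\<^sup>2 + (norm_grad x (z', i))\<^sup>2) / 2)"
  proof (rule sum_mono)
    fix i
    show "norm_grad x (z, i) * norm_grad x (z', i) \<le> ((norm_grad x (z, i))\<^sup>2 + (norm_grad x (z', i))\<^sup>2) / 2"
      using sum_squares_bound[of "norm_grad x (z, i)" "norm_grad x (z', i)"] by simp
  qed
  also have "\<dots> = ((\<Sum>i\<in>{1..m}. (norm_grad x (z, i))\<^sup>2) + (\<Sum>i\<in>{1..m}. (norm_grad x (z', i))\<^sup>2)) / 2"
    by (simp add: sum_divide_distrib[symmetric] sum.distrib)
  also have "\<dots> \<le> 1" using sum_norm_grad_sq_le[of x z] sum_norm_grad_sq_le[of x z'] by simp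
  finally show ?thesis .
qed

text \<open>
  The heart of Gordon's inequality. For \<open>z \<noteq> z'\<close> the second derivatives combine to
  \<open>(r z z' - 1) (1 - \<beta>) (\<langle>grad z, grad z'\<rangle> - 1)\<close> times a nonnegative factor, a product of three
  nonpositive numbers; the \<open>- 1\<close> in the last one is contributed by the scalar coordinate \<open>0\<close>, whose
  covariance moves in the opposite direction. For \<open>z = z'\<close> the covariance factor vanishes.
\<close>
lemma covariance_sum_nonpos:
  assumes c: "c \<ge> 0" and diag: "\<And>z. z \<in> F \<Longrightarrow> r z z = 1" and le: "\<And>z z'. z \<in> F \<Longrightarrow> z' \<in> F \<Longrightarrow> r z z' \<le> 1"
  shows "(\<Sum>a\<in>coords. \<Sum>b\<in>coords.
     (if snd a = snd b then c * (if snd a = 0 then 1 - r (fst a) (fst b) else r (fst a) (fst b) - 1) else 0)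
       * softmax_dd a b x) \<le> 0" (is "?S \<le> 0")
proof -
  have "?S = (\<Sum>z\<in>F. \<Sum>i\<in>{0..m}. \<Sum>z'\<in>F. (c * (if i = 0 then 1 - r z z' else r z z' - 1)) * softmax_dd (z, i) (z', i) x)"
    unfolding sum_coords by (intro sum.cong refl) (simp add: if_distrib[where f = "\<lambda>c. c * _"] cong: if_cong)
  also have "\<dots> = (\<Sum>z\<in>F. \<Sum>z'\<in>F. \<Sum>i\<in>{0..m}. (c * (if i = 0 then 1 - r z z' else r z z' - 1)) * softmax_dd (z, i) (z', i) x)"
    by (intro sum.cong refl sum.swap)
  also have "\<dots> = (\<Sum>z\<in>F. \<Sum>z'\<in>F. (c * (softmax x * gibbs_prob x z * gibbs_prob x z')) * ((r z z' - 1) * (1 - \<beta>) *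
      ((\<Sum>i\<in>{1..m}. norm_grad x (z, i) * norm_grad x (z', i)) - 1)))"
  proof (intro sum.cong refl)
    fix z z' assume z: "z \<in> F" "z' \<in> F"
    have "(c * (if i = 0 then 1 - r z z' else r z z' - 1)) * softmax_dd (z, i) (z', i) x =
       (c * (softmax x * gibbs_prob x z * gibbs_prob x z')) * ((r z z' - 1) * (1 - \<beta>)) * (if i = 0 then - 1 else norm_grad x (z, i) * norm_grad x (z', i))" for i
    proof (cases "z = z'")
      case True
      then show ?thesis using diag[of z] z by simp
    next
      case False
      then show ?thesis by (simp add: softmax_dd_def norm_grad_def)
    qed
    then have "(\<Sum>i\<in>{0..m}. (c * (if i = 0 then 1 - r z z' else r z z' - 1)) * softmax_dd (z, i) (z', i) x) =
      (\<Sum>i\<in>{0..m}. (c * (softmax x * gibbs_prob x z * gibbs_prob x z')) * ((r z z' - 1) * (1 - \<beta>)) * (if i = 0 then - 1 else norm_grad x (z, i) * norm_grad x (z', i)))"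
      by (intro sum.cong refl)
    then show "(\<Sum>i\<in>{0..m}. (c * (if i = 0 then 1 - r z z' else r z z' - 1)) * softmax_dd (z, i) (z', i) x) =
      (c * (softmax x * gibbs_prob x z * gibbs_prob x z')) * ((r z z' - 1) * (1 - \<beta>) * ((\<Sum>i\<in>{1..m}. norm_grad x (z, i) * norm_grad x (z', i)) - 1))"
      unfolding sum_distrib_left[symmetric] sum_split_first
      by (auto simp: mult.assoc intro!: sum.cong)
  qed
  also have "\<dots> \<le> 0"
  proof (intro sum_nonpos)
    fix z z' assume z: "z \<in> F" "z' \<in> F"
    have "0 \<le> c * (softmax x * gibbs_prob x z * gibbs_prob x z')"
      using c softmax_pos[of x] by (simp add: gibbs_prob_nonneg)
    moreover have "0 \<le> (r z z' - 1) * (1 - \<beta>)"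
      using le[OF z] \<beta> by (intro mult_nonpos_nonpos) auto
    ultimately show "(c * (softmax x * gibbs_prob x z * gibbs_prob x z')) * ((r z z' - 1) * (1 - \<beta>) *
        ((\<Sum>i\<in>{1..m}. norm_grad x (z, i) * norm_grad x (z', i)) - 1)) \<le> 0"
      using norm_grad_inner_le_1[of x z z'] by (intro mult_nonneg_nonpos) auto
  qed
  finally show ?thesis .
qed

text \<open>
  In this lemma and the next, the smoothing error is a factor \<open>exp \<epsilon>\<close> on one side and \<open>card F\<close> to the power \<open>1 / \<beta>\<close> on the other.
\<close>
lemma softmax_ge:
  assumes "z \<in> F"
  shows "exp (- (L2_set (\<lambda>i. x (z, i)) {1..m} + x (z, 0))) \<le> exp \<epsilon> * softmax x"
proof -
  have "snorm x z \<le> \<epsilon> + L2_set (\<lambda>i. x (z, i)) {1..m}"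
    using sqrt_add_le_add_sqrt[of "\<epsilon>\<^sup>2" "\<Sum>i\<in>{1..m}. (x (z, i))\<^sup>2"] \<epsilon>
    by (simp add: snorm_def L2_set_def sum_nonneg)
  moreover have "gibbs_weight x z \<le> partition_sum x"
    unfolding partition_sum_def using assms finF gibbs_weight_pos by (intro member_le_sum) (auto intro: less_imp_le)
  then have "ln (gibbs_weight x z) \<le> ln (partition_sum x)" using gibbs_weight_pos partition_sum_pos by (simp add: ln_mono)
  then have "- (snorm x z + x (z, 0)) \<le> ln (partition_sum x) / \<beta>"
    using \<beta> by (simp add: gibbs_weight_def field_simps)
  ultimately have "- (L2_set (\<lambda>i. x (z, i)) {1..m} + x (z, 0)) \<le> \<epsilon> + ln (partition_sum x) / \<beta>" by linarith
  then show ?thesis by (simp add: softmax_def exp_add[symmetric])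
qed

lemma softmax_le:
  assumes "\<And>z. z \<in> F \<Longrightarrow> exp (- (L2_set (\<lambda>i. x (z, i)) {1..m} + x (z, 0))) \<le> B" and B: "B > 0"
  shows "softmax x \<le> exp (ln (card F) / \<beta>) * B"
proof -
  have card: "real (card F) > 0"
    using finF neF by (simp add: card_gt_0_iff)
  have "gibbs_weight x z \<le> exp (\<beta> * ln B)" if "z \<in> F" for z
  proof -
    have "L2_set (\<lambda>i. x (z, i)) {1..m} \<le> snorm x z"
      unfolding snorm_def L2_set_def by (intro real_sqrt_le_mono) simp
    moreover have "- (L2_set (\<lambda>i. x (z, i)) {1..m} + x (z, 0)) \<le> ln B"
      using assms(1)[OF that] B by (simp add: ln_ge_iff)
    ultimately have "- (snorm x z + x (z, 0)) \<le> ln B" by linarith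
    then have "\<beta> * - (snorm x z + x (z, 0)) \<le> \<beta> * ln B" using \<beta> by (intro mult_left_mono) auto
    then show ?thesis by (simp add: gibbs_weight_def algebra_simps)
  qed
  then have "partition_sum x \<le> card F * exp (\<beta> * ln B)"
    unfolding partition_sum_def by (rule sum_bounded_above)
  then have "ln (partition_sum x) \<le> ln (card F * exp (\<beta> * ln B))" using partition_sum_pos by (simp add: ln_mono)
  then have "ln (partition_sum x) / \<beta> \<le> ln (card F) / \<beta> + ln B"
    using \<beta> card by (simp add: ln_mult field_simps)
  then have "softmax x \<le> exp (ln (card F) / \<beta> + ln B)" by (simp add: softmax_def)
  then show ?thesis using B by (simp add: exp_add)
qed

end

lemma inner_unit_le_1:
  fixes z z' :: "nat \<Rightarrow> real"
  assumes "(\<Sum>j\<in>J. (z j)\<^sup>2) = 1" "(\<Sum>j\<in>J. (z' j)\<^sup>2) = 1"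
  shows "(\<Sum>j\<in>J. z j * z' j) \<le> 1"
proof -
  have "(\<Sum>j\<in>J. z j * z' j) \<le> (\<Sum>j\<in>J. ((z j)\<^sup>2 + (z' j)\<^sup>2) / 2)"
  proof (rule sum_mono)
    fix j
    show "z j * z' j \<le> ((z j)\<^sup>2 + (z' j)\<^sup>2) / 2"
      using sum_squares_bound[of "z j" "z' j"] by simp
  qed
  also have "\<dots> = 1"
    using assms by (simp add: sum_divide_distrib[symmetric] sum.distrib)
  finally show ?thesis .
qed

text \<open>
  One standard Gaussian array \<open>\<xi>\<close> on \<open>{0..m} \<times> {0..N}\<close> carries all variables: the entries of the matrix
  are \<open>\<xi> (i, j)\<close> with \<open>i, j \<ge> 1\<close>, the comparison vectors are \<open>g = \<xi> (_, 0)\<close> and \<open>h = \<xi> (0, _)\<close>, and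
  \<open>\<xi> (0, 0)\<close> is the extra scalar. The path \<open>sin \<theta> X + cos \<theta> Y\<close> rotates \<open>Y\<close> into \<open>X\<close>. As \<open>X\<close> and \<open>Y\<close>
  use disjoint variables, the mixed covariances are \<open>sin \<theta> cos \<theta>\<close> times the difference of the covariances
  of \<open>X\<close> and \<open>Y\<close>.
\<close>
lemma gordon_softmin:
  fixes F :: "(nat \<Rightarrow> real) set" and l \<epsilon> \<beta> :: real and m N :: nat
  assumes "softmin F \<epsilon> \<beta>" and unit: "\<And>z. z \<in> F \<Longrightarrow> (\<Sum>j\<in>{1..N}. (z j)\<^sup>2) = 1"
  defines "I \<equiv> {0..m} \<times> {0..N}"
  defines "X \<equiv> \<lambda>\<xi> (z, i). l * (if i = 0 then \<xi> (0, 0) else (\<Sum>j\<in>{1..N}. z j * \<xi> (i, j)))"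
    and "Y \<equiv> \<lambda>\<xi> (z, i). l * (if i = 0 then (\<Sum>j\<in>{1..N}. z j * \<xi> (0, j)) else \<xi> (i, 0))"
  shows "(\<integral>\<xi>. softmin.softmax F m \<epsilon> \<beta> (X \<xi>) \<partial>gaussN I) \<le> (\<integral>\<xi>. softmin.softmax F m \<epsilon> \<beta> (Y \<xi>) \<partial>gaussN I)"
    and "integrable (gaussN I) (\<lambda>\<xi>. softmin.softmax F m \<epsilon> \<beta> (X \<xi>))"
    and "integrable (gaussN I) (\<lambda>\<xi>. softmin.softmax F m \<epsilon> \<beta> (Y \<xi>))"
proof -
  interpret softmin F m \<epsilon> \<beta> by fact
  define w :: "(nat \<Rightarrow> real) \<Rightarrow> nat \<Rightarrow> nat \<Rightarrow> real \<Rightarrow> real \<Rightarrow> real" where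
    "w z i j s c = l * (if i = 0 then (if j = 0 then s else c * z j) else (if j = 0 then c else s * z j))" for z i j s c
  define L where "L a \<kappa> \<theta> = (if snd a = fst \<kappa> then w (fst a) (snd a) (snd \<kappa>) (sin \<theta>) (cos \<theta>) else 0)"
    for a :: "(nat \<Rightarrow> real) \<times> nat" and \<kappa> :: "nat \<times> nat" and \<theta> :: real
  define L' where "L' a \<kappa> \<theta> = (if snd a = fst \<kappa> then w (fst a) (snd a) (snd \<kappa>) (cos \<theta>) (- sin \<theta>) else 0)"
    for a :: "(nat \<Rightarrow> real) \<times> nat" and \<kappa> :: "nat \<times> nat" and \<theta> :: real
  have finI: "finite I" by (simp add: I_def)
  have row: "(\<Sum>\<kappa>\<in>I. if i = fst \<kappa> then f (snd \<kappa>) \<kappa> else 0) = f 0 (i, 0) + (\<Sum>j\<in>{1..N}. f j (i, j))"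
    if "i \<le> m" for i :: nat and f :: "nat \<Rightarrow> nat \<times> nat \<Rightarrow> real"
  proof -
    have "(\<Sum>\<kappa>\<in>I. if i = fst \<kappa> then f (snd \<kappa>) \<kappa> else 0) =
        (\<Sum>i'\<in>{0..m}. \<Sum>j\<in>{0..N}. if i = i' then f j (i', j) else 0)"
      unfolding I_def by (subst sum.cartesian_product) (auto intro!: sum.cong)
    also have "\<dots> = (\<Sum>i'\<in>{0..m}. if i = i' then \<Sum>j\<in>{0..N}. f j (i', j) else 0)"
      by (intro sum.cong refl) auto
    also have "\<dots> = (\<Sum>j\<in>{0..N}. f j (i, j))" using that by simp
    finally show ?thesis by (simp add: sum.atLeast_Suc_atMost)
  qed
  have Lsum: "(\<Sum>\<kappa>\<in>I. L a \<kappa> \<theta> * \<xi> \<kappa>) = (case a of (z, i) \<Rightarrow>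
      w z i 0 (sin \<theta>) (cos \<theta>) * \<xi> (i, 0) + (\<Sum>j\<in>{1..N}. w z i j (sin \<theta>) (cos \<theta>) * \<xi> (i, j)))"
    if "a \<in> coords" for a \<theta> \<xi>
    using row[of "snd a" "\<lambda>j \<kappa>. w (fst a) (snd a) j (sin \<theta>) (cos \<theta>) * \<xi> \<kappa>"] that
    unfolding L_def by (auto simp: coords_def if_distrib[where f = "\<lambda>c. c * _"] cong: if_cong)
  have Lend: "(\<Sum>\<kappa>\<in>I. L a \<kappa> (pi / 2) * \<xi> \<kappa>) = X \<xi> a" "(\<Sum>\<kappa>\<in>I. L a \<kappa> 0 * \<xi> \<kappa>) = Y \<xi> a" if "a \<in> coords" for a \<xi>
    using Lsum[OF that, of "pi/2"] Lsum[OF that, of 0]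
    by (auto simp: X_def Y_def w_def sum_distrib_left mult.assoc split: prod.splits)
  have G_cong: "softmax x = softmax x'" if "\<And>a. a \<in> coords \<Longrightarrow> x a = x' a" for x x' :: "(nat \<Rightarrow> real) \<times> nat \<Rightarrow> real"
    unfolding softmax_def partition_sum_def gibbs_weight_def snorm_def using that by (simp add: coordsI)
  have LL: "(\<Sum>\<kappa>\<in>I. L' a \<kappa> \<theta> * L b \<kappa> \<theta>) =
      (if snd a = snd b then l\<^sup>2 * sin \<theta> * cos \<theta> *
        (if snd a = 0 then 1 - (\<Sum>j\<in>{1..N}. fst a j * fst b j) else (\<Sum>j\<in>{1..N}. fst a j * fst b j) - 1) else 0)"
    if "a \<in> coords" "b \<in> coords" for a b \<theta>
  proof (cases "snd a = snd b")
    case True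
    have "(\<Sum>\<kappa>\<in>I. L' a \<kappa> \<theta> * L b \<kappa> \<theta>) = (\<Sum>\<kappa>\<in>I. if snd a = fst \<kappa> then
        w (fst a) (snd a) (snd \<kappa>) (cos \<theta>) (- sin \<theta>) * w (fst b) (snd a) (snd \<kappa>) (sin \<theta>) (cos \<theta>) else 0)"
      unfolding L_def L'_def using True by (intro sum.cong) auto
    also have "\<dots> = w (fst a) (snd a) 0 (cos \<theta>) (- sin \<theta>) * w (fst b) (snd a) 0 (sin \<theta>) (cos \<theta>) +
       (\<Sum>j\<in>{1..N}. w (fst a) (snd a) j (cos \<theta>) (- sin \<theta>) * w (fst b) (snd a) j (sin \<theta>) (cos \<theta>))"
      using that row[of "snd a" "\<lambda>j _. w (fst a) (snd a) j (cos \<theta>) (- sin \<theta>) * w (fst b) (snd a) j (sin \<theta>) (cos \<theta>)"]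
      by (auto simp: coords_def)
    also have "(\<Sum>j\<in>{1..N}. w (fst a) (snd a) j (cos \<theta>) (- sin \<theta>) * w (fst b) (snd a) j (sin \<theta>) (cos \<theta>)) =
       (\<Sum>j\<in>{1..N}. (if snd a = 0 then - 1 else 1) * (l\<^sup>2 * sin \<theta> * cos \<theta>) * (fst a j * fst b j))"
      by (intro sum.cong refl) (auto simp: w_def power2_eq_square)
    also have "\<dots> = (if snd a = 0 then - 1 else 1) * (l\<^sup>2 * sin \<theta> * cos \<theta>) * (\<Sum>j\<in>{1..N}. fst a j * fst b j)"
      by (rule sum_distrib_left[symmetric])
    finally show ?thesis using True
      by (simp add: w_def power2_eq_square right_diff_distrib mult_ac)
  next
    case False
    then show ?thesis unfolding L_def L'_def by (auto intro!: sum.neutral)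
  qed
  define B where "B = \<bar>l\<bar> * (1 + (\<Sum>z\<in>F. \<Sum>j\<in>{1..N}. \<bar>z j\<bar>))"
  have wB: "\<bar>w z i j s c\<bar> \<le> B" if z: "z \<in> F" and j: "j \<le> N" and sc: "\<bar>s\<bar> \<le> 1" "\<bar>c\<bar> \<le> 1" for z i j s c
  proof -
    have "j = 0 \<or> \<bar>z j\<bar> \<le> (\<Sum>j\<in>{1..N}. \<bar>z j\<bar>)"
      using j by (cases "j = 0") (auto intro!: member_le_sum)
    moreover have "(\<Sum>j\<in>{1..N}. \<bar>z j\<bar>) \<le> (\<Sum>z\<in>F. \<Sum>j\<in>{1..N}. \<bar>z j\<bar>)"
      using z finF by (intro member_le_sum) (auto intro: sum_nonneg)
    ultimately have zj: "j = 0 \<or> \<bar>z j\<bar> \<le> (\<Sum>z\<in>F. \<Sum>j\<in>{1..N}. \<bar>z j\<bar>)" by auto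
    have nn: "0 \<le> (\<Sum>z\<in>F. \<Sum>j\<in>{1..N}. \<bar>z j\<bar>)" by (intro sum_nonneg) auto
    have "\<bar>q * z j\<bar> \<le> 1 + (\<Sum>z\<in>F. \<Sum>j\<in>{1..N}. \<bar>z j\<bar>)" if "\<bar>q\<bar> \<le> 1" "j \<noteq> 0" for q
      using mult_mono[OF that(1), of "\<bar>z j\<bar>"] zj that nn by (fastforce simp: abs_mult)
    then show ?thesis
      unfolding w_def B_def abs_mult[of l] using sc nn by (intro mult_left_mono) auto
  qed
  have Bnn: "0 \<le> B" unfolding B_def by (intro mult_nonneg_nonneg add_nonneg_nonneg sum_nonneg) auto
  define K where "K = max 1 (2 * \<beta> + 2 / \<epsilon>) * card F"
  have KG: "k * softmax x \<le> K * exp (\<Sum>a\<in>coords. \<bar>x a\<bar>)" if "k \<le> max 1 (2 * \<beta> + 2 / \<epsilon>)" for k x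
  proof -
    have "k * softmax x \<le> max 1 (2 * \<beta> + 2 / \<epsilon>) * (card F * exp (\<Sum>a\<in>coords. \<bar>x a\<bar>))"
      using softmax_pos[of x] softmax_bound[of x] by (intro mult_mono that) auto
    then show ?thesis by (simp add: K_def)
  qed
  have dL: "(L a \<kappa> has_real_derivative L' a \<kappa> \<theta>) (at \<theta>)" for a \<kappa> \<theta>
    unfolding L_def[abs_def] L'_def w_def
    by (cases "snd a = fst \<kappa>"; cases "snd a = 0"; cases "snd \<kappa> = 0") (auto intro!: derivative_eq_intros)
  have bL: "\<bar>L a \<kappa> \<theta>\<bar> \<le> B" "\<bar>L' a \<kappa> \<theta>\<bar> \<le> B" if "a \<in> coords" "\<kappa> \<in> I" for a \<kappa> \<theta>
    using that Bnn unfolding L_def L'_def by (auto simp: coords_def I_def intro!: wB)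
  have bG: "\<bar>softmax x\<bar> \<le> K * exp (\<Sum>a\<in>coords. \<bar>x a\<bar>)" for x
    using KG[of 1 x] softmax_pos[of x] by simp
  have bG1: "\<bar>softmax_d a x\<bar> \<le> K * exp (\<Sum>a\<in>coords. \<bar>x a\<bar>)" if "a \<in> coords" for a x
    using KG[of 1 x] softmax_d_bound[OF that, of x] by simp
  have bG2: "\<bar>softmax_dd a b x\<bar> \<le> K * exp (\<Sum>a\<in>coords. \<bar>x a\<bar>)" if "a \<in> coords" "b \<in> coords" for a b x
    using KG[of "2 * \<beta> + 2 / \<epsilon>" x] softmax_dd_bound[OF that, of x] by simp
  have sign: "(\<Sum>a\<in>coords. \<Sum>b\<in>coords. (\<Sum>\<kappa>\<in>I. L' a \<kappa> \<theta> * L b \<kappa> \<theta>) * softmax_dd a b x) \<le> 0" if "0 \<le> \<theta>" "\<theta> \<le> pi / 2" for \<theta> x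
  proof -
    have "0 \<le> l\<^sup>2 * sin \<theta> * cos \<theta>"
      using that by (intro mult_nonneg_nonneg sin_ge_zero cos_ge_zero) auto
    from covariance_sum_nonpos[OF this, of "\<lambda>z z'. \<Sum>j\<in>{1..N}. z j * z' j" x]
    show ?thesis
      using unit inner_unit_le_1[OF unit unit] by (simp add: LL power2_eq_square)
  qed
  note interp = gaussian_interpolation[where G = softmax and ?G1.0 = softmax_d and ?G2.0 = softmax_dd and L = L and L' = L' and I = I
      and T = coords and B = B and K = K and \<alpha> = 0 and \<beta> = "pi / 2",
      OF finI finite_coords dL bL(1) bL(2) deriv_softmax deriv_softmax_d continuous_softmax_dd
         measurable_softmax measurable_softmax_d measurable_softmax_dd bG bG1 bG2 sign]
  have A: "(\<integral>\<xi>. softmax (\<lambda>a. \<Sum>\<kappa>\<in>I. L a \<kappa> (pi / 2) * \<xi> \<kappa>) \<partial>gaussN I) \<le> (\<integral>\<xi>. softmax (\<lambda>a. \<Sum>\<kappa>\<in>I. L a \<kappa> 0 * \<xi> \<kappa>) \<partial>gaussN I)"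
    by (rule interp(1)) auto
  have B: "integrable (gaussN I) (\<lambda>\<xi>. softmax (\<lambda>a. \<Sum>\<kappa>\<in>I. L a \<kappa> \<theta> * \<xi> \<kappa>))" for \<theta>
    by (rule interp(2)) auto
  have eqX: "softmax (\<lambda>a. \<Sum>\<kappa>\<in>I. L a \<kappa> (pi / 2) * \<xi> \<kappa>) = softmax (X \<xi>)" for \<xi>
    by (rule G_cong) (rule Lend(1))
  have eqY: "softmax (\<lambda>a. \<Sum>\<kappa>\<in>I. L a \<kappa> 0 * \<xi> \<kappa>) = softmax (Y \<xi>)" for \<xi>
    by (rule G_cong) (rule Lend(2))
  show "(\<integral>\<xi>. softmax (X \<xi>) \<partial>gaussN I) \<le> (\<integral>\<xi>. softmax (Y \<xi>) \<partial>gaussN I)"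
    using A unfolding eqX eqY .
  show "integrable (gaussN I) (\<lambda>\<xi>. softmax (X \<xi>))"
    using B[of "pi / 2"] unfolding eqX .
  show "integrable (gaussN I) (\<lambda>\<xi>. softmax (Y \<xi>))"
    using B[of 0] unfolding eqY .
qed

text \<open>
  Gordon's inequality for exponential moments, weakened by Markov's inequality on the left and by an upper
  bound \<open>H\<close> for \<open>max (- \<langle>h, z\<rangle>)\<close> on the right. The smoothing is removed with \<open>\<epsilon> = 1 / n\<close>, \<open>\<beta> = n\<close>.
\<close>
lemma gordon_exponential_comparison:
  fixes F :: "(nat \<Rightarrow> real) set" and l \<zeta> :: real and m N :: nat and H :: "(nat \<times> nat \<Rightarrow> real) \<Rightarrow> real"
  defines "I \<equiv> {0..m} \<times> {0..N}"
  assumes F: "finite F" and unit: "\<And>z. z \<in> F \<Longrightarrow> (\<Sum>j\<in>{1..N}. (z j)\<^sup>2) = 1"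
    and l: "l \<ge> 0"
    and H: "\<And>z \<xi>. z \<in> F \<Longrightarrow> - (\<Sum>j\<in>{1..N}. z j * \<xi> (0, j)) \<le> H \<xi>"
    and int: "integrable (gaussN I) (\<lambda>\<xi>. exp (l * H \<xi> - l * L2_set (\<lambda>i. \<xi> (i, 0)) {1..m}))"
  shows "(\<integral>\<xi>. exp (- l * \<xi> (0, 0)) *
        (if \<exists>z\<in>F. L2_set (\<lambda>i. \<Sum>j\<in>{1..N}. z j * \<xi> (i, j)) {1..m} < \<zeta> then 1 else 0) \<partial>gaussN I)
      \<le> exp (l * \<zeta>) * (\<integral>\<xi>. exp (l * H \<xi> - l * L2_set (\<lambda>i. \<xi> (i, 0)) {1..m}) \<partial>gaussN I)"
    (is "?lhs \<le> exp (l * \<zeta>) * ?rhs")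
proof (cases "F = {}")
  case True
  then show ?thesis by (simp add: Bochner_Integration.integral_nonneg)
next
  case False
  define f where "f n = exp (1 / real (Suc n)) * exp (ln (card F) / real (Suc n))" for n
  have scale: "L2_set (\<lambda>i. l * f i) {1..m} = l * L2_set f {1..m}" for f :: "nat \<Rightarrow> real"
    using L2_set_right_distrib[OF l] by metis
  have "?lhs \<le> f n * (exp (l * \<zeta>) * ?rhs)" for n
  proof -
    let ?e = "1 / real (Suc n)" and ?b = "real (Suc n)"
    interpret softmin F m ?e ?b
      using F False by unfold_locales auto
    note gs = gordon_softmin[OF softmin_axioms unit, where l = l and m = m, folded I_def]
    let ?X = "\<lambda>\<xi> (z, i). l * (if i = 0 then \<xi> (0, 0) else (\<Sum>j\<in>{1..N}. z j * \<xi> (i, j)))"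
    let ?Y = "\<lambda>\<xi> (z, i). l * (if i = 0 then (\<Sum>j\<in>{1..N}. z j * \<xi> (0, j)) else \<xi> (i, 0))"
    have nX: "L2_set (\<lambda>i. ?X \<xi> (z, i)) {1..m} = l * L2_set (\<lambda>i. \<Sum>j\<in>{1..N}. z j * \<xi> (i, j)) {1..m}" for \<xi> z
      unfolding scale[symmetric] by (intro L2_set_cong) auto
    have nY: "L2_set (\<lambda>i. ?Y \<xi> (z, i)) {1..m} = l * L2_set (\<lambda>i. \<xi> (i, 0)) {1..m}" for \<xi> z
      unfolding scale[symmetric] by (intro L2_set_cong) auto
    have lower: "exp (- l * \<xi> (0, 0)) *
        (if \<exists>z\<in>F. L2_set (\<lambda>i. \<Sum>j\<in>{1..N}. z j * \<xi> (i, j)) {1..m} < \<zeta> then 1 else 0)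
        \<le> exp (l * \<zeta>) * (exp ?e * softmax (?X \<xi>))" for \<xi>
    proof (cases "\<exists>z\<in>F. L2_set (\<lambda>i. \<Sum>j\<in>{1..N}. z j * \<xi> (i, j)) {1..m} < \<zeta>")
      case True
      then obtain z where z: "z \<in> F" "L2_set (\<lambda>i. \<Sum>j\<in>{1..N}. z j * \<xi> (i, j)) {1..m} \<le> \<zeta>"
        by (auto intro: less_imp_le)
      from mult_left_mono[OF z(2) l]
      have "exp (- l * \<xi> (0, 0)) \<le> exp (l * \<zeta>) * exp (- (L2_set (\<lambda>i. ?X \<xi> (z, i)) {1..m} + ?X \<xi> (z, 0)))"
        unfolding nX exp_add[symmetric] by simp
      also have "\<dots> \<le> exp (l * \<zeta>) * (exp ?e * softmax (?X \<xi>))"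
        by (intro mult_left_mono softmax_ge z) auto
      finally show ?thesis using True by simp
    next
      case False
      then show ?thesis using softmax_pos[of "?X \<xi>"] by (simp add: less_imp_le)
    qed
    have upper: "softmax (?Y \<xi>) \<le> exp (ln (card F) / ?b) * exp (l * H \<xi> - l * L2_set (\<lambda>i. \<xi> (i, 0)) {1..m})" for \<xi>
    proof (rule softmax_le)
      fix z assume "z \<in> F"
      from mult_left_mono[OF H[OF this, of \<xi>] l]
      show "exp (- (L2_set (\<lambda>i. ?Y \<xi> (z, i)) {1..m} + ?Y \<xi> (z, 0)))
          \<le> exp (l * H \<xi> - l * L2_set (\<lambda>i. \<xi> (i, 0)) {1..m})"
        unfolding nY by simp
    qed simp
    have "?lhs \<le> (\<integral>\<xi>. exp (l * \<zeta>) * (exp ?e * softmax (?X \<xi>)) \<partial>gaussN I)"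
      by (intro integral_mono' integrable_mult_right gs(2) lower mult_nonneg_nonneg less_imp_le[OF softmax_pos]) auto
    also have "\<dots> = exp (l * \<zeta>) * (exp ?e * (\<integral>\<xi>. softmax (?X \<xi>) \<partial>gaussN I))"
      by simp
    also have "\<dots> \<le> exp (l * \<zeta>) * (exp ?e * (\<integral>\<xi>. softmax (?Y \<xi>) \<partial>gaussN I))"
      by (intro mult_left_mono gs(1)) auto
    also have "(\<integral>\<xi>. softmax (?Y \<xi>) \<partial>gaussN I) \<le>
        (\<integral>\<xi>. exp (ln (card F) / ?b) * exp (l * H \<xi> - l * L2_set (\<lambda>i. \<xi> (i, 0)) {1..m}) \<partial>gaussN I)"
      by (intro integral_mono integrable_mult_right gs(3) int upper)
    finally show ?thesis by (simp add: f_def mult_ac)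
  qed
  moreover have "(\<lambda>n. f n * (exp (l * \<zeta>) * ?rhs)) \<longlonglongrightarrow> (exp 0 * exp 0) * (exp (l * \<zeta>) * ?rhs)"
  proof -
    have "(\<lambda>n. c / real (Suc n)) \<longlonglongrightarrow> 0" for c :: real
      using LIMSEQ_Suc[OF lim_const_over_n[of c]] by simp
    then show ?thesis unfolding f_def by (intro tendsto_mult tendsto_exp tendsto_const)
  qed
  ultimately show ?thesis
    by (auto intro: LIMSEQ_le_const)
qed

section \<open>The norm of a Gaussian vector\<close>

text \<open>
  The radius is smoothed at the origin so that functions of it are differentiable in each coordinate.
\<close>
locale smooth_norm =
  fixes I :: "'i set" and \<epsilon> :: real
  assumes fin: "finite I" and \<epsilon>: "\<epsilon> > 0"
begin

definition rad :: "('i \<Rightarrow> real) \<Rightarrow> real" where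
  "rad \<xi> = sqrt (\<epsilon>\<^sup>2 + (\<Sum>\<kappa>\<in>I. (\<xi> \<kappa>)\<^sup>2))"

lemma rad_sq: "(\<Sum>\<kappa>\<in>I. (\<xi> \<kappa>)\<^sup>2) = (rad \<xi>)\<^sup>2 - \<epsilon>\<^sup>2"
  by (simp add: rad_def sum_nonneg)

lemma rad_ge: "rad \<xi> \<ge> \<epsilon>"
proof -
  have "sqrt (\<epsilon>\<^sup>2) \<le> rad \<xi>"
    unfolding rad_def by (intro real_sqrt_le_mono) (simp add: sum_nonneg)
  then show ?thesis using \<epsilon> by simp
qed

lemma rad_pos: "rad \<xi> > 0"
  using rad_ge[of \<xi>] \<epsilon> by linarith

lemma rad_le: "rad \<xi> \<le> \<epsilon> + L2_set \<xi> I"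
  using sqrt_add_le_add_sqrt[of "\<epsilon>\<^sup>2" "\<Sum>i\<in>I. (\<xi> i)\<^sup>2"] \<epsilon>
  by (simp add: rad_def L2_set_def sum_nonneg)

lemma rad_le_sum: "rad \<xi> \<le> \<epsilon> + (\<Sum>\<kappa>\<in>I. \<bar>\<xi> \<kappa>\<bar>)"
  using rad_le[of \<xi>] L2_set_le_sum_abs[of \<xi> I] by linarith

lemma measurable_rad [measurable]: "rad \<in> borel_measurable (gaussN I)"
  unfolding rad_def by measurable

lemma integrable_rad:
  assumes [measurable]: "g \<in> borel_measurable borel"
    and g: "\<And>t. t \<ge> \<epsilon> \<Longrightarrow> \<bar>g t\<bar> \<le> K * exp (c * t)" and c: "c \<ge> 0"
  shows "integrable (gaussN I) (\<lambda>\<xi>. g (rad \<xi>))"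
proof (rule integrable_gaussN_bound[OF fin])
  fix \<xi>
  have "0 \<le> K * exp (c * \<epsilon>)" using g[of \<epsilon>] by linarith
  then have K: "K \<ge> 0" by (simp add: zero_le_mult_iff)
  have "\<bar>g (rad \<xi>)\<bar> \<le> K * exp (c * rad \<xi>)" using g rad_ge by blast
  also have "\<dots> \<le> K * exp (c * (\<epsilon> + (\<Sum>\<kappa>\<in>I. \<bar>\<xi> \<kappa>\<bar>)))"
    using K c rad_le_sum[of \<xi>] by (intro mult_left_mono) (auto intro: mult_left_mono)
  finally show "\<bar>g (rad \<xi>)\<bar> \<le> (K * exp (c * \<epsilon>)) * exp (c * (\<Sum>\<kappa>\<in>I. \<bar>\<xi> \<kappa>\<bar>))"
    by (simp add: exp_add distrib_left mult_ac)
qed measurable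

text \<open>
  Integration by parts in every coordinate for \<open>\<xi> \<kappa> * \<phi> (rad \<xi>)\<close>, summed over the coordinates. With
  \<open>\<epsilon> = 0\<close> this is \<open>E r\<^sup>2 \<phi> r = n E \<phi> r + E r \<phi>' r\<close>, i.e. partial integration against the chi density.
\<close>
lemma radial_integration_by_parts:
  fixes \<phi> \<phi>' :: "real \<Rightarrow> real"
  assumes d\<phi>: "\<And>t. (\<phi> has_real_derivative \<phi>' t) (at t)" and cont: "continuous_on UNIV \<phi>'"
    and b: "\<And>t. t \<ge> \<epsilon> \<Longrightarrow> \<bar>\<phi> t\<bar> \<le> K * exp t" "\<And>t. t \<ge> \<epsilon> \<Longrightarrow> \<bar>\<phi>' t\<bar> \<le> K * exp t"
  shows "(\<integral>\<xi>. ((rad \<xi>)\<^sup>2 - \<epsilon>\<^sup>2) * \<phi> (rad \<xi>) \<partial>gaussN I) =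
    (\<integral>\<xi>. card I * \<phi> (rad \<xi>) + ((rad \<xi>)\<^sup>2 - \<epsilon>\<^sup>2) / rad \<xi> * \<phi>' (rad \<xi>) \<partial>gaussN I)"
proof -
  have c\<phi>: "continuous_on UNIV \<phi>"
    by (intro continuous_at_imp_continuous_on ballI DERIV_isCont[OF d\<phi>])
  have [measurable]: "\<phi> \<in> borel_measurable borel" "\<phi>' \<in> borel_measurable borel"
    using c\<phi> cont by (auto intro: borel_measurable_continuous_onI)
  have "0 \<le> K * exp \<epsilon>" using b(1)[of \<epsilon>] by linarith
  then have K: "K \<ge> 0" by (simp add: zero_le_mult_iff)
  let ?f = "\<lambda>\<kappa> \<xi>. \<xi> \<kappa> * \<phi> (rad \<xi>)"
  let ?f' = "\<lambda>\<kappa> \<xi>. \<phi> (rad \<xi>) + (\<xi> \<kappa>)\<^sup>2 / rad \<xi> * \<phi>' (rad \<xi>)"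
  have ibp: "(\<integral>\<xi>. \<xi> \<kappa> * ?f \<kappa> \<xi> \<partial>gaussN I) = (\<integral>\<xi>. ?f' \<kappa> \<xi> \<partial>gaussN I)"
      "integrable (gaussN I) (\<lambda>\<xi>. \<xi> \<kappa> * ?f \<kappa> \<xi>)" "integrable (gaussN I) (?f' \<kappa>)"
    if \<kappa>: "\<kappa> \<in> I" for \<kappa>
  proof -
    have upd: "rad (\<xi>(\<kappa> := t)) = sqrt (\<epsilon>\<^sup>2 + (t\<^sup>2 + (\<Sum>i\<in>I - {\<kappa>}. (\<xi> i)\<^sup>2)))" for \<xi> t
      unfolding rad_def using fin \<kappa> by (simp add: sum.remove)
    have pos: "\<epsilon>\<^sup>2 + (t\<^sup>2 + (\<Sum>i\<in>I - {\<kappa>}. (\<xi> i)\<^sup>2)) > 0" for \<xi> :: "'i \<Rightarrow> real" and t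
      using \<epsilon> by (intro add_pos_nonneg add_nonneg_nonneg sum_nonneg) auto
    have dq: "((\<lambda>t. rad (\<xi>(\<kappa> := t))) has_real_derivative t / rad (\<xi>(\<kappa> := t))) (at t)" for \<xi> t
      unfolding upd using pos[of t \<xi>] by (auto intro!: derivative_eq_intros simp: field_simps)
    have cq: "continuous_on UNIV (\<lambda>t. rad (\<xi>(\<kappa> := t)))" for \<xi>
      unfolding upd by (intro continuous_intros)
    have sx: "\<bar>\<xi> \<kappa>\<bar> \<le> exp (\<Sum>i\<in>I. \<bar>\<xi> i\<bar>)" for \<xi> :: "'i \<Rightarrow> real"
    proof -
      have "\<bar>\<xi> \<kappa>\<bar> \<le> (\<Sum>i\<in>I. \<bar>\<xi> i\<bar>)" using fin \<kappa> by (intro member_le_sum) auto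
      then show ?thesis using exp_ge_add_one_self[of "\<Sum>i\<in>I. \<bar>\<xi> i\<bar>"] by linarith
    qed
    have eq: "K * exp (rad \<xi>) \<le> (K * exp \<epsilon>) * exp (\<Sum>i\<in>I. \<bar>\<xi> i\<bar>)" for \<xi>
      using K rad_le_sum[of \<xi>] by (simp add: exp_add[symmetric] mult.assoc mult_left_mono)
    have bq: "\<bar>\<phi> (rad \<xi>)\<bar> \<le> (K * exp \<epsilon>) * exp (\<Sum>i\<in>I. \<bar>\<xi> i\<bar>)"
      "\<bar>\<phi>' (rad \<xi>)\<bar> \<le> (K * exp \<epsilon>) * exp (\<Sum>i\<in>I. \<bar>\<xi> i\<bar>)" for \<xi>
      using b[OF rad_ge] eq by (blast intro: order_trans)+
    have bf: "\<bar>?f \<kappa> \<xi>\<bar> \<le> (2 * K * exp \<epsilon>) * exp (2 * (\<Sum>i\<in>I. \<bar>\<xi> i\<bar>))" for \<xi>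
    proof -
      have "\<bar>\<xi> \<kappa>\<bar> * \<bar>\<phi> (rad \<xi>)\<bar> \<le> exp (\<Sum>i\<in>I. \<bar>\<xi> i\<bar>) * ((K * exp \<epsilon>) * exp (\<Sum>i\<in>I. \<bar>\<xi> i\<bar>))"
        by (rule mult_mono[OF sx bq(1)]) auto
      also have "\<dots> = (K * exp \<epsilon>) * exp (2 * (\<Sum>i\<in>I. \<bar>\<xi> i\<bar>))"
        unfolding mult_2 exp_add by simp
      also have "\<dots> \<le> (2 * K * exp \<epsilon>) * exp (2 * (\<Sum>i\<in>I. \<bar>\<xi> i\<bar>))"
        using K by (intro mult_right_mono) auto
      finally show ?thesis by (simp only: abs_mult)
    qed
    have bf': "\<bar>?f' \<kappa> \<xi>\<bar> \<le> (2 * K * exp \<epsilon>) * exp (2 * (\<Sum>i\<in>I. \<bar>\<xi> i\<bar>))" for \<xi>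
    proof -
      let ?s = "\<Sum>i\<in>I. \<bar>\<xi> i\<bar>"
      have s1: "1 \<le> exp ?s" by (simp add: sum_nonneg)
      have "(\<xi> \<kappa>)\<^sup>2 \<le> (\<Sum>i\<in>I. (\<xi> i)\<^sup>2)" using fin \<kappa> by (intro member_le_sum) auto
      then have "sqrt ((\<xi> \<kappa>)\<^sup>2) \<le> rad \<xi>" unfolding rad_def by (intro real_sqrt_le_mono) (simp add: add_increasing)
      then have "\<bar>\<xi> \<kappa>\<bar> * \<bar>\<xi> \<kappa>\<bar> \<le> rad \<xi> * exp ?s" using sx[of \<xi>] by (intro mult_mono) auto
      then have "(\<xi> \<kappa>)\<^sup>2 / rad \<xi> \<le> exp ?s"
        using rad_pos[of \<xi>] by (simp add: divide_le_eq power2_eq_square mult.commute)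
      then have "\<bar>(\<xi> \<kappa>)\<^sup>2 / rad \<xi> * \<phi>' (rad \<xi>)\<bar> \<le> exp ?s * ((K * exp \<epsilon>) * exp ?s)"
        using rad_pos[of \<xi>] unfolding abs_mult by (intro mult_mono bq) auto
      moreover have "\<bar>\<phi> (rad \<xi>)\<bar> \<le> exp ?s * ((K * exp \<epsilon>) * exp ?s)"
        using bq(1)[of \<xi>] mult_right_mono[OF s1, of "(K * exp \<epsilon>) * exp ?s"] K by simp
      ultimately have "\<bar>?f' \<kappa> \<xi>\<bar> \<le> 2 * (exp ?s * ((K * exp \<epsilon>) * exp ?s))" by linarith
      then show ?thesis unfolding mult_2 exp_add by (simp add: algebra_simps)
    qed
    have df: "((\<lambda>t. ?f \<kappa> (\<xi>(\<kappa> := t))) has_real_derivative ?f' \<kappa> (\<xi>(\<kappa> := t))) (at t)" for \<xi> t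
    proof -
      have "((\<lambda>t. t * \<phi> (rad (\<xi>(\<kappa> := t)))) has_real_derivative
          1 * \<phi> (rad (\<xi>(\<kappa> := t))) + (\<phi>' (rad (\<xi>(\<kappa> := t))) * (t / rad (\<xi>(\<kappa> := t)))) * t) (at t)"
        by (intro DERIV_mult DERIV_ident DERIV_chain2[OF d\<phi> dq])
      then show ?thesis by (simp add: power2_eq_square mult_ac)
    qed
    have cf: "continuous_on UNIV (\<lambda>t. ?f' \<kappa> (\<xi>(\<kappa> := t)))" for \<xi>
      using rad_pos[THEN less_imp_neq] unfolding fun_upd_same
      by (intro continuous_intros cq continuous_on_compose2[OF c\<phi> cq] continuous_on_compose2[OF cont cq]) (auto simp: less_imp_neq[OF rad_pos, symmetric])
    have m: "?f \<kappa> \<in> borel_measurable (gaussN I)" "?f' \<kappa> \<in> borel_measurable (gaussN I)"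
      using \<kappa> by measurable
    note * = gaussN_integration_by_parts[where f = "?f \<kappa>" and f' = "?f' \<kappa>", OF fin \<kappa> m df cf bf bf']
    show "(\<integral>\<xi>. \<xi> \<kappa> * ?f \<kappa> \<xi> \<partial>gaussN I) = (\<integral>\<xi>. ?f' \<kappa> \<xi> \<partial>gaussN I)"
      "integrable (gaussN I) (\<lambda>\<xi>. \<xi> \<kappa> * ?f \<kappa> \<xi>)" "integrable (gaussN I) (?f' \<kappa>)"
      by (rule *)+
  qed
  have "(\<integral>\<xi>. ((rad \<xi>)\<^sup>2 - \<epsilon>\<^sup>2) * \<phi> (rad \<xi>) \<partial>gaussN I) = (\<integral>\<xi>. (\<Sum>\<kappa>\<in>I. \<xi> \<kappa> * ?f \<kappa> \<xi>) \<partial>gaussN I)"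
    unfolding rad_sq[symmetric] by (simp add: sum_distrib_right power2_eq_square mult.assoc)
  also have "\<dots> = (\<integral>\<xi>. (\<Sum>\<kappa>\<in>I. ?f' \<kappa> \<xi>) \<partial>gaussN I)"
    using ibp by (simp add: Bochner_Integration.integral_sum)
  finally show ?thesis
    by (simp add: rad_sq[symmetric] sum.distrib sum_distrib_right sum_divide_distrib)
qed

text \<open>
  The moments of the radius under the exponentially tilted measure, not normalized.
\<close>
definition mom :: "nat \<Rightarrow> real \<Rightarrow> real" where
  "mom k l = (\<integral>\<xi>. (rad \<xi>) ^ k * exp (- l * rad \<xi>) \<partial>gaussN I)"

lemma pow_le_exp: "t \<ge> 0 \<Longrightarrow> t ^ k \<le> exp (real k * t)" for t :: real
proof -
  assume t: "t \<ge> 0"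
  have "t \<le> exp t" using exp_ge_add_one_self[of t] by linarith
  then have "t ^ k \<le> exp t ^ k" using t by (intro power_mono)
  then show ?thesis by (simp add: exp_of_nat_mult)
qed

lemma mom_int: "integrable (gaussN I) (\<lambda>\<xi>. (rad \<xi>) ^ k * exp (- l * rad \<xi>))"
proof (rule integrable_rad[where K = 1 and c = "real k + \<bar>l\<bar>"])
  fix t assume "t \<ge> \<epsilon>"
  then have t: "t \<ge> 0" using \<epsilon> by linarith
  have "t ^ k * exp (- l * t) \<le> exp (real k * t) * exp (\<bar>l\<bar> * t)"
    using t mult_right_mono[of "- l" "\<bar>l\<bar>" t] by (intro mult_mono pow_le_exp) auto
  then show "\<bar>t ^ k * exp (- l * t)\<bar> \<le> 1 * exp ((real k + \<bar>l\<bar>) * t)"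
    using t by (simp add: abs_mult exp_add distrib_right)
qed auto

lemma inv_int: "l \<ge> 0 \<Longrightarrow> integrable (gaussN I) (\<lambda>\<xi>. exp (- l * rad \<xi>) / rad \<xi>)"
proof (rule integrable_rad[where K = "1 / \<epsilon>" and c = 0])
  fix t assume "t \<ge> \<epsilon>" "l \<ge> 0"
  moreover from this have "exp (- l * t) \<le> 1" using \<epsilon> by simp
  ultimately have "exp (- l * t) / t \<le> 1 / \<epsilon>" using \<epsilon> by (intro frac_le) auto
  then show "\<bar>exp (- l * t) / t\<bar> \<le> 1 / \<epsilon> * exp (0 * t)" using \<open>t \<ge> \<epsilon>\<close> \<epsilon> by simp
qed auto

lemma mom_mono_eps: "\<epsilon> * mom k l \<le> mom (Suc k) l"
proof -
  have "\<epsilon> * mom k l = (\<integral>\<xi>. \<epsilon> * ((rad \<xi>) ^ k * exp (- l * rad \<xi>)) \<partial>gaussN I)" by (simp add: mom_def)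
  also have "\<dots> \<le> (\<integral>\<xi>. (rad \<xi>) ^ Suc k * exp (- l * rad \<xi>) \<partial>gaussN I)"
    using rad_ge rad_pos by (intro integral_mono integrable_mult_right mom_int) (simp add: mult_right_mono less_imp_le mult.assoc)
  finally show ?thesis by (simp add: mom_def)
qed

lemma mom0_pos: "mom 0 l > 0"
proof -
  interpret prob_space "gaussN I" by (rule prob_space_gaussN)
  have "mom 0 l \<noteq> 0"
    using integral_nonneg_eq_0_iff_AE[OF mom_int[of 0 l]] by (auto simp: mom_def)
  moreover have "mom 0 l \<ge> 0"
    unfolding mom_def by (intro Bochner_Integration.integral_nonneg) simp
  ultimately show ?thesis by simp
qed

lemma mom_pos: "mom k l > 0"
proof (induction k)
  case (Suc k)
  then show ?case using mom_mono_eps[of k l] \<epsilon> by (smt (verit) mult_pos_pos)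
qed (rule mom0_pos)

text \<open>
  The radial formula for \<open>\<phi> t = exp (- l t)\<close>; for \<open>\<epsilon> = 0\<close> it is an equality.
\<close>
lemma mom_rec_0: assumes "l \<ge> 0" shows "card I * mom 0 l \<le> mom 2 l + l * mom 1 l"
proof -
  define r where "r = (\<integral>\<xi>. exp (- l * rad \<xi>) / rad \<xi> \<partial>gaussN I)"
  have r: "r \<ge> 0" unfolding r_def by (intro Bochner_Integration.integral_nonneg) (simp add: less_imp_le[OF rad_pos])
  have e1: "exp (- l * t) \<le> 1" if "t \<ge> \<epsilon>" for t using that \<epsilon> assms by simp
  have e2: "1 \<le> exp t" if "t \<ge> \<epsilon>" for t using that \<epsilon> by simp
  have "(\<integral>\<xi>. ((rad \<xi>)\<^sup>2 - \<epsilon>\<^sup>2) * exp (- l * rad \<xi>) \<partial>gaussN I) =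
    (\<integral>\<xi>. card I * exp (- l * rad \<xi>) + ((rad \<xi>)\<^sup>2 - \<epsilon>\<^sup>2) / rad \<xi> * (- l * exp (- l * rad \<xi>)) \<partial>gaussN I)"
  proof (rule radial_integration_by_parts[where K = "1 + l" and \<phi> = "\<lambda>t. exp (- l * t)" and \<phi>' = "\<lambda>t. - l * exp (- l * t)"])
    fix t
    show "((\<lambda>t. exp (- l * t)) has_real_derivative - l * exp (- l * t)) (at t)"
      by (auto intro!: derivative_eq_intros)
    assume t: "t \<ge> \<epsilon>"
    have "exp (- l * t) \<le> exp t" using e1[OF t] e2[OF t] by linarith
    then show "\<bar>exp (- l * t)\<bar> \<le> (1 + l) * exp t" "\<bar>- l * exp (- l * t)\<bar> \<le> (1 + l) * exp t"
      using assms mult_left_mono[of "exp (- l * t)" "exp t" l]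
      by (auto simp: abs_mult distrib_right intro: add_increasing2 add_increasing)
  qed (intro continuous_intros)
  also have "(\<lambda>\<xi>. ((rad \<xi>)\<^sup>2 - \<epsilon>\<^sup>2) * exp (- l * rad \<xi>)) =
     (\<lambda>\<xi>. (rad \<xi>) ^ 2 * exp (- l * rad \<xi>) - \<epsilon>\<^sup>2 * ((rad \<xi>) ^ 0 * exp (- l * rad \<xi>)))"
    by (simp add: left_diff_distrib)
  also have "(\<lambda>\<xi>. card I * exp (- l * rad \<xi>) + ((rad \<xi>)\<^sup>2 - \<epsilon>\<^sup>2) / rad \<xi> * (- l * exp (- l * rad \<xi>))) =
     (\<lambda>\<xi>. card I * ((rad \<xi>) ^ 0 * exp (- l * rad \<xi>)) - l * ((rad \<xi>) ^ 1 * exp (- l * rad \<xi>)) + l * \<epsilon>\<^sup>2 * (exp (- l * rad \<xi>) / rad \<xi>))"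
    using rad_pos by (auto simp: fun_eq_iff divide_simps power2_eq_square less_imp_neq[symmetric]) (simp add: algebra_simps)
  finally have "mom 2 l - \<epsilon>\<^sup>2 * mom 0 l = card I * mom 0 l - l * mom 1 l + l * \<epsilon>\<^sup>2 * r"
    unfolding mom_def r_def using mom_int[of 0 l] mom_int[of 1 l] mom_int[of 2 l] inv_int[OF assms]
    by (simp del: times_divide_eq_right)
  moreover have "0 \<le> l * \<epsilon>\<^sup>2 * r" "0 \<le> \<epsilon>\<^sup>2 * mom 0 l" using assms r mom_pos[of 0 l] by auto
  ultimately show ?thesis by linarith
qed

text \<open>
  The radial formula for \<open>\<phi> t = t exp (- l t)\<close>, where the factor \<open>t\<close> adds \<open>1\<close> to the dimension; this is
  the origin of the \<open>m + 1\<close> in the measurement condition. The summands with \<open>\<epsilon>\<close> are smoothing errors.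
\<close>
lemma mom_rec_1: assumes "l \<ge> 0"
  shows "mom 3 l + l * mom 2 l \<le> (card I + 1 + \<epsilon>\<^sup>2 + l * \<epsilon>) * mom 1 l"
proof -
  define r where "r = (\<integral>\<xi>. exp (- l * rad \<xi>) / rad \<xi> \<partial>gaussN I)"
  have r: "r \<ge> 0" unfolding r_def by (intro Bochner_Integration.integral_nonneg) (simp add: less_imp_le[OF rad_pos])
  have "(\<integral>\<xi>. ((rad \<xi>)\<^sup>2 - \<epsilon>\<^sup>2) * (rad \<xi> * exp (- l * rad \<xi>)) \<partial>gaussN I) =
    (\<integral>\<xi>. card I * (rad \<xi> * exp (- l * rad \<xi>)) + ((rad \<xi>)\<^sup>2 - \<epsilon>\<^sup>2) / rad \<xi> * ((1 - l * rad \<xi>) * exp (- l * rad \<xi>)) \<partial>gaussN I)"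
  proof (rule radial_integration_by_parts[where K = "1 + l" and \<phi> = "\<lambda>t. t * exp (- l * t)" and \<phi>' = "\<lambda>t. (1 - l * t) * exp (- l * t)"])
    fix t
    show "((\<lambda>t. t * exp (- l * t)) has_real_derivative (1 - l * t) * exp (- l * t)) (at t)"
      by (auto intro!: derivative_eq_intros simp: algebra_simps)
    assume "t \<ge> \<epsilon>"
    then have t: "t \<ge> 0" using \<epsilon> by linarith
    have e: "1 + t \<le> exp t" by (rule exp_ge_add_one_self)
    have e1: "exp (- l * t) \<le> 1" using t assms by simp
    have "t * exp (- l * t) \<le> t * 1" using t e1 by (intro mult_left_mono) auto
    also have "\<dots> \<le> 1 * exp t" using e by linarith
    also have "\<dots> \<le> (1 + l) * exp t" using assms by (intro mult_right_mono) auto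
    finally show "\<bar>t * exp (- l * t)\<bar> \<le> (1 + l) * exp t" using t by (simp add: abs_mult)
    have "\<bar>1 - l * t\<bar> * exp (- l * t) \<le> (1 + l * t) * 1"
      using e1 t assms by (intro mult_mono) (auto simp: abs_le_iff)
    also have "\<dots> \<le> (1 + l) * (1 + t)" using t assms by (simp add: algebra_simps)
    also have "\<dots> \<le> (1 + l) * exp t" using e assms by (intro mult_left_mono) auto
    finally show "\<bar>(1 - l * t) * exp (- l * t)\<bar> \<le> (1 + l) * exp t" by (simp add: abs_mult)
  qed (intro continuous_intros)
  also have "(\<lambda>\<xi>. ((rad \<xi>)\<^sup>2 - \<epsilon>\<^sup>2) * (rad \<xi> * exp (- l * rad \<xi>))) =
     (\<lambda>\<xi>. (rad \<xi>) ^ 3 * exp (- l * rad \<xi>) - \<epsilon>\<^sup>2 * ((rad \<xi>) ^ 1 * exp (- l * rad \<xi>)))"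
    by (simp add: fun_eq_iff power2_eq_square power3_eq_cube algebra_simps)
  also have "(\<lambda>\<xi>. card I * (rad \<xi> * exp (- l * rad \<xi>)) + ((rad \<xi>)\<^sup>2 - \<epsilon>\<^sup>2) / rad \<xi> * ((1 - l * rad \<xi>) * exp (- l * rad \<xi>))) =
     (\<lambda>\<xi>. (card I + 1) * ((rad \<xi>) ^ 1 * exp (- l * rad \<xi>)) - l * ((rad \<xi>) ^ 2 * exp (- l * rad \<xi>))
        + l * \<epsilon>\<^sup>2 * ((rad \<xi>) ^ 0 * exp (- l * rad \<xi>)) - \<epsilon>\<^sup>2 * (exp (- l * rad \<xi>) / rad \<xi>))"
    using rad_pos by (auto simp: fun_eq_iff divide_simps power2_eq_square less_imp_neq[symmetric]) (simp add: algebra_simps)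
  finally have "mom 3 l - \<epsilon>\<^sup>2 * mom 1 l = (card I + 1) * mom 1 l - l * mom 2 l + l * \<epsilon>\<^sup>2 * mom 0 l - \<epsilon>\<^sup>2 * r"
    unfolding mom_def r_def
    using mom_int[of 0 l] mom_int[of 1 l] mom_int[of 2 l] mom_int[of 3 l] inv_int[OF assms]
    by (simp del: times_divide_eq_right)
  moreover have "l * \<epsilon>\<^sup>2 * mom 0 l \<le> l * \<epsilon> * mom 1 l"
    using mult_left_mono[OF mom_mono_eps[of 0 l], of "l * \<epsilon>"] assms \<epsilon> by (simp add: power2_eq_square mult_ac)
  moreover have "0 \<le> \<epsilon>\<^sup>2 * r" using r by simp
  ultimately show ?thesis by (simp add: algebra_simps)
qed

lemma mom_cauchy_schwarz: "(mom 2 l / mom 1 l)\<^sup>2 * mom 1 l \<le> mom 3 l"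
proof -
  define R where "R = mom 2 l / mom 1 l"
  have "0 \<le> (\<integral>\<xi>. R\<^sup>2 * ((rad \<xi>) ^ 1 * exp (- l * rad \<xi>)) - 2 * R * ((rad \<xi>) ^ 2 * exp (- l * rad \<xi>))
      + (rad \<xi>) ^ 3 * exp (- l * rad \<xi>) \<partial>gaussN I)"
  proof (rule Bochner_Integration.integral_nonneg)
    fix \<xi>
    have "0 \<le> rad \<xi> * (R - rad \<xi>)\<^sup>2 * exp (- l * rad \<xi>)" using rad_pos[of \<xi>] by simp
    also have "\<dots> = R\<^sup>2 * ((rad \<xi>) ^ 1 * exp (- l * rad \<xi>)) - 2 * R * ((rad \<xi>) ^ 2 * exp (- l * rad \<xi>))
      + (rad \<xi>) ^ 3 * exp (- l * rad \<xi>)"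
      by (simp add: power2_eq_square power3_eq_cube algebra_simps)
    finally show "0 \<le> \<dots>" .
  qed
  also have "\<dots> = R\<^sup>2 * mom 1 l - 2 * R * mom 2 l + mom 3 l"
    unfolding mom_def using mom_int[of 1 l] mom_int[of 2 l] mom_int[of 3 l] by simp
  also have "mom 2 l = R * mom 1 l" using mom_pos[of 1 l] by (simp add: R_def)
  finally have "R\<^sup>2 * mom 1 l \<le> mom 3 l" by (simp add: power2_eq_square)
  then show ?thesis by (simp add: R_def)
qed

text \<open>
  Let \<open>R\<close> be the ratio of the second to the first moment. Cauchy-Schwarz and the recursion give
  \<open>R\<^sup>2 \<le> C\<close>, and the other recursion gives \<open>card I * mom 0 l \<le> (R + l) * mom 1 l\<close>. Finally
  \<open>n / (sqrt C + l) \<ge> n / sqrt C - l\<close> because \<open>n \<le> C\<close>.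
\<close>
lemma mom_ratio:
  assumes l: "0 \<le> l" "l \<le> b"
  defines "C \<equiv> card I + 1 + \<epsilon>\<^sup>2 + b * \<epsilon>"
  shows "(card I / sqrt C - l) * mom 0 l \<le> mom 1 l"
proof -
  have "0 \<le> b * \<epsilon>" "0 \<le> \<epsilon>\<^sup>2" using l \<epsilon> by auto
  then have C: "C > 0" "card I \<le> C" unfolding C_def by linarith+
  define R where "R = mom 2 l / mom 1 l"
  have R: "R \<ge> 0" using mom_pos[of 1 l] mom_pos[of 2 l] by (simp add: R_def)
  have m2: "mom 2 l = R * mom 1 l" using mom_pos[of 1 l] by (simp add: R_def)
  have "R\<^sup>2 * mom 1 l \<le> mom 3 l + l * mom 2 l"
    using mom_cauchy_schwarz[of l] l mom_pos[of 2 l] by (simp add: R_def add_increasing2)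
  also have "\<dots> \<le> C * mom 1 l"
    unfolding C_def using mom_pos[of 1 l] l \<epsilon>
    by (intro order_trans[OF mom_rec_1] mult_right_mono add_left_mono) auto
  finally have "R\<^sup>2 \<le> C" using mom_pos[of 1 l] by simp
  then have R': "R \<le> sqrt C" by (rule real_le_rsqrt)
  have "card I * mom 0 l \<le> (R + l) * mom 1 l"
    using mom_rec_0[OF l(1)] by (simp add: m2 algebra_simps)
  also have "\<dots> \<le> (sqrt C + l) * mom 1 l"
    using R' mom_pos[of 1 l] by (intro mult_right_mono) auto
  finally have 1: "card I * mom 0 l \<le> (sqrt C + l) * mom 1 l" .
  have "(card I / sqrt C - l) * (sqrt C + l) \<le> card I"
  proof -
    define a where "a = card I / sqrt C"
    have a: "a * sqrt C = card I" using C by (simp add: a_def)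
    have "a * l \<le> sqrt C * l"
      unfolding a_def using C l by (intro mult_right_mono) (auto simp: divide_le_eq)
    moreover have "(a - l) * (sqrt C + l) = a * sqrt C + (a * l - sqrt C * l) - l * l"
      by (simp add: algebra_simps)
    ultimately show ?thesis unfolding a a_def[symmetric] using zero_le_square[of l] by linarith
  qed
  then have "(card I / sqrt C - l) * (sqrt C + l) * mom 0 l \<le> card I * mom 0 l"
    using mom_pos[of 0 l] by (intro mult_right_mono) auto
  also note 1
  finally have "(sqrt C + l) * ((card I / sqrt C - l) * mom 0 l) \<le> (sqrt C + l) * mom 1 l"
    by (simp add: mult_ac)
  moreover have "sqrt C + l > 0" using C l by (simp add: add_pos_nonneg)
  ultimately show ?thesis by (simp add: mult_le_cancel_left_pos)
qed

lemma deriv_mom0: "(mom 0 has_real_derivative - mom 1 l) (at l)"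
proof -
  have "((\<lambda>l. \<integral>\<xi>. exp (- l * rad \<xi>) \<partial>gaussN I) has_real_derivative
      (\<integral>\<xi>. - rad \<xi> * exp (- l * rad \<xi>) \<partial>gaussN I)) (at l)"
  proof (rule has_real_derivative_integral)
    show "integrable (gaussN I) (\<lambda>\<xi>. exp (- l * rad \<xi>))" for l
      using mom_int[of 0 l] by simp
    show "((\<lambda>l. exp (- l * rad \<xi>)) has_real_derivative - rad \<xi> * exp (- l * rad \<xi>)) (at l)" for l \<xi>
      by (auto intro!: derivative_eq_intros)
    show "integrable (gaussN I) (\<lambda>\<xi>. (rad \<xi>) ^ 1 * exp (- (- (\<bar>l\<bar> + 1)) * rad \<xi>))"
      by (rule mom_int)
    fix l' :: real and \<xi> assume "\<bar>l' - l\<bar> \<le> 1"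
    then have "- l' * rad \<xi> \<le> (\<bar>l\<bar> + 1) * rad \<xi>"
      using rad_pos[of \<xi>] by (intro mult_right_mono) auto
    then show "\<bar>- rad \<xi> * exp (- l' * rad \<xi>)\<bar> \<le> (rad \<xi>) ^ 1 * exp (- (- (\<bar>l\<bar> + 1)) * rad \<xi>)"
      using rad_pos[of \<xi>] by (simp add: abs_mult add.commute)
  qed measurable
  then show ?thesis by (simp add: mom_def[abs_def])
qed

text \<open>
  The ratio bound says that the logarithmic derivative of \<open>mom 0\<close> is at most \<open>- \<mu> + t\<close>, with
  \<open>\<mu> = card I / sqrt (\<dots>)\<close>; it is integrated from \<open>0\<close> to \<open>l\<close>.
\<close>
lemma mom0_bound:
  assumes l: "l \<ge> 0"
  shows "mom 0 l \<le> exp (- l * (card I / sqrt (card I + 1 + \<epsilon>\<^sup>2 + l * \<epsilon>)) + l\<^sup>2 / 2)"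
proof -
  define \<mu> where "\<mu> = card I / sqrt (card I + 1 + \<epsilon>\<^sup>2 + l * \<epsilon>)"
  define g where "g t = exp (t * \<mu> - t\<^sup>2 / 2) * mom 0 t" for t
  have "g l \<le> g 0"
  proof (rule DERIV_nonpos_imp_nonincreasing[OF l])
    fix t assume t: "0 \<le> t" "t \<le> l"
    have "(g has_real_derivative exp (t * \<mu> - t\<^sup>2 / 2) * ((\<mu> - t) * mom 0 t - mom 1 t)) (at t)"
      unfolding g_def by (auto intro!: derivative_eq_intros deriv_mom0 simp: algebra_simps)
    moreover have "exp (t * \<mu> - t\<^sup>2 / 2) * ((\<mu> - t) * mom 0 t - mom 1 t) \<le> 0"
      using mom_ratio[OF t] by (simp add: \<mu>_def mult_le_0_iff)
    ultimately show "\<exists>y. (g has_real_derivative y) (at t) \<and> y \<le> 0" by blast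
  qed
  also have "g 0 = 1" using prob_space.prob_space[OF prob_space_gaussN[of I]] by (simp add: g_def mom_def)
  finally have "mom 0 l \<le> exp (- (l * \<mu> - l\<^sup>2 / 2))"
    by (simp add: g_def exp_minus field_simps)
  then show ?thesis by (simp add: \<mu>_def)
qed

end

text \<open>
  The lower tail of the norm is sub-Gaussian with variance \<open>1\<close> around the lower bound
  \<open>n / sqrt (n + 1)\<close> of its mean.
\<close>
lemma gaussian_norm_mgf:
  assumes fin: "finite I" and l: "l \<ge> 0"
  shows "(\<integral>\<xi>. exp (- l * L2_set \<xi> I) \<partial>gaussN I) \<le> exp (- l * (card I / sqrt (card I + 1)) + l\<^sup>2 / 2)"
proof -
  let ?lhs = "\<integral>\<xi>. exp (- l * L2_set \<xi> I) \<partial>gaussN I"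
  define f where "f \<epsilon> = exp (l * \<epsilon>) * exp (- l * (card I / sqrt (card I + 1 + \<epsilon>\<^sup>2 + l * \<epsilon>)) + l\<^sup>2 / 2)" for \<epsilon> :: real
  have "?lhs \<le> f \<epsilon>" if "\<epsilon> > 0" for \<epsilon>
  proof -
    interpret smooth_norm I \<epsilon> by unfold_locales fact+
    have "?lhs \<le> (\<integral>\<xi>. exp (l * \<epsilon>) * ((rad \<xi>) ^ 0 * exp (- l * rad \<xi>)) \<partial>gaussN I)"
    proof (intro integral_mono' integrable_mult_right mom_int)
      fix \<xi>
      show "exp (- l * L2_set \<xi> I) \<le> exp (l * \<epsilon>) * ((rad \<xi>) ^ 0 * exp (- l * rad \<xi>))"
        using mult_left_mono[OF rad_le[of \<xi>] l] by (simp add: exp_add[symmetric] algebra_simps)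
    qed auto
    also have "\<dots> = exp (l * \<epsilon>) * mom 0 l" by (simp add: mom_def)
    also have "\<dots> \<le> f \<epsilon>" unfolding f_def by (intro mult_left_mono mom0_bound l) auto
    finally show ?thesis .
  qed
  moreover have "(f \<longlongrightarrow> f 0) (at_right 0)"
    unfolding f_def by (intro tendsto_intros) auto
  ultimately have "?lhs \<le> f 0"
    by (intro tendsto_lowerbound[where F = "at_right 0" and f = f]) (auto simp: eventually_at_right_less eventually_at_filter)
  then show ?thesis by (simp add: f_def)
qed

section \<open>Exponential moments of a soft-thresholded Gaussian vector\<close>

text \<open>
  Exponential moments of squares are parametrized by \<open>\<alpha>\<close> instead of \<open>1 - 1 / \<alpha>\<^sup>2\<close>, because the moment
  itself is then \<open>\<alpha>\<close>.
\<close>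
lemma exp_square_density:
  assumes "\<alpha> > 0"
  shows "std_normal_density t * exp ((1 - 1 / \<alpha>\<^sup>2) * t\<^sup>2 / 2) = \<alpha> * normal_density 0 \<alpha> t"
proof -
  have "- t\<^sup>2 / 2 + (1 - 1 / \<alpha>\<^sup>2) * t\<^sup>2 / 2 = - t\<^sup>2 / (2 * \<alpha>\<^sup>2)"
    using assms by (simp add: field_simps)
  then have "exp (- t\<^sup>2 / 2) * exp ((1 - 1 / \<alpha>\<^sup>2) * t\<^sup>2 / 2) = exp (- t\<^sup>2 / (2 * \<alpha>\<^sup>2))"
    by (simp only: exp_add[symmetric])
  then show ?thesis
    using assms by (simp add: std_normal_density_def normal_density_def real_sqrt_mult)
qed

lemma integrable_gauss_exp_square:
  assumes "\<alpha> > 0"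
  shows "integrable gauss (\<lambda>t. exp ((1 - 1 / \<alpha>\<^sup>2) * t\<^sup>2 / 2))"
  by (subst integrable_gauss_iff) (auto simp: exp_square_density[OF assms] assms)

lemma integral_gauss_exp_square:
  assumes "\<alpha> > 0"
  shows "(\<integral>t. exp ((1 - 1 / \<alpha>\<^sup>2) * t\<^sup>2 / 2) \<partial>gauss) = \<alpha>"
  by (subst integral_gauss) (auto simp: exp_square_density[OF assms] assms)

text \<open>
  A Frullani integral; its value is \<open>ln \<alpha>\<close>, and \<open>\<alpha> - 1\<close> suffices. The integrand is the integral over
  \<open>1 \<le> a \<le> \<alpha>\<close> of the derivative of \<open>exp (- u\<^sup>2 / (2 a\<^sup>2)) / u\<close> in \<open>a\<close>, and for each \<open>a\<close> the integral over
  \<open>u\<close> is \<open>1 / a \<le> 1\<close>.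
\<close>
lemma frullani_gaussian:
  assumes "\<alpha> \<ge> 1"
  shows "(\<integral>\<^sup>+u. ennreal ((exp (- u\<^sup>2 / (2 * \<alpha>\<^sup>2)) - exp (- u\<^sup>2 / 2)) / u) * indicator {0..} u \<partial>lborel) \<le> ennreal (\<alpha> - 1)"
proof -
  let ?k = "\<lambda>a u::real. u / a ^ 3 * exp (- u\<^sup>2 / (2 * a\<^sup>2))"
  have inner: "ennreal ((exp (- u\<^sup>2 / (2 * \<alpha>\<^sup>2)) - exp (- u\<^sup>2 / 2)) / u) * indicator {0..} u =
      (\<integral>\<^sup>+a. ennreal (?k a u) * indicator {1..\<alpha>} a * indicator {0..} u \<partial>lborel)" for u
  proof (cases "u > 0")
    case True
    have "(\<integral>\<^sup>+a. ennreal (?k a u) * indicator {1..\<alpha>} a \<partial>lborel) =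
        ennreal (exp (- u\<^sup>2 / (2 * \<alpha>\<^sup>2)) / u - exp (- u\<^sup>2 / (2 * 1\<^sup>2)) / u)"
    proof (rule nn_integral_FTC_Icc[where F = "\<lambda>a. exp (- u\<^sup>2 / (2 * a\<^sup>2)) / u"])
      fix a assume "a \<in> {1..\<alpha>}"
      then have a: "1 \<le> a" by simp
      show "((\<lambda>a. exp (- u\<^sup>2 / (2 * a\<^sup>2)) / u) has_real_derivative ?k a u) (at a)"
        using a True
        by (auto intro!: derivative_eq_intros) (simp add: divide_simps power2_eq_square power3_eq_cube power4_eq_xxxx)
      show "0 \<le> ?k a u" using a True by auto
    qed (use assms in auto)
    then show ?thesis using True by (simp add: diff_divide_distrib)
  next
    case False
    then show ?thesis by (cases "u = 0") (auto simp: indicator_def)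
  qed
  have outer: "(\<integral>\<^sup>+u. ennreal (?k a u) * indicator {0..} u \<partial>lborel) \<le> 1" if a: "1 \<le> a" for a
  proof -
    have "(\<integral>\<^sup>+u. ennreal (?k a u) * indicator {0..} u \<partial>lborel) = ennreal (0 - (- (1 / a) * exp (- 0\<^sup>2 / (2 * a\<^sup>2))))"
    proof (rule nn_integral_FTC_atLeast[where F = "\<lambda>u. - (1 / a) * exp (- u\<^sup>2 / (2 * a\<^sup>2))"])
      fix u :: real assume u: "0 \<le> u"
      show "((\<lambda>u. - (1 / a) * exp (- u\<^sup>2 / (2 * a\<^sup>2))) has_real_derivative ?k a u) (at u)"
        using a by (auto intro!: derivative_eq_intros) (simp add: divide_simps power2_eq_square power3_eq_cube power4_eq_xxxx)
      show "0 \<le> ?k a u" using a u by auto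
    next
      have "filterlim (\<lambda>u. (1 / (2 * a\<^sup>2)) * u\<^sup>2) at_top at_top"
        using a by (intro filterlim_tendsto_pos_mult_at_top[OF tendsto_const] filterlim_pow_at_top filterlim_ident) auto
      then have "((\<lambda>u. exp (- u\<^sup>2 / (2 * a\<^sup>2))) \<longlongrightarrow> 0) at_top"
        by (intro filterlim_compose[OF exp_at_bot]) (simp add: filterlim_uminus_at_bot)
      from tendsto_mult_left[OF this, of "- (1 / a)"]
      show "((\<lambda>u. - (1 / a) * exp (- u\<^sup>2 / (2 * a\<^sup>2))) \<longlongrightarrow> 0) at_top" by simp
    qed simp
    also have "\<dots> \<le> 1" using a by (simp add: ennreal_le_1)
    finally show ?thesis .
  qed
  have "(\<integral>\<^sup>+u. ennreal ((exp (- u\<^sup>2 / (2 * \<alpha>\<^sup>2)) - exp (- u\<^sup>2 / 2)) / u) * indicator {0..} u \<partial>lborel) =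
    (\<integral>\<^sup>+u. (\<integral>\<^sup>+a. ennreal (?k a u) * indicator {1..\<alpha>} a * indicator {0..} u \<partial>lborel) \<partial>lborel)"
    by (simp only: inner)
  also have "\<dots> = (\<integral>\<^sup>+a. (\<integral>\<^sup>+u. ennreal (?k a u) * indicator {1..\<alpha>} a * indicator {0..} u \<partial>lborel) \<partial>lborel)"
    by (rule lborel_pair.Fubini') measurable
  also have "\<dots> = (\<integral>\<^sup>+a. (\<integral>\<^sup>+u. ennreal (?k a u) * indicator {0..} u \<partial>lborel) * indicator {1..\<alpha>} a \<partial>lborel)"
    by (intro nn_integral_cong) (auto simp: indicator_def)
  also have "\<dots> \<le> (\<integral>\<^sup>+a. indicator {1..\<alpha>} a \<partial>lborel)"
    using outer by (intro nn_integral_mono) (auto simp: indicator_def)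
  also have "\<dots> = ennreal (\<alpha> - 1)" using assms by simp
  finally show ?thesis .
qed

lemma two_y_le_exp: "2 * y \<le> exp y" if "y \<ge> 0" for y :: real
proof -
  have "2 * y \<le> 1 + y + y\<^sup>2 / 2"
    using zero_le_power2[of "1 - y"] by (simp add: power2_eq_square algebra_simps)
  also have "\<dots> \<le> exp y" using exp_lower_Taylor_quadratic[OF that] .
  finally show ?thesis .
qed

text \<open>
  The density at \<open>L + u\<close> is the density at \<open>u\<close> times \<open>exp (- L\<^sup>2 / 2) exp (- L u)\<close>. Bounding the last factor
  by \<open>1 / (2 L u)\<close> gains the factor \<open>1 / L\<close> over the trivial estimate, and the division by \<open>u\<close> leads to the
  Frullani integral. This gain keeps the sum over all coordinates below \<open>\<gamma> s\<close>.
\<close>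
lemma nn_integral_excess_half:
  assumes "\<alpha> \<ge> 1" "L > 0"
  shows "(\<integral>\<^sup>+u. ennreal (std_normal_density (L + u) * (exp ((1 - 1 / \<alpha>\<^sup>2) * u\<^sup>2 / 2) - 1)) * indicator {0..} u \<partial>lborel)
    \<le> ennreal (exp (- L\<^sup>2 / 2) / (4 * L) * (\<alpha> - 1))"
proof -
  let ?C = "exp (- L\<^sup>2 / 2) / (4 * L)"
  let ?F = "\<lambda>u. (exp (- u\<^sup>2 / (2 * \<alpha>\<^sup>2)) - exp (- u\<^sup>2 / 2)) / u"
  have pw: "std_normal_density (L + u) * (exp ((1 - 1 / \<alpha>\<^sup>2) * u\<^sup>2 / 2) - 1) \<le> ?C * ?F u" if u: "u > 0" for u
  proof -
    have "- (L + u)\<^sup>2 / 2 = - L\<^sup>2 / 2 + - (L * u) + - u\<^sup>2 / 2"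
      by (simp add: power2_eq_square field_simps)
    then have e: "exp (- (L + u)\<^sup>2 / 2) = exp (- L\<^sup>2 / 2) * exp (- (L * u)) * exp (- u\<^sup>2 / 2)"
      by (simp only: exp_add)
    have "- u\<^sup>2 / 2 + (1 - 1 / \<alpha>\<^sup>2) * u\<^sup>2 / 2 = - u\<^sup>2 / (2 * \<alpha>\<^sup>2)"
      using assms by (simp add: field_simps)
    then have e2: "exp (- u\<^sup>2 / 2) * (exp ((1 - 1 / \<alpha>\<^sup>2) * u\<^sup>2 / 2) - 1) = exp (- u\<^sup>2 / (2 * \<alpha>\<^sup>2)) - exp (- u\<^sup>2 / 2)"
      by (simp only: right_diff_distrib exp_add[symmetric] mult_1_right)
    have "u\<^sup>2 / \<alpha>\<^sup>2 \<le> u\<^sup>2" using assms by (simp add: divide_le_eq mult_le_cancel_left1 one_le_power)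
    then have nn: "exp (- u\<^sup>2 / (2 * \<alpha>\<^sup>2)) - exp (- u\<^sup>2 / 2) \<ge> 0" by simp
    have "exp (- (L * u)) \<le> 1 / (2 * (L * u))"
      using two_y_le_exp[of "L * u"] u assms by (simp add: exp_minus field_simps)
    moreover have "1 / sqrt (2 * pi) \<le> 1 / 2"
    proof -
      have "2 = sqrt 4" by simp
      also have "\<dots> \<le> sqrt (2 * pi)" using pi_gt3 by (intro real_sqrt_le_mono) simp
      finally show ?thesis by (intro divide_left_mono) auto
    qed
    ultimately have "1 / sqrt (2 * pi) * exp (- (L * u)) \<le> 1 / 2 * (1 / (2 * (L * u)))"
      by (intro mult_mono) auto
    then have "exp (- L\<^sup>2 / 2) * (1 / sqrt (2 * pi) * exp (- (L * u))) * (exp (- u\<^sup>2 / (2 * \<alpha>\<^sup>2)) - exp (- u\<^sup>2 / 2))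
       \<le> exp (- L\<^sup>2 / 2) * (1 / 2 * (1 / (2 * (L * u)))) * (exp (- u\<^sup>2 / (2 * \<alpha>\<^sup>2)) - exp (- u\<^sup>2 / 2))"
      by (intro mult_right_mono mult_left_mono nn) auto
    also have "\<dots> = ?C * ?F u" using u assms by (simp add: field_simps)
    finally show ?thesis unfolding std_normal_density_def e e2[symmetric] by (simp add: mult_ac)
  qed
  have "(\<integral>\<^sup>+u. ennreal (std_normal_density (L + u) * (exp ((1 - 1 / \<alpha>\<^sup>2) * u\<^sup>2 / 2) - 1)) * indicator {0..} u \<partial>lborel)
     \<le> (\<integral>\<^sup>+u. ennreal ?C * (ennreal (?F u) * indicator {0..} u) \<partial>lborel)"
  proof (rule nn_integral_mono)
    fix u :: real
    show "ennreal (std_normal_density (L + u) * (exp ((1 - 1 / \<alpha>\<^sup>2) * u\<^sup>2 / 2) - 1)) * indicator {0..} u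
        \<le> ennreal ?C * (ennreal (?F u) * indicator {0..} u)"
    proof (cases "u > 0")
      case True
      have "ennreal (std_normal_density (L + u) * (exp ((1 - 1 / \<alpha>\<^sup>2) * u\<^sup>2 / 2) - 1)) \<le> ennreal (?C * ?F u)"
        by (rule ennreal_leI[OF pw[OF True]])
      also have "\<dots> = ennreal ?C * ennreal (?F u)" using assms by (intro ennreal_mult') simp
      finally show ?thesis using True by simp
    qed (auto simp: indicator_def)
  qed
  also have "\<dots> = ennreal ?C * (\<integral>\<^sup>+u. ennreal (?F u) * indicator {0..} u \<partial>lborel)"
    by (rule nn_integral_cmult) measurable
  also have "\<dots> \<le> ennreal ?C * ennreal (\<alpha> - 1)"
    using frullani_gaussian[OF assms(1)] by (rule mult_left_mono) simp
  also have "\<dots> = ennreal (?C * (\<alpha> - 1))" using assms by (intro ennreal_mult'[symmetric]) simp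
  finally show ?thesis .
qed

text \<open>
  Compared with \<open>integral_gauss_exp_square\<close>, where the moment is \<open>1 + (\<alpha> - 1)\<close>, thresholding at \<open>L\<close>
  multiplies the excess over \<open>1\<close> by at most \<open>exp (- L\<^sup>2 / 2) / (2 * L)\<close>: a thresholded coordinate counts as that fraction of a
  full coordinate. Both half-lines contribute the bound of the previous lemma.
\<close>
lemma soft_threshold_mgf:
  assumes "\<alpha> \<ge> 1" "L > 0"
  shows "integrable gauss (\<lambda>t. exp ((1 - 1 / \<alpha>\<^sup>2) * (max 0 (\<bar>t\<bar> - L))\<^sup>2 / 2))"
    and "(\<integral>t. exp ((1 - 1 / \<alpha>\<^sup>2) * (max 0 (\<bar>t\<bar> - L))\<^sup>2 / 2) \<partial>gauss) \<le> 1 + exp (- L\<^sup>2 / 2) / (2 * L) * (\<alpha> - 1)"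
proof -
  let ?\<theta> = "1 - 1 / \<alpha>\<^sup>2"
  let ?E = "\<lambda>t. exp (?\<theta> * (max 0 (\<bar>t\<bar> - L))\<^sup>2 / 2)"
  have \<theta>: "?\<theta> \<ge> 0" using assms by (simp add: one_le_power)
  show int: "integrable gauss ?E"
  proof (rule Bochner_Integration.integrable_bound)
    show "integrable gauss (\<lambda>t. exp (?\<theta> * t\<^sup>2 / 2))"
      using assms by (intro integrable_gauss_exp_square) simp
    have "(max 0 (\<bar>t\<bar> - L))\<^sup>2 \<le> t\<^sup>2" for t
      using assms power_mono[of "max 0 (\<bar>t\<bar> - L)" "\<bar>t\<bar>" 2] by simp
    then show "AE t in gauss. norm (?E t) \<le> norm (exp (?\<theta> * t\<^sup>2 / 2))"
      using \<theta> by (intro AE_I2) (simp add: mult_left_mono divide_right_mono)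
  qed simp
  let ?r = "\<lambda>u. exp (?\<theta> * u\<^sup>2 / 2) - 1"
  let ?p = std_normal_density
  have even: "?p (- t) = ?p t" for t by (simp add: std_normal_density_def)
  have "(\<integral>\<^sup>+t. ennreal (?p t * (?E t - 1)) \<partial>lborel) \<le>
      (\<integral>\<^sup>+t. ennreal (?p t * ?r (t - L)) * indicator {0..} (t - L) + ennreal (?p t * ?r (- t - L)) * indicator {0..} (- t - L) \<partial>lborel)"
    by (intro nn_integral_mono) (use assms in \<open>auto simp: indicator_def max_def abs_if\<close>)
  also have "\<dots> = (\<integral>\<^sup>+t. ennreal (?p t * ?r (t - L)) * indicator {0..} (t - L) \<partial>lborel)
      + (\<integral>\<^sup>+t. ennreal (?p t * ?r (- t - L)) * indicator {0..} (- t - L) \<partial>lborel)"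
    by (rule nn_integral_add) measurable
  also have "(\<integral>\<^sup>+t. ennreal (?p t * ?r (t - L)) * indicator {0..} (t - L) \<partial>lborel) =
      (\<integral>\<^sup>+u. ennreal (?p (L + u) * ?r u) * indicator {0..} u \<partial>lborel)"
    by (subst nn_integral_real_affine[where c = 1 and t = L]) auto
  also have "(\<integral>\<^sup>+t. ennreal (?p t * ?r (- t - L)) * indicator {0..} (- t - L) \<partial>lborel) =
      (\<integral>\<^sup>+u. ennreal (?p (L + u) * ?r u) * indicator {0..} u \<partial>lborel)"
    using even[of "L + u" for u] by (subst nn_integral_real_affine[where c = "- 1" and t = "- L"]) auto
  also have "(\<integral>\<^sup>+u. ennreal (?p (L + u) * ?r u) * indicator {0..} u \<partial>lborel)
      + (\<integral>\<^sup>+u. ennreal (?p (L + u) * ?r u) * indicator {0..} u \<partial>lborel)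
      \<le> ennreal (exp (- L\<^sup>2 / 2) / (4 * L) * (\<alpha> - 1)) + ennreal (exp (- L\<^sup>2 / 2) / (4 * L) * (\<alpha> - 1))"
    by (intro add_mono nn_integral_excess_half assms)
  also have "\<dots> = ennreal (exp (- L\<^sup>2 / 2) / (2 * L) * (\<alpha> - 1))"
    using assms by (subst ennreal_plus[symmetric]) (auto simp: field_simps)
  finally have *: "(\<integral>\<^sup>+t. ennreal (?p t * (?E t - 1)) \<partial>lborel) \<le> ennreal (exp (- L\<^sup>2 / 2) / (2 * L) * (\<alpha> - 1))" .
  have i: "integrable gauss (\<lambda>t. ?E t - 1)" using int by simp
  then have "integrable lborel (\<lambda>t. ?p t * (?E t - 1))" by (subst (asm) integrable_gauss_iff) auto
  moreover have "0 \<le> ?p t * (?E t - 1)" for t using \<theta> by (intro mult_nonneg_nonneg) auto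
  ultimately have "(\<integral>t. ?p t * (?E t - 1) \<partial>lborel) \<le> exp (- L\<^sup>2 / 2) / (2 * L) * (\<alpha> - 1)"
    using * assms by (subst (asm) nn_integral_eq_integral) (auto simp: ennreal_le_iff)
  moreover have "(\<integral>t. ?p t * (?E t - 1) \<partial>lborel) = (\<integral>t. ?E t - 1 \<partial>gauss)"
    by (rule integral_gauss[symmetric]) measurable
  moreover have "(\<integral>t. ?E t - 1 \<partial>gauss) = (\<integral>t. ?E t \<partial>gauss) - 1"
    using int gauss.prob_space by simp
  ultimately show "(\<integral>t. ?E t \<partial>gauss) \<le> 1 + exp (- L\<^sup>2 / 2) / (2 * L) * (\<alpha> - 1)" by simp
qed

text \<open>
  With \<open>K\<close> an upper bound for the effective number of coordinates, the norm is sub-Gaussian with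
  variance \<open>1\<close> around \<open>sqrt K\<close>. The norm \<open>n\<close> is linearized by \<open>2 l n \<le> l a + (l / a) n\<^sup>2\<close>, which makes
  the coordinates independent factors. The choice of \<open>a\<close> with \<open>a\<^sup>2 - l a = K\<close> is the optimal one; after
  \<open>ln \<alpha> \<le> \<alpha> - 1\<close> the remaining gap is the square \<open>K (1 - 1 / \<alpha>)\<^sup>2 / 2\<close>.
\<close>
lemma thresholded_norm_mgf:
  fixes L :: "'i \<Rightarrow> real" and l K :: real
  assumes J: "finite J" "S \<subseteq> J" and L: "\<And>j. j \<in> J - S \<Longrightarrow> L j > 0" and l: "l \<ge> 0" and K: "K > 0"
    and le: "card S + (\<Sum>j\<in>J - S. exp (- (L j)\<^sup>2 / 2) / (2 * L j)) \<le> K"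
  defines "c \<equiv> \<lambda>\<xi> j. if j \<in> S then \<bar>\<xi> j\<bar> else max 0 (\<bar>\<xi> j\<bar> - L j)"
  shows "integrable (gaussN J) (\<lambda>\<xi>. exp (l * L2_set (c \<xi>) J))"
    and "(\<integral>\<xi>. exp (l * L2_set (c \<xi>) J) \<partial>gaussN J) \<le> exp (l * sqrt K + l\<^sup>2 / 2)"
proof -
  have cle: "0 \<le> c \<xi> j" "c \<xi> j \<le> \<bar>\<xi> j\<bar>" if "j \<in> J" for \<xi> j
    using L[of j] that by (auto simp: c_def)
  show int: "integrable (gaussN J) (\<lambda>\<xi>. exp (l * L2_set (c \<xi>) J))"
  proof (rule integrable_gaussN_bound[OF J(1)])
    show "(\<lambda>\<xi>. exp (l * L2_set (c \<xi>) J)) \<in> borel_measurable (gaussN J)"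
      unfolding c_def L2_set_def using J by measurable
    fix \<xi>
    have "L2_set (c \<xi>) J \<le> (\<Sum>j\<in>J. \<bar>c \<xi> j\<bar>)" by (rule L2_set_le_sum_abs)
    also have "\<dots> \<le> (\<Sum>j\<in>J. \<bar>\<xi> j\<bar>)" using cle by (intro sum_mono) auto
    finally show "\<bar>exp (l * L2_set (c \<xi>) J)\<bar> \<le> 1 * exp (l * (\<Sum>j\<in>J. \<bar>\<xi> j\<bar>))"
      using l by (simp add: mult_left_mono)
  qed
  define k where "k = sqrt K"
  have k: "k > 0" "k\<^sup>2 = K" using K by (auto simp: k_def)
  \<comment> \<open>the positive root of \<open>a\<^sup>2 - l a = K\<close>\<close>
  define a where "a = (l + sqrt (l\<^sup>2 + 4 * K)) / 2"
  have sq: "(sqrt (l\<^sup>2 + 4 * K))\<^sup>2 = l\<^sup>2 + 4 * K" using K by simp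
  have aK: "a\<^sup>2 - l * a = K"
    using sq by (simp add: a_def power2_eq_square field_simps)
  have "sqrt (4 * K) \<le> sqrt (l\<^sup>2 + 4 * K)" by (intro real_sqrt_le_mono) simp
  then have ak: "a \<ge> k" using l by (simp add: a_def k_def real_sqrt_mult)
  then have a: "a > 0" using k by linarith
  define \<alpha> where "\<alpha> = a / k"
  have \<alpha>: "\<alpha> \<ge> 1" using ak k by (simp add: \<alpha>_def)
  have a_eq: "a = k * \<alpha>" using k by (simp add: \<alpha>_def)
  have l_eq: "l = k * (\<alpha> - 1 / \<alpha>)"
  proof -
    have "l * a = a\<^sup>2 - k\<^sup>2" using aK k by simp
    then have "l = (a\<^sup>2 - k\<^sup>2) / a" using a by (simp add: eq_divide_eq)
    also have "\<dots> = k * (\<alpha> - 1 / \<alpha>)" using k \<alpha> by (simp add: a_eq field_simps power2_eq_square)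
    finally show ?thesis .
  qed
  let ?\<theta> = "1 - 1 / \<alpha>\<^sup>2"
  have la: "l / a = ?\<theta>" using k \<alpha> by (simp add: a_eq l_eq field_simps power2_eq_square)
  define f where "f j t = exp (?\<theta> * (if j \<in> S then t\<^sup>2 else (max 0 (\<bar>t\<bar> - L j))\<^sup>2) / 2)" for j and t :: real
  define w where "w j = (if j \<in> S then 1 else exp (- (L j)\<^sup>2 / 2) / (2 * L j))" for j
  have f: "integrable gauss (f j)" "(\<integral>t. f j t \<partial>gauss) \<le> exp (w j * (\<alpha> - 1))" "0 \<le> (\<integral>t. f j t \<partial>gauss)" if "j \<in> J" for j
  proof -
    show "0 \<le> (\<integral>t. f j t \<partial>gauss)" by (intro Bochner_Integration.integral_nonneg) (simp add: f_def)
    show "integrable gauss (f j)" "(\<integral>t. f j t \<partial>gauss) \<le> exp (w j * (\<alpha> - 1))"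
    proof (atomize (full), cases "j \<in> S")
      case True
      then show "integrable gauss (f j) \<and> (\<integral>t. f j t \<partial>gauss) \<le> exp (w j * (\<alpha> - 1))"
        using \<alpha> integrable_gauss_exp_square[of \<alpha>] integral_gauss_exp_square[of \<alpha>] exp_ge_add_one_self[of "\<alpha> - 1"]
        by (simp add: f_def[abs_def] w_def)
    next
      case False
      then have Lj: "L j > 0" using L that by simp
      show "integrable gauss (f j) \<and> (\<integral>t. f j t \<partial>gauss) \<le> exp (w j * (\<alpha> - 1))"
        using False soft_threshold_mgf(1)[OF \<alpha> Lj] order_trans[OF soft_threshold_mgf(2)[OF \<alpha> Lj] exp_ge_add_one_self]
        by (simp add: f_def[abs_def] w_def)
    qed
  qed
  have pw: "exp (l * L2_set (c \<xi>) J) \<le> exp (l * a / 2) * (\<Prod>j\<in>J. f j (\<xi> j))" for \<xi>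
  proof -
    let ?n = "L2_set (c \<xi>) J"
    have "0 \<le> (l / a) * (a - ?n)\<^sup>2" using l a by simp
    also have "\<dots> = l * a - 2 * (l * ?n) + (l / a) * ?n\<^sup>2"
      using a by (simp add: power2_eq_square field_simps)
    finally have "l * ?n \<le> l * a / 2 + (l / a * ?n\<^sup>2) / 2" by argo
    then have "l * ?n \<le> l * a / 2 + ?\<theta> * ?n\<^sup>2 / 2" unfolding la .
    also have "?n\<^sup>2 = (\<Sum>j\<in>J. if j \<in> S then (\<xi> j)\<^sup>2 else (max 0 (\<bar>\<xi> j\<bar> - L j))\<^sup>2)"
      by (simp add: L2_set_def sum_nonneg c_def if_distrib[where f = "\<lambda>x. x\<^sup>2"] cong: if_cong)
    finally show ?thesis
      using J by (simp add: f_def exp_add[symmetric] exp_sum[symmetric] sum_distrib_left sum_divide_distrib)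
  qed
  have "(\<integral>\<xi>. exp (l * L2_set (c \<xi>) J) \<partial>gaussN J) \<le> (\<integral>\<xi>. exp (l * a / 2) * (\<Prod>j\<in>J. f j (\<xi> j)) \<partial>gaussN J)"
    by (intro integral_mono int integrable_mult_right gaussN.product_integrable_prod J f pw)
  also have "\<dots> = exp (l * a / 2) * (\<Prod>j\<in>J. \<integral>t. f j t \<partial>gauss)"
    using f(1) J by (simp add: gaussN.product_integral_prod)
  also have "\<dots> \<le> exp (l * a / 2) * (\<Prod>j\<in>J. exp (w j * (\<alpha> - 1)))"
    using f by (intro mult_left_mono prod_mono) auto
  also have "\<dots> = exp (l * a / 2 + (\<Sum>j\<in>J. w j) * (\<alpha> - 1))"
    using J by (simp add: exp_add exp_sum[symmetric] sum_distrib_right)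
  also have "\<dots> \<le> exp (l * sqrt K + l\<^sup>2 / 2)"
  proof -
    have "(\<Sum>j\<in>J. w j) = card S + (\<Sum>j\<in>J - S. exp (- (L j)\<^sup>2 / 2) / (2 * L j))"
      using J by (subst sum.subset_diff[OF J(2) J(1)]) (simp add: w_def)
    then have "(\<Sum>j\<in>J. w j) * (\<alpha> - 1) \<le> K * (\<alpha> - 1)"
      using le \<alpha> by (intro mult_right_mono) auto
    moreover have "l * sqrt K + l\<^sup>2 / 2 - (l * a / 2 + K * (\<alpha> - 1)) = k\<^sup>2 * (1 - 1 / \<alpha>)\<^sup>2 / 2"
      using \<alpha> unfolding k_def[symmetric] unfolding k(2)[symmetric]
      by (simp add: a_eq l_eq power2_eq_square field_simps)
    moreover have "0 \<le> k\<^sup>2 * (1 - 1 / \<alpha>)\<^sup>2 / 2" by simp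
    ultimately have "l * a / 2 + (\<Sum>j\<in>J. w j) * (\<alpha> - 1) \<le> l * sqrt K + l\<^sup>2 / 2" by argo
    then show ?thesis by simp
  qed
  finally show "(\<integral>\<xi>. exp (l * L2_set (c \<xi>) J) \<partial>gaussN J) \<le> exp (l * sqrt K + l\<^sup>2 / 2)" .
qed

text \<open>
  The two terms of the minimum cross at \<open>j = r = s exp (x / 2)\<close>. The first \<open>n = \<lfloor>r\<rfloor>\<close> summands
  contribute at most \<open>r exp (- x)\<close>, the rest at most \<open>s\<^sup>2 / n \<le> 2 s\<^sup>2 / r\<close> by telescoping.
\<close>
lemma sum_min_inverse_square_le:
  fixes s x :: real
  assumes s: "s \<ge> 1" and x: "x \<ge> 0"
  shows "(\<Sum>j\<in>{1..N}. min (exp (- x)) ((s / real j)\<^sup>2)) \<le> 3 * s * exp (- x / 2)"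
proof -
  define r where "r = s * exp (x / 2)"
  define n where "n = nat \<lfloor>r\<rfloor>"
  have r: "r \<ge> 1" using s x mult_mono[of 1 s 1 "exp (x / 2)"] by (simp add: r_def)
  have n1: "n \<ge> 1" using r by (simp add: n_def le_nat_floor)
  have nr: "real n \<le> r" using r by (simp add: n_def)
  have rn: "r \<le> 2 * real n" using r n1 unfolding n_def by linarith
  have e: "exp (x / 2) * exp (x / 2) = exp x" "exp (- x / 2) = 1 / exp (x / 2)" "exp (- x) = 1 / exp x"
    by (simp_all add: exp_add[symmetric] exp_minus field_simps)
  have *: "(\<Sum>j\<in>{1..N}. min (exp (- x)) ((s / real j)\<^sup>2)) \<le> n * exp (- x) + s\<^sup>2 / n"
  proof (cases "N \<le> n")
    case True
    have "(\<Sum>j\<in>{1..N}. min (exp (- x)) ((s / real j)\<^sup>2)) \<le> (\<Sum>j\<in>{1..N}. exp (- x))"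
      by (intro sum_mono) auto
    also have "\<dots> \<le> n * exp (- x)" using True by simp
    finally show ?thesis using n1 by (simp add: add_increasing2)
  next
    case False
    then have "n \<le> N" by simp
    then have "(\<Sum>j\<in>{1..N}. min (exp (- x)) ((s / real j)\<^sup>2)) \<le> n * exp (- x) + s\<^sup>2 * (1 / n - 1 / N)"
    proof (induction N rule: dec_induct)
      case base
      have "(\<Sum>j\<in>{1..n}. min (exp (- x)) ((s / real j)\<^sup>2)) \<le> (\<Sum>j\<in>{1..n}. exp (- x))"
        by (intro sum_mono) auto
      then show ?case by simp
    next
      case (step N)
      have N: "real N > 0" using step n1 by simp
      have "(s / real (Suc N))\<^sup>2 \<le> s\<^sup>2 * (1 / N - 1 / Suc N)"
      proof -
        have "1 / (real (Suc N))\<^sup>2 \<le> 1 / N - 1 / Suc N"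
        proof -
          have "1 / N - 1 / Suc N = 1 / (real N * real (Suc N))" using N by (simp add: field_simps)
          moreover have "1 / (real (Suc N))\<^sup>2 \<le> 1 / (real N * real (Suc N))"
            unfolding power2_eq_square using N by (intro divide_left_mono mult_right_mono) auto
          ultimately show ?thesis by simp
        qed
        from mult_left_mono[OF this, of "s\<^sup>2"] show ?thesis by (simp add: power_divide)
      qed
      then have "min (exp (- x)) ((s / real (Suc N))\<^sup>2) \<le> s\<^sup>2 * (1 / N - 1 / Suc N)" by simp
      then show ?case using step by (simp add: right_diff_distrib)
    qed
    also have "\<dots> \<le> n * exp (- x) + s\<^sup>2 / n" by (simp add: right_diff_distrib)
    finally show ?thesis .
  qed
  also have "n * exp (- x) \<le> r * exp (- x)" using nr by simp
  also have "r * exp (- x) = s * exp (- x / 2)" unfolding r_def e by (simp add: e(1)[symmetric])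
  also have "s\<^sup>2 / n \<le> s\<^sup>2 / (r / 2)" using rn r n1 by (intro divide_left_mono) auto
  also have "s\<^sup>2 / (r / 2) = 2 * (s * exp (- x / 2))" using s unfolding r_def e by (simp add: power2_eq_square)
  finally show ?thesis by simp
qed

text \<open>
  The weight condition gives \<open>exp (- (L j)\<^sup>2 / 2) \<le> min (exp (- 1 / \<gamma>)) ((s / j)\<^sup>2)\<close> and
  \<open>L j \<ge> y = sqrt (2 / \<gamma>)\<close>. The sum is then at most \<open>3 s exp (- x / 2) / (2 y)\<close> with \<open>x = 1 / \<gamma>\<close>, and
  \<open>exp (- x / 2) \<le> 1 / y\<close> turns this into a multiple of \<open>s / x\<close>.
\<close>
lemma weighted_tail_sum_le:
  fixes \<gamma> :: real and \<omega> :: "nat \<Rightarrow> real" and s N :: nat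
  assumes s: "s \<ge> 1" and \<gamma>: "\<gamma> > 0"
    and w: "\<And>j. j \<in> {1..N} \<Longrightarrow> \<omega> j \<ge> max 1 (sqrt (2 * \<gamma> * ln (real j / real s)))"
    and J: "J \<subseteq> {1..N}"
  defines "L \<equiv> \<lambda>j. sqrt (2 / \<gamma>) * \<omega> j"
  shows "(\<Sum>j\<in>J. exp (- (L j)\<^sup>2 / 2) / (2 * L j)) \<le> 3 / 4 * (\<gamma> * s)"
proof -
  define x where "x = 1 / \<gamma>"
  have x: "x > 0" using \<gamma> by (simp add: x_def)
  define y where "y = sqrt (2 * x)"
  have y: "y > 0" "y * y = 2 * x" using x by (auto simp: y_def)
  have L: "L j \<ge> y" "exp (- (L j)\<^sup>2 / 2) \<le> min (exp (- x)) ((real s / real j)\<^sup>2)" if j: "j \<in> {1..N}" for j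
  proof -
    have w1: "\<omega> j \<ge> 1" using w[OF j] by simp
    have yx: "y = sqrt (2 / \<gamma>)" by (simp add: y_def x_def)
    show "L j \<ge> y" using w1 y by (simp add: L_def yx[symmetric])
    have Lsq: "(L j)\<^sup>2 / 2 = x * (\<omega> j)\<^sup>2"
      using y by (simp add: L_def yx[symmetric] power_mult_distrib power2_eq_square)
    have "x * 1 \<le> x * (\<omega> j)\<^sup>2" using w1 x by (intro mult_left_mono) (auto simp: one_le_power)
    then have 1: "exp (- (L j)\<^sup>2 / 2) \<le> exp (- x)" using Lsq by simp
    have 2: "exp (- (L j)\<^sup>2 / 2) \<le> (real s / real j)\<^sup>2"
    proof (cases "j \<le> s")
      case True
      then have "1 \<le> real s / real j" using j by simp
      then have "1 \<le> (real s / real j)\<^sup>2" by (rule one_le_power)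
      moreover have "exp (- (L j)\<^sup>2 / 2) \<le> 1" by simp
      ultimately show ?thesis by linarith
    next
      case False
      have js: "real j / real s > 0" using j s by simp
      have ln: "0 \<le> ln (real j / real s)" using False s by simp
      have "sqrt (2 * \<gamma> * ln (real j / real s)) \<le> \<omega> j" using w[OF j] by simp
      then have "(sqrt (2 * \<gamma> * ln (real j / real s)))\<^sup>2 \<le> (\<omega> j)\<^sup>2"
        using ln \<gamma> by (intro power_mono) auto
      then have "2 * \<gamma> * ln (real j / real s) \<le> (\<omega> j)\<^sup>2" using ln \<gamma> by simp
      from mult_left_mono[OF this, of x] have "2 * ln (real j / real s) \<le> (L j)\<^sup>2 / 2"
        unfolding Lsq using \<gamma> by (simp add: x_def)
      then have "exp (- (L j)\<^sup>2 / 2) \<le> exp (- (2 * ln (real j / real s)))" by simp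
      also have "\<dots> = (real s / real j)\<^sup>2"
        unfolding exp_minus exp_double exp_ln[OF js] by (simp add: power_divide)
      finally show ?thesis .
    qed
    show "exp (- (L j)\<^sup>2 / 2) \<le> min (exp (- x)) ((real s / real j)\<^sup>2)" using 1 2 by simp
  qed
  have Lpos: "L j > 0" if "j \<in> {1..N}" for j using L(1)[OF that] y by linarith
  have "(\<Sum>j\<in>J. exp (- (L j)\<^sup>2 / 2) / (2 * L j)) \<le> (\<Sum>j\<in>{1..N}. exp (- (L j)\<^sup>2 / 2) / (2 * L j))"
    using J Lpos by (intro sum_mono2) (auto intro!: divide_nonneg_pos)
  also have "\<dots> \<le> (\<Sum>j\<in>{1..N}. min (exp (- x)) ((real s / real j)\<^sup>2) / (2 * y))"
    using L y by (intro sum_mono frac_le) auto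
  also have "\<dots> = (\<Sum>j\<in>{1..N}. min (exp (- x)) ((real s / real j)\<^sup>2)) / (2 * y)"
    by (rule sum_divide_distrib[symmetric])
  also have "\<dots> \<le> (3 * s * exp (- x / 2)) / (2 * y)"
    using sum_min_inverse_square_le[of "real s" x N] s x y by (intro divide_right_mono) auto
  also have "\<dots> \<le> (3 * s * (1 / y)) / (2 * y)"
  proof -
    have "(1 + x / 2)\<^sup>2 = 2 * x + (1 - x / 2)\<^sup>2"
      by (simp add: power2_eq_square algebra_simps)
    then have "y\<^sup>2 \<le> (1 + x / 2)\<^sup>2" by (simp add: power2_eq_square[of y] y(2))
    then have "y \<le> 1 + x / 2" by (rule power2_le_imp_le) (use x in simp)
    also have "\<dots> \<le> exp (x / 2)" by (rule exp_ge_add_one_self)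
    finally have "exp (- x / 2) \<le> 1 / y" using y by (simp add: exp_minus field_simps)
    then show ?thesis using y by (intro divide_right_mono mult_left_mono) auto
  qed
  also have "\<dots> = 3 * s / (2 * (y * y))" by simp
  also have "\<dots> = 3 / 4 * (\<gamma> * s)" unfolding y(2) using \<gamma> by (simp add: x_def)
  finally show ?thesis .
qed

section \<open>The descent cone of the weighted norm\<close>

lemma weighted_l1_le_L2_set:
  assumes "finite S" "\<And>j. j \<in> S \<Longrightarrow> \<omega> j \<ge> 0" "(\<Sum>j\<in>S. (\<omega> j)\<^sup>2) \<le> s"
  shows "(\<Sum>j\<in>S. \<omega> j * \<bar>z j\<bar>) \<le> sqrt s * L2_set z S"
proof -
  have "(\<Sum>j\<in>S. \<omega> j * \<bar>z j\<bar>) = (\<Sum>j\<in>S. \<bar>\<omega> j\<bar> * \<bar>z j\<bar>)"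
    using assms(2) by (intro sum.cong) auto
  also have "\<dots> \<le> L2_set \<omega> S * L2_set z S" by (rule L2_set_mult_ineq)
  also have "\<dots> \<le> sqrt s * L2_set z S"
    using assms(3) by (intro mult_right_mono) (auto simp: L2_set_def sum_nonneg)
  finally show ?thesis .
qed

lemma L2_set_mono_set: "finite J \<Longrightarrow> S \<subseteq> J \<Longrightarrow> L2_set z S \<le> L2_set z J"
  unfolding L2_set_def by (intro real_sqrt_le_mono sum_mono2) auto

text \<open>
  The unit vectors of the cone that contains all error vectors.
\<close>
definition descent_sphere :: "nat \<Rightarrow> (nat \<Rightarrow> real) \<Rightarrow> nat set \<Rightarrow> (nat \<Rightarrow> real) set" where
  "descent_sphere N \<omega> S = {z. L2_set z {1..N} = 1 \<and>
     (\<Sum>j\<in>{1..N} - S. \<omega> j * \<bar>z j\<bar>) \<le> (\<Sum>j\<in>S. \<omega> j * \<bar>z j\<bar>)}"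

text \<open>
  Off \<open>S\<close>, \<open>\<bar>h j\<bar>\<close> is at most its excess over the threshold plus the threshold \<open>t * \<omega> j\<close> itself. The
  thresholds contribute \<open>t\<close> times the weighted norm of \<open>z\<close> off \<open>S\<close>, which the cone condition moves to \<open>S\<close>,
  where it is at most \<open>sqrt s\<close>.
\<close>
lemma descent_sphere_width:
  fixes h :: "nat \<Rightarrow> real"
  assumes S: "S \<subseteq> {1..N}" and w: "\<And>j. j \<in> {1..N} \<Longrightarrow> \<omega> j \<ge> 0" and s: "(\<Sum>j\<in>S. (\<omega> j)\<^sup>2) \<le> s"
    and t: "t \<ge> 0" and z: "z \<in> descent_sphere N \<omega> S"
  shows "- (\<Sum>j\<in>{1..N}. z j * h j) \<le>
    t * sqrt s + L2_set (\<lambda>j. if j \<in> S then \<bar>h j\<bar> else max 0 (\<bar>h j\<bar> - t * \<omega> j)) {1..N}"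
proof -
  let ?c = "\<lambda>j. if j \<in> S then \<bar>h j\<bar> else max 0 (\<bar>h j\<bar> - t * \<omega> j)"
  have finS: "finite S" using S finite_subset by blast
  have zn: "L2_set z {1..N} = 1" and zc: "(\<Sum>j\<in>{1..N} - S. \<omega> j * \<bar>z j\<bar>) \<le> (\<Sum>j\<in>S. \<omega> j * \<bar>z j\<bar>)"
    using z by (auto simp: descent_sphere_def)
  have "- (\<Sum>j\<in>{1..N}. z j * h j) \<le> (\<Sum>j\<in>{1..N}. \<bar>z j\<bar> * \<bar>h j\<bar>)"
    unfolding sum_negf[symmetric] by (intro sum_mono) (metis abs_ge_minus_self abs_mult)
  also have "\<dots> \<le> (\<Sum>j\<in>{1..N}. \<bar>z j\<bar> * \<bar>?c j\<bar> + (if j \<in> S then 0 else t * (\<omega> j * \<bar>z j\<bar>)))"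
  proof (rule sum_mono)
    fix j assume "j \<in> {1..N}"
    have "\<bar>h j\<bar> \<le> \<bar>?c j\<bar> + (if j \<in> S then 0 else t * \<omega> j)" by (auto simp: max_def)
    from mult_left_mono[OF this, of "\<bar>z j\<bar>"]
    show "\<bar>z j\<bar> * \<bar>h j\<bar> \<le> \<bar>z j\<bar> * \<bar>?c j\<bar> + (if j \<in> S then 0 else t * (\<omega> j * \<bar>z j\<bar>))"
      by (auto simp: algebra_simps)
  qed
  also have "\<dots> = (\<Sum>j\<in>{1..N}. \<bar>z j\<bar> * \<bar>?c j\<bar>) + t * (\<Sum>j\<in>{1..N} - S. \<omega> j * \<bar>z j\<bar>)"
  proof -
    have "(\<Sum>j\<in>{1..N}. if j \<in> S then 0 else t * (\<omega> j * \<bar>z j\<bar>)) = (\<Sum>j\<in>{1..N} - S. t * (\<omega> j * \<bar>z j\<bar>))"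
      by (rule sum.mono_neutral_cong_right) auto
    then show ?thesis by (simp add: sum.distrib sum_distrib_left)
  qed
  also have "(\<Sum>j\<in>{1..N}. \<bar>z j\<bar> * \<bar>?c j\<bar>) \<le> L2_set z {1..N} * L2_set ?c {1..N}"
    by (rule L2_set_mult_ineq)
  also have "t * (\<Sum>j\<in>{1..N} - S. \<omega> j * \<bar>z j\<bar>) \<le> t * (sqrt s * 1)"
  proof -
    have "(\<Sum>j\<in>S. \<omega> j * \<bar>z j\<bar>) \<le> sqrt s * L2_set z S"
      using finS S w s by (intro weighted_l1_le_L2_set) auto
    also have "\<dots> \<le> sqrt s * L2_set z {1..N}"
      using S s sum_nonneg[of S "\<lambda>j. (\<omega> j)\<^sup>2"] by (intro mult_left_mono L2_set_mono_set) auto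
    finally show ?thesis using zc zn t by (intro mult_left_mono) auto
  qed
  finally show ?thesis using zn by simp
qed

section \<open>The smallest dilation of a Gaussian matrix on the descent cone\<close>

lemma borel_measurable_coordinate:
  "p \<in> J \<Longrightarrow> (\<lambda>\<xi>. \<xi> p) \<in> borel_measurable (gaussN J)"
  using measurable_component_singleton[of p J "\<lambda>_. gauss"] measurable_cong_sets[OF refl sets_gauss] by blast

text \<open>
  Functions of disjoint blocks of coordinates are independent, also when the blocks leave out some
  coordinates.
\<close>
lemma gaussN_integral_split:
  fixes f g :: "('i \<Rightarrow> real) \<Rightarrow> real"
  assumes fin: "finite I" and AB: "A \<subseteq> I" "B \<subseteq> I" "A \<inter> B = {}"
    and f: "f \<in> borel_measurable (gaussN A)" and g: "g \<in> borel_measurable (gaussN B)"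
    and int: "integrable (gaussN I) (\<lambda>\<xi>. f (restrict \<xi> A) * g (restrict \<xi> B))"
  shows "(\<integral>\<xi>. f (restrict \<xi> A) * g (restrict \<xi> B) \<partial>gaussN I) = (\<integral>\<xi>. f \<xi> \<partial>gaussN A) * (\<integral>\<xi>. g \<xi> \<partial>gaussN B)"
proof -
  let ?F = "\<lambda>\<xi>. f (restrict \<xi> A) * g (restrict \<xi> B)"
  have C: "A \<union> B \<subseteq> I" using AB by simp
  have fAB: "finite A" "finite B" using fin AB(1,2) by (auto intro: finite_subset)
  have m[measurable]: "?F \<in> borel_measurable (gaussN (A \<union> B))"
    by (intro borel_measurable_times measurable_compose[OF _ f] measurable_compose[OF _ g] measurable_restrict_subset) auto
  have r: "(\<lambda>\<xi>. restrict \<xi> (A \<union> B)) \<in> measurable (gaussN I) (gaussN (A \<union> B))"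
    using C by (rule measurable_restrict_subset)
  have Fr: "?F (restrict \<xi> (A \<union> B)) = ?F \<xi>" for \<xi>
  proof -
    have "(A \<union> B) \<inter> A = A" "(A \<union> B) \<inter> B = B" by auto
    then show ?thesis by (simp only: restrict_restrict)
  qed
  have int': "integrable (gaussN (A \<union> B)) ?F"
    by (subst gaussN.distr_restrict[OF C fin], subst integrable_distr_eq[OF r m]) (simp only: Fr int)
  have "(\<integral>\<xi>. ?F \<xi> \<partial>gaussN I) = (\<integral>\<xi>. ?F \<xi> \<partial>gaussN (A \<union> B))"
    by (subst gaussN.distr_restrict[OF C fin], subst integral_distr[OF r m]) (simp only: Fr)
  also have "\<dots> = (\<integral>x. (\<integral>y. ?F (merge A B (x, y)) \<partial>gaussN B) \<partial>gaussN A)"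
    by (rule gaussN.product_integral_fold[OF AB(3) fAB int'])
  also have "\<dots> = (\<integral>x. (\<integral>y. f x * g y \<partial>gaussN B) \<partial>gaussN A)"
  proof (intro Bochner_Integration.integral_cong refl)
    fix x y assume "x \<in> space (gaussN A)" "y \<in> space (gaussN B)"
    then have "restrict x A = x" "restrict y B = y" by (auto simp: space_PiM PiE_restrict)
    then show "?F (merge A B (x, y)) = f x * g y"
      using AB by (simp add: restrict_merge)
  qed
  finally show ?thesis by simp
qed

lemma L2_set_times_singleton:
  "L2_set f (A \<times> {b}) = L2_set (\<lambda>i. f (i, b)) A" "L2_set f ({b} \<times> A) = L2_set (\<lambda>i. f (b, i)) A"
proof -
  have "(\<Sum>p\<in>A \<times> {b}. (f p)\<^sup>2) = (\<Sum>i\<in>A. (f (i, b))\<^sup>2)"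
    by (rule sum.reindex_bij_witness[where i = "\<lambda>i. (i, b)" and j = fst]) auto
  then show "L2_set f (A \<times> {b}) = L2_set (\<lambda>i. f (i, b)) A" by (simp add: L2_set_def)
next
  have "(\<Sum>p\<in>{b} \<times> A. (f p)\<^sup>2) = (\<Sum>i\<in>A. (f (b, i))\<^sup>2)"
    by (rule sum.reindex_bij_witness[where i = "\<lambda>i. (b, i)" and j = snd]) auto
  then show "L2_set f ({b} \<times> A) = L2_set (\<lambda>i. f (b, i)) A" by (simp add: L2_set_def)
qed

text \<open>
  Gordon's comparison with \<open>l = \<tau>\<close>. In the exponent, \<open>\<tau>\<^sup>2 / 2\<close> appears once on the left, from the extra
  scalar, and twice on the right, from \<open>g\<close> and from \<open>h\<close>; together with the linear term \<open>- \<tau>\<^sup>2\<close> this leaves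
  \<open>- \<tau>\<^sup>2 / 2\<close>.
\<close>
lemma gaussian_descent_cone_prob:
  fixes \<gamma> \<zeta> :: real and \<omega> :: "nat \<Rightarrow> real" and m N s :: nat
  assumes s: "s \<ge> 1" and \<gamma>: "\<gamma> > 0"
    and w: "\<And>j. j \<in> {1..N} \<Longrightarrow> \<omega> j \<ge> max 1 (sqrt (2 * \<gamma> * ln (real j / real s)))"
    and S: "S \<subseteq> {1..N}" "(\<Sum>j\<in>S. (\<omega> j)\<^sup>2) \<le> s"
    and F: "finite F" "F \<subseteq> descent_sphere N \<omega> S"
  defines "\<tau> \<equiv> m / sqrt (m + 1) - sqrt (2 * s / \<gamma>) - sqrt (card S + 3 / 4 * (\<gamma> * s)) - \<zeta>"
  assumes \<tau>: "\<tau> \<ge> 0"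
  shows "measure (gaussN ({1..m} \<times> {1..N}))
      {\<xi> \<in> space (gaussN ({1..m} \<times> {1..N})). \<exists>z\<in>F. L2_set (\<lambda>i. \<Sum>j\<in>{1..N}. z j * \<xi> (i, j)) {1..m} < \<zeta>}
    \<le> exp (- \<tau>\<^sup>2 / 2)"
proof -
  define I where "I = {0..m} \<times> {0..N}"
  define IA where "IA = {1..m} \<times> {1..N}"
  define Ig where "Ig = {1..m} \<times> {0::nat}"
  define Ih where "Ih = {0::nat} \<times> {1..N}"
  define I0 where "I0 = {(0::nat, 0::nat)}"
  note idx = I_def IA_def Ig_def Ih_def I0_def
  have fin: "finite I" "finite IA" "finite Ig" "finite Ih" "finite I0" by (auto simp: idx)
  have w1: "\<omega> j \<ge> 1" if "j \<in> {1..N}" for j using w[OF that] by simp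
  define t where "t = sqrt (2 / \<gamma>)"
  have t: "t > 0" using \<gamma> by (simp add: t_def)
  define K where "K = card S + 3 / 4 * (\<gamma> * s)"
  have K: "K > 0" unfolding K_def using \<gamma> s by (intro add_nonneg_pos) auto
  define c where "c \<xi> p = (if p \<in> {0} \<times> S then \<bar>\<xi> p\<bar> else max 0 (\<bar>\<xi> p\<bar> - t * \<omega> (snd p)))"
    for \<xi> :: "nat \<times> nat \<Rightarrow> real" and p
  define H where "H \<xi> = t * sqrt s + L2_set (c \<xi>) Ih" for \<xi>
  let ?A = "\<lambda>z \<xi>. L2_set (\<lambda>i. \<Sum>j\<in>{1..N}. z j * \<xi> (i, j)) {1..m}"
  define P where "P \<xi> = (if \<exists>z\<in>F. ?A z \<xi> < \<zeta> then 1 else 0 :: real)" for \<xi>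
  have cw: "integrable (gaussN Ih) (\<lambda>\<xi>. exp (\<tau> * L2_set (c \<xi>) Ih))"
    "(\<integral>\<xi>. exp (\<tau> * L2_set (c \<xi>) Ih) \<partial>gaussN Ih) \<le> exp (\<tau> * sqrt K + \<tau>\<^sup>2 / 2)"
  proof -
    have sub: "{0} \<times> S \<subseteq> Ih" using S by (auto simp: Ih_def)
    have pos: "t * \<omega> (snd p) > 0" if "p \<in> Ih - {0} \<times> S" for p
      using that w1[of "snd p"] t by (auto simp: Ih_def)
    have "(\<Sum>p\<in>Ih - {0} \<times> S. exp (- (t * \<omega> (snd p))\<^sup>2 / 2) / (2 * (t * \<omega> (snd p)))) =
        (\<Sum>j\<in>{1..N} - S. exp (- (t * \<omega> j)\<^sup>2 / 2) / (2 * (t * \<omega> j)))"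
      by (rule sum.reindex_bij_witness[where i = "\<lambda>j. (0, j)" and j = snd]) (auto simp: Ih_def)
    also have "\<dots> \<le> 3 / 4 * (\<gamma> * s)"
      unfolding t_def by (rule weighted_tail_sum_le[OF s \<gamma> w]) auto
    finally have le: "card ({0::nat} \<times> S) + (\<Sum>p\<in>Ih - {0} \<times> S. exp (- (t * \<omega> (snd p))\<^sup>2 / 2) / (2 * (t * \<omega> (snd p)))) \<le> K"
      by (simp add: K_def card_cartesian_product)
    note * = thresholded_norm_mgf[OF fin(4) sub pos \<tau> K le]
    show "integrable (gaussN Ih) (\<lambda>\<xi>. exp (\<tau> * L2_set (c \<xi>) Ih))"
      "(\<integral>\<xi>. exp (\<tau> * L2_set (c \<xi>) Ih) \<partial>gaussN Ih) \<le> exp (\<tau> * sqrt K + \<tau>\<^sup>2 / 2)"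
      unfolding c_def[abs_def] using * by auto
  qed
  have mc: "(\<lambda>\<xi>. L2_set (c \<xi>) Ih) \<in> borel_measurable (gaussN J)" if "Ih \<subseteq> J" for J
  proof -
    have [measurable]: "(\<lambda>\<xi>. c \<xi> p) \<in> borel_measurable (gaussN J)" if "p \<in> Ih" for p
    proof -
      have [measurable]: "(\<lambda>\<xi>. \<xi> p) \<in> borel_measurable (gaussN J)"
        using that \<open>Ih \<subseteq> J\<close> by (intro borel_measurable_coordinate) auto
      show ?thesis unfolding c_def by (cases "p \<in> {0} \<times> S") simp_all
    qed
    show ?thesis unfolding L2_set_def by measurable
  qed
  have cr: "L2_set (c (restrict \<xi> Ih)) Ih = L2_set (c \<xi>) Ih" for \<xi>
    by (intro L2_set_cong) (auto simp: c_def)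
  have gr: "L2_set (restrict \<xi> Ig) Ig = L2_set \<xi> Ig" for \<xi>
    by (intro L2_set_cong) auto
  have gI: "L2_set \<xi> Ig = L2_set (\<lambda>i. \<xi> (i, 0)) {1..m}" for \<xi>
    unfolding Ig_def by (rule L2_set_times_singleton)
  \<comment> \<open>\<open>g\<close> and \<open>h\<close> occupy disjoint coordinates, so the bound supplied by \<open>H\<close> factorizes\<close>
  have rint: "integrable (gaussN I) (\<lambda>\<xi>. exp (\<tau> * L2_set (c (restrict \<xi> Ih)) Ih) * exp (- \<tau> * L2_set (restrict \<xi> Ig) Ig))"
  proof (rule integrable_gaussN_bound[OF fin(1)])
    show "(\<lambda>\<xi>. exp (\<tau> * L2_set (c (restrict \<xi> Ih)) Ih) * exp (- \<tau> * L2_set (restrict \<xi> Ig) Ig)) \<in> borel_measurable (gaussN I)"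
    proof -
      have [measurable]: "(\<lambda>\<xi>. L2_set (c \<xi>) Ih) \<in> borel_measurable (gaussN I)" by (rule mc) (auto simp: idx)
      have [measurable]: "(\<lambda>\<xi>. L2_set \<xi> Ig) \<in> borel_measurable (gaussN I)"
        unfolding L2_set_def by (intro measurable_compose[OF _ borel_measurable_sqrt] borel_measurable_sum borel_measurable_power) (auto simp: idx)
      show ?thesis unfolding cr gr by measurable
    qed
    fix \<xi>
    have "L2_set (c \<xi>) Ih \<le> (\<Sum>p\<in>Ih. \<bar>c \<xi> p\<bar>)" by (rule L2_set_le_sum_abs)
    also have "\<dots> \<le> (\<Sum>p\<in>Ih. \<bar>\<xi> p\<bar>)"
    proof (rule sum_mono)
      fix p assume "p \<in> Ih"
      then have "0 \<le> t * \<omega> (snd p)" using t w1[of "snd p"] by (auto simp: Ih_def)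
      then show "\<bar>c \<xi> p\<bar> \<le> \<bar>\<xi> p\<bar>" by (auto simp: c_def)
    qed
    also have "\<dots> \<le> (\<Sum>p\<in>I. \<bar>\<xi> p\<bar>)" by (intro sum_mono2 fin) (auto simp: idx)
    finally have "exp (\<tau> * L2_set (c \<xi>) Ih) \<le> exp (\<tau> * (\<Sum>p\<in>I. \<bar>\<xi> p\<bar>))"
      using \<tau> by (simp add: mult_left_mono)
    moreover have "exp (- \<tau> * L2_set \<xi> Ig) \<le> 1" using \<tau> by simp
    ultimately show "\<bar>exp (\<tau> * L2_set (c (restrict \<xi> Ih)) Ih) * exp (- \<tau> * L2_set (restrict \<xi> Ig) Ig)\<bar> \<le> 1 * exp (\<tau> * (\<Sum>p\<in>I. \<bar>\<xi> p\<bar>))"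
      unfolding cr gr abs_mult abs_exp_cancel using mult_mono[of "exp (\<tau> * L2_set (c \<xi>) Ih)" _ "exp (- \<tau> * L2_set \<xi> Ig)" 1]
      by simp
  qed
  have rsplit: "(\<integral>\<xi>. exp (\<tau> * L2_set (c (restrict \<xi> Ih)) Ih) * exp (- \<tau> * L2_set (restrict \<xi> Ig) Ig) \<partial>gaussN I) =
      (\<integral>\<xi>. exp (\<tau> * L2_set (c \<xi>) Ih) \<partial>gaussN Ih) * (\<integral>\<xi>. exp (- \<tau> * L2_set \<xi> Ig) \<partial>gaussN Ig)"
  proof (rule gaussN_integral_split[OF fin(1) _ _ _ _ _ rint])
    show "(\<lambda>\<xi>. exp (\<tau> * L2_set (c \<xi>) Ih)) \<in> borel_measurable (gaussN Ih)" using mc[of Ih] by measurable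
    show "(\<lambda>\<xi>. exp (- \<tau> * L2_set \<xi> Ig)) \<in> borel_measurable (gaussN Ig)"
      unfolding L2_set_def by measurable
  qed (auto simp: idx)
  have expH: "exp (\<tau> * H \<xi> - \<tau> * L2_set (\<lambda>i. \<xi> (i, 0)) {1..m}) =
      exp (\<tau> * (t * sqrt s)) * (exp (\<tau> * L2_set (c (restrict \<xi> Ih)) Ih) * exp (- \<tau> * L2_set (restrict \<xi> Ig) Ig))" for \<xi>
    unfolding cr gr unfolding gI H_def exp_add[symmetric] by (simp add: algebra_simps)
  have rhs: "(\<integral>\<xi>. exp (\<tau> * H \<xi> - \<tau> * L2_set (\<lambda>i. \<xi> (i, 0)) {1..m}) \<partial>gaussN I) \<le>
      exp (\<tau> * (t * sqrt s)) * (exp (\<tau> * sqrt K + \<tau>\<^sup>2 / 2) * exp (- \<tau> * (m / sqrt (m + 1)) + \<tau>\<^sup>2 / 2))"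
  proof -
    have "(\<integral>\<xi>. exp (- \<tau> * L2_set \<xi> Ig) \<partial>gaussN Ig) \<le> exp (- \<tau> * (m / sqrt (m + 1)) + \<tau>\<^sup>2 / 2)"
      using gaussian_norm_mgf[OF fin(3) \<tau>] by (simp add: Ig_def card_cartesian_product)
    then show ?thesis
      unfolding expH integral_mult_right_zero rsplit using cw(2)
      by (intro mult_left_mono mult_mono) (auto intro: Bochner_Integration.integral_nonneg)
  qed
  \<comment> \<open>the matrix does not see \<open>\<xi> (0, 0)\<close>, which splits off the factor \<open>exp (\<tau>\<^sup>2 / 2)\<close>\<close>
  have Pr: "P (restrict \<xi> IA) = P \<xi>" for \<xi>
  proof -
    have "?A z (restrict \<xi> IA) = ?A z \<xi>" for z
      by (intro L2_set_cong sum.cong refl) (auto simp: IA_def)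
    then show ?thesis by (simp add: P_def)
  qed
  have mA: "{\<xi> \<in> space (gaussN J). \<exists>z\<in>F. ?A z \<xi> < \<zeta>} \<in> sets (gaussN J)" if "IA \<subseteq> J" for J
  proof -
    have "(\<lambda>\<xi>. ?A z \<xi>) \<in> borel_measurable (gaussN J)" for z
      unfolding L2_set_def using that
      by (intro measurable_compose[OF _ borel_measurable_sqrt] borel_measurable_sum borel_measurable_power
          borel_measurable_times borel_measurable_const borel_measurable_coordinate)
         (auto simp: IA_def)
    then show ?thesis
      using F(1) by (intro sets.sets_Collect_finite_Ex borel_measurable_less borel_measurable_const) auto
  qed
  have mP: "P \<in> borel_measurable (gaussN J)" if "IA \<subseteq> J" for J
    unfolding P_def using mA[OF that] by (intro measurable_If) auto
  have lint: "integrable (gaussN I) (\<lambda>\<xi>. exp (- \<tau> * restrict \<xi> I0 (0, 0)) * P (restrict \<xi> IA))"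
  proof (rule integrable_gaussN_bound[OF fin(1)])
    have [measurable]: "P \<in> borel_measurable (gaussN I)" by (rule mP) (auto simp: idx)
    show "(\<lambda>\<xi>. exp (- \<tau> * restrict \<xi> I0 (0, 0)) * P (restrict \<xi> IA)) \<in> borel_measurable (gaussN I)"
    proof -
      have [measurable]: "(\<lambda>\<xi>. \<xi> (0, 0)) \<in> borel_measurable (gaussN I)"
        by (rule borel_measurable_coordinate) (auto simp: idx)
      have "restrict \<xi> I0 (0, 0) = \<xi> (0, 0)" for \<xi> :: "nat \<times> nat \<Rightarrow> real"
        by (simp add: I0_def)
      then show ?thesis unfolding Pr by simp
    qed
    fix \<xi> :: "nat \<times> nat \<Rightarrow> real"
    have "\<bar>\<xi> (0, 0)\<bar> \<le> (\<Sum>p\<in>I. \<bar>\<xi> p\<bar>)" using fin by (intro member_le_sum[of "(0, 0)" I "\<lambda>p. \<bar>\<xi> p\<bar>"]) (auto simp: idx)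
    then have "- \<tau> * \<xi> (0, 0) \<le> \<tau> * (\<Sum>p\<in>I. \<bar>\<xi> p\<bar>)"
      using \<tau> mult_left_mono[of "- \<xi> (0, 0)" "\<Sum>p\<in>I. \<bar>\<xi> p\<bar>" \<tau>] by simp
    then show "\<bar>exp (- \<tau> * restrict \<xi> I0 (0, 0)) * P (restrict \<xi> IA)\<bar> \<le> 1 * exp (\<tau> * (\<Sum>p\<in>I. \<bar>\<xi> p\<bar>))"
      unfolding Pr by (simp add: P_def I0_def)
  qed
  have "(\<integral>\<xi>. exp (- \<tau> * restrict \<xi> I0 (0, 0)) * P (restrict \<xi> IA) \<partial>gaussN I) =
      (\<integral>\<xi>. exp (- \<tau> * \<xi> (0, 0)) \<partial>gaussN I0) * (\<integral>\<xi>. P \<xi> \<partial>gaussN IA)"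
  proof (rule gaussN_integral_split[OF fin(1) _ _ _ _ _ lint])
    show "(\<lambda>\<xi>. exp (- \<tau> * \<xi> (0, 0))) \<in> borel_measurable (gaussN I0)"
      unfolding I0_def by measurable
  qed (auto simp: idx intro!: mP[unfolded IA_def])
  also have "(\<integral>\<xi>. exp (- \<tau> * \<xi> (0, 0)) \<partial>gaussN I0) = exp (\<tau>\<^sup>2 / 2)"
    using gaussN.product_integral_singleton[of "\<lambda>t. exp (- \<tau> * t)" "(0, 0)"] integral_gauss_exp[of "- \<tau>"]
    by (simp add: I0_def)
  also have "(\<integral>\<xi>. P \<xi> \<partial>gaussN IA) = measure (gaussN IA) {\<xi> \<in> space (gaussN IA). \<exists>z\<in>F. ?A z \<xi> < \<zeta>}"
  proof -
    have "(\<integral>\<xi>. P \<xi> \<partial>gaussN IA) = (\<integral>\<xi>. indicator {\<xi> \<in> space (gaussN IA). \<exists>z\<in>F. ?A z \<xi> < \<zeta>} \<xi> \<partial>gaussN IA)"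
      by (intro Bochner_Integration.integral_cong refl) (simp add: P_def indicator_def)
    then show ?thesis using sets.sets_into_space[OF mA[OF order_refl]] by (simp add: Int_absorb1 Int_absorb2)
  qed
  finally have lhs: "exp (\<tau>\<^sup>2 / 2) * measure (gaussN IA) {\<xi> \<in> space (gaussN IA). \<exists>z\<in>F. ?A z \<xi> < \<zeta>} =
      (\<integral>\<xi>. exp (- \<tau> * \<xi> (0, 0)) * P \<xi> \<partial>gaussN I)"
    unfolding Pr by (simp add: I0_def)
  have "(\<integral>\<xi>. exp (- \<tau> * \<xi> (0, 0)) * P \<xi> \<partial>gaussN I) \<le>
      exp (\<tau> * \<zeta>) * (\<integral>\<xi>. exp (\<tau> * H \<xi> - \<tau> * L2_set (\<lambda>i. \<xi> (i, 0)) {1..m}) \<partial>gaussN I)"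
    unfolding P_def I_def
  proof (rule gordon_exponential_comparison[OF F(1) _ \<tau>])
    fix z assume z: "z \<in> F"
    then have "L2_set z {1..N} = 1" using F(2) by (auto simp: descent_sphere_def)
    then show "(\<Sum>j\<in>{1..N}. (z j)\<^sup>2) = 1" by (simp add: L2_set_def)
    fix \<xi> :: "nat \<times> nat \<Rightarrow> real"
    have "L2_set (\<lambda>j. if j \<in> S then \<bar>\<xi> (0, j)\<bar> else max 0 (\<bar>\<xi> (0, j)\<bar> - t * \<omega> j)) {1..N} = L2_set (c \<xi>) Ih"
      unfolding Ih_def L2_set_times_singleton c_def by (intro L2_set_cong) auto
    then show "- (\<Sum>j\<in>{1..N}. z j * \<xi> (0, j)) \<le> H \<xi>"
      using descent_sphere_width[OF S(1) _ S(2), of t z "\<lambda>j. \<xi> (0, j)"] z F(2) t w1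
      by (force simp: H_def)
  next
    show "integrable (gaussN ({0..m} \<times> {0..N})) (\<lambda>\<xi>. exp (\<tau> * H \<xi> - \<tau> * L2_set (\<lambda>i. \<xi> (i, 0)) {1..m}))"
      unfolding expH I_def[symmetric] by (intro integrable_mult_right rint)
  qed
  also have "\<dots> \<le> exp (\<tau> * \<zeta>) * (exp (\<tau> * (t * sqrt s)) * (exp (\<tau> * sqrt K + \<tau>\<^sup>2 / 2) * exp (- \<tau> * (m / sqrt (m + 1)) + \<tau>\<^sup>2 / 2)))"
    using rhs by (rule mult_left_mono) simp
  also have "\<dots> = exp (\<tau>\<^sup>2 / 2) * exp (- \<tau>\<^sup>2 / 2)"
  proof -
    have "\<tau> = m / sqrt (m + 1) - t * sqrt s - sqrt K - \<zeta>"
      using \<gamma> by (simp add: \<tau>_def t_def K_def real_sqrt_mult[symmetric])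
    then have "\<tau> * \<tau> = \<tau> * (m / sqrt (m + 1) - t * sqrt s - sqrt K - \<zeta>)" by simp
    then have "\<tau> * \<zeta> + (\<tau> * (t * sqrt s) + (\<tau> * sqrt K + \<tau>\<^sup>2 / 2 + (- \<tau> * (m / sqrt (m + 1)) + \<tau>\<^sup>2 / 2))) = \<tau>\<^sup>2 / 2 + - \<tau>\<^sup>2 / 2"
      by (simp add: power2_eq_square algebra_simps)
    then show ?thesis by (simp only: exp_add[symmetric])
  qed
  finally have "exp (\<tau>\<^sup>2 / 2) * measure (gaussN IA) {\<xi> \<in> space (gaussN IA). \<exists>z\<in>F. ?A z \<xi> < \<zeta>} \<le> exp (\<tau>\<^sup>2 / 2) * exp (- \<tau>\<^sup>2 / 2)"
    unfolding lhs .
  then show ?thesis unfolding IA_def by (simp only: mult_le_cancel_left_pos[OF exp_gt_zero])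
qed

lemma countable_dense_subset:
  fixes S :: "'a::second_countable_topology set"
  obtains D where "countable D" "D \<subseteq> S" "S \<subseteq> closure D"
proof -
  from ex_countable_basis obtain B :: "'a set set" where "countable B \<and> topological_basis B" ..
  then have B: "countable B" "topological_basis B" by simp_all
  define pick where "pick b = (SOME x. x \<in> b \<inter> S)" for b
  have pick: "pick b \<in> b \<inter> S" if "b \<inter> S \<noteq> {}" for b
    using someI_ex[of "\<lambda>x. x \<in> b \<inter> S"] that unfolding pick_def by blast
  define D where "D = pick ` {b \<in> B. b \<inter> S \<noteq> {}}"
  have "x \<in> closure D" if x: "x \<in> S" for x
  proof (unfold closure_iff_nhds_not_empty, intro allI impI)
    fix A U assume U: "U \<subseteq> A" "open U" "x \<in> U"
    then obtain b where b: "b \<in> B" "x \<in> b" "b \<subseteq> U"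
      using topological_basisE[OF B(2)] by metis
    then have "b \<inter> S \<noteq> {}" using x by auto
    then have "pick b \<in> D \<inter> A" using pick[of b] b U by (auto simp: D_def)
    then show "D \<inter> A \<noteq> {}" by blast
  qed
  moreover have "D \<subseteq> S" using pick by (auto simp: D_def)
  moreover have "countable D" using B by (simp add: D_def)
  ultimately show ?thesis using that by blast
qed


text \<open>
  The map \<open>z \<mapsto> \<parallel>A z\<parallel>\<close> is continuous for the product topology on sequences.
\<close>
lemma cone_bound_extend:
  fixes A :: "nat \<Rightarrow> nat \<Rightarrow> real"
  assumes D: "D0 \<subseteq> closure D" and z: "z \<in> D0"
    and le: "\<And>z. z \<in> D \<Longrightarrow> \<zeta> \<le> L2_set (mat_vec N A z) {1..m}"
  shows "\<zeta> \<le> L2_set (mat_vec N A z) {1..m}"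
proof -
  have "continuous_on UNIV (\<lambda>z :: nat \<Rightarrow> real. L2_set (mat_vec N A z) {1..m})"
    unfolding L2_set_def mat_vec_def
    by (intro continuous_intros continuous_on_product_coordinates)
  then have "closed {z. \<zeta> \<le> L2_set (mat_vec N A z) {1..m}}"
    by (intro closed_Collect_le continuous_on_const)
  then have "closure D \<subseteq> {z. \<zeta> \<le> L2_set (mat_vec N A z) {1..m}}"
    using le by (intro closure_minimal) auto
  then show ?thesis using D z by auto
qed

text \<open>
  The deterministic part. Since \<open>x\<close> vanishes off \<open>S\<close>, optimality of \<open>xh\<close> forces the error \<open>v\<close> into the
  descent cone; feasibility of \<open>x\<close> and \<open>xh\<close> bounds \<open>\<parallel>A v\<parallel>\<close> by \<open>2 \<eta>\<close>. On the cone the weighted norm is at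
  most twice its part on \<open>S\<close>, hence at most \<open>2 sqrt s \<parallel>v\<parallel>\<close>.
\<close>
lemma recovery_from_cone_bound:
  assumes \<zeta>: "\<zeta> > 0" and S: "S \<subseteq> {1..N}" "supported_on N x S" "weighted_card \<omega> S \<le> s"
    and w: "\<And>j. j \<in> {1..N} \<Longrightarrow> \<omega> j \<ge> 0"
    and y: "\<And>i. i \<in> {1..m} \<Longrightarrow> y i = mat_vec N A x i + e i" and e: "L2_set e {1..m} \<le> \<eta>"
    and cone: "\<And>z. z \<in> descent_sphere N \<omega> S \<Longrightarrow> \<zeta> \<le> L2_set (mat_vec N A z) {1..m}"
    and sol: "weighted_l1_solution m N \<omega> A y \<eta> xh"
  shows "L2_set (\<lambda>j. xh j - x j) {1..N} \<le> 2 * \<eta> / \<zeta>"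
    and "weighted_l1 N \<omega> (\<lambda>j. xh j - x j) \<le> 4 * sqrt s * \<eta> / \<zeta>"
proof -
  define v where "v j = xh j - x j" for j
  define n where "n = L2_set v {1..N}"
  have n0: "n \<ge> 0" by (simp add: n_def)
  have finS: "finite S" using S(1) finite_subset by blast
  have \<eta>: "\<eta> \<ge> 0" using e L2_set_nonneg[of e "{1..m}"] by linarith
  have feas: "L2_set (\<lambda>i. mat_vec N A xh i - y i) {1..m} \<le> \<eta>"
    and opt: "\<And>z. L2_set (\<lambda>i. mat_vec N A z i - y i) {1..m} \<le> \<eta> \<Longrightarrow> weighted_l1 N \<omega> xh \<le> weighted_l1 N \<omega> z"
    using sol unfolding weighted_l1_solution_def is_arg_min_def by (auto simp: not_less)
  have feasx: "L2_set (\<lambda>i. mat_vec N A x i - y i) {1..m} \<le> \<eta>"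
  proof -
    have "L2_set (\<lambda>i. mat_vec N A x i - y i) {1..m} = L2_set e {1..m}"
      unfolding L2_set_def using y by (intro arg_cong[where f = sqrt] sum.cong) auto
    then show ?thesis using e by simp
  qed
  have split: "(\<Sum>j\<in>{1..N}. f j) = (\<Sum>j\<in>S. f j) + (\<Sum>j\<in>{1..N} - S. f j)" for f :: "nat \<Rightarrow> real"
    using S(1) by (subst sum.subset_diff[OF S(1)]) auto
  have vcone: "(\<Sum>j\<in>{1..N} - S. \<omega> j * \<bar>v j\<bar>) \<le> (\<Sum>j\<in>S. \<omega> j * \<bar>v j\<bar>)"
  proof -
    have "(\<Sum>j\<in>S. \<omega> j * \<bar>xh j\<bar>) + (\<Sum>j\<in>{1..N} - S. \<omega> j * \<bar>xh j\<bar>) \<le>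
        (\<Sum>j\<in>S. \<omega> j * \<bar>x j\<bar>) + (\<Sum>j\<in>{1..N} - S. \<omega> j * \<bar>x j\<bar>)"
      using opt[OF feasx] unfolding weighted_l1_def split .
    moreover have "(\<Sum>j\<in>{1..N} - S. \<omega> j * \<bar>x j\<bar>) = 0"
      using S(2) by (intro sum.neutral) (auto simp: supported_on_def)
    moreover have "(\<Sum>j\<in>{1..N} - S. \<omega> j * \<bar>v j\<bar>) = (\<Sum>j\<in>{1..N} - S. \<omega> j * \<bar>xh j\<bar>)"
      using S(2) by (intro sum.cong) (auto simp: supported_on_def v_def)
    moreover have "(\<Sum>j\<in>S. \<omega> j * \<bar>x j\<bar>) \<le> (\<Sum>j\<in>S. \<omega> j * \<bar>xh j\<bar> + \<omega> j * \<bar>v j\<bar>)"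
    proof (rule sum_mono)
      fix j assume "j \<in> S"
      then have "\<omega> j \<ge> 0" using w S(1) by auto
      moreover have "\<bar>x j\<bar> \<le> \<bar>xh j\<bar> + \<bar>v j\<bar>" by (simp add: v_def)
      ultimately show "\<omega> j * \<bar>x j\<bar> \<le> \<omega> j * \<bar>xh j\<bar> + \<omega> j * \<bar>v j\<bar>"
        unfolding distrib_left[symmetric] by (rule mult_left_mono[rotated])
    qed
    ultimately show ?thesis by (simp add: sum.distrib)
  qed
  have Av: "L2_set (mat_vec N A v) {1..m} \<le> 2 * \<eta>"
  proof -
    have "L2_set (mat_vec N A v) {1..m} =
        L2_set (\<lambda>i. (mat_vec N A xh i - y i) + - (mat_vec N A x i - y i)) {1..m}"
      by (intro L2_set_cong) (auto simp: mat_vec_def v_def algebra_simps sum_subtractf)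
    also have "\<dots> \<le> L2_set (\<lambda>i. mat_vec N A xh i - y i) {1..m} + L2_set (\<lambda>i. - (mat_vec N A x i - y i)) {1..m}"
      by (rule L2_set_triangle_ineq)
    also have "L2_set (\<lambda>i. - (mat_vec N A x i - y i)) {1..m} = L2_set (\<lambda>i. mat_vec N A x i - y i) {1..m}"
      unfolding L2_set_def power2_minus ..
    finally show ?thesis using feas feasx by simp
  qed
  have main: "n \<le> 2 * \<eta> / \<zeta>"
  proof (cases "n = 0")
    case True
    then show ?thesis using \<eta> \<zeta> by simp
  next
    case False
    then have n: "n > 0" using n0 by simp
    define z where "z j = v j * (1 / n)" for j
    have scale: "(\<Sum>j\<in>J. \<omega> j * \<bar>z j\<bar>) = (\<Sum>j\<in>J. \<omega> j * \<bar>v j\<bar>) * (1 / n)" for J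
      using n by (simp add: z_def abs_mult sum_divide_distrib)
    have "L2_set z {1..N} = 1"
      unfolding z_def using n by (subst L2_set_left_distrib[symmetric]) (auto simp: n_def)
    moreover have "(\<Sum>j\<in>{1..N} - S. \<omega> j * \<bar>z j\<bar>) \<le> (\<Sum>j\<in>S. \<omega> j * \<bar>z j\<bar>)"
      unfolding scale using vcone n by (intro mult_right_mono) auto
    ultimately have "\<zeta> \<le> L2_set (mat_vec N A z) {1..m}"
      by (intro cone) (simp add: descent_sphere_def)
    also have "\<dots> = L2_set (\<lambda>i. mat_vec N A v i * (1 / n)) {1..m}"
      by (intro L2_set_cong) (simp_all add: mat_vec_def z_def sum_divide_distrib)
    also have "\<dots> = L2_set (mat_vec N A v) {1..m} * (1 / n)"
      using n by (intro L2_set_left_distrib[symmetric]) simp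
    also have "\<dots> \<le> 2 * \<eta> * (1 / n)" using Av n by (intro mult_right_mono) auto
    finally show ?thesis using n \<zeta> by (simp add: field_simps)
  qed
  then show "L2_set (\<lambda>j. xh j - x j) {1..N} \<le> 2 * \<eta> / \<zeta>" by (simp only: n_def v_def[abs_def])
  have "weighted_l1 N \<omega> v \<le> 2 * (\<Sum>j\<in>S. \<omega> j * \<bar>v j\<bar>)"
    unfolding weighted_l1_def split using vcone by simp
  also have "(\<Sum>j\<in>S. \<omega> j * \<bar>v j\<bar>) \<le> sqrt s * L2_set v S"
    using finS S w by (intro weighted_l1_le_L2_set) (auto simp: weighted_card_def)
  also have "\<dots> \<le> sqrt s * (2 * \<eta> / \<zeta>)"
  proof -
    have "0 \<le> s" using S(3) sum_nonneg[of S "\<lambda>j. (\<omega> j)\<^sup>2"] by (simp add: weighted_card_def)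
    moreover have "L2_set v S \<le> n" unfolding n_def using S(1) by (intro L2_set_mono_set) auto
    ultimately show ?thesis using main by (intro mult_left_mono) auto
  qed
  finally show "weighted_l1 N \<omega> (\<lambda>j. xh j - x j) \<le> 4 * sqrt s * \<eta> / \<zeta>"
    by (simp add: v_def[abs_def] mult_ac)
qed

lemma gaussian_matrix_distr:
  assumes "prob_space M" and G: "gaussian_matrix M m N A" and ne: "m \<ge> 1" "N \<ge> 1"
  defines "I \<equiv> {1..m} \<times> {1..N}"
  shows "(\<lambda>u. \<lambda>p\<in>I. A u (fst p) (snd p)) \<in> measurable M (gaussN I)"
    and "distr M (gaussN I) (\<lambda>u. \<lambda>p\<in>I. A u (fst p) (snd p)) = gaussN I"
proof -
  interpret prob_space M by fact
  have I: "I \<noteq> {}" using ne by (auto simp: I_def)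
  have rv: "random_variable borel (\<lambda>u. A u (fst p) (snd p))"
    and d: "distr M borel (\<lambda>u. A u (fst p) (snd p)) = gauss" if "p \<in> I" for p
  proof -
    have D: "distributed M lborel (\<lambda>u. A u (fst p) (snd p)) (\<lambda>t. ennreal (std_normal_density t))"
      using G that by (auto simp: gaussian_matrix_def I_def)
    then show "random_variable borel (\<lambda>u. A u (fst p) (snd p))"
      using distributed_measurable[OF D] by simp
    have "distr M lborel (\<lambda>u. A u (fst p) (snd p)) = gauss"
      using distributed_distr_eq_density[OF D] by (simp add: gauss_def)
    then show "distr M borel (\<lambda>u. A u (fst p) (snd p)) = gauss"
      by (metis distr_cong sets_lborel)
  qed
  have "indep_vars (\<lambda>_. borel) (\<lambda>p u. A u (fst p) (snd p)) I"
    using G by (simp add: gaussian_matrix_def I_def case_prod_beta')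
  then have eq: "distr M (\<Pi>\<^sub>M p\<in>I. borel) (\<lambda>u. \<lambda>p\<in>I. A u (fst p) (snd p)) = (\<Pi>\<^sub>M p\<in>I. distr M borel (\<lambda>u. A u (fst p) (snd p)))"
    using I rv by (subst (asm) indep_vars_iff_distr_eq_PiM') auto
  have s: "sets (gaussN I) = sets (\<Pi>\<^sub>M p\<in>I. borel)"
    by (rule sets_PiM_cong) auto
  have "(\<Pi>\<^sub>M p\<in>I. distr M borel (\<lambda>u. A u (fst p) (snd p))) = gaussN I"
    by (rule PiM_cong) (auto simp: d)
  then show "distr M (gaussN I) (\<lambda>u. \<lambda>p\<in>I. A u (fst p) (snd p)) = gaussN I"
    using eq distr_cong[OF refl s refl] by metis
  show "(\<lambda>u. \<lambda>p\<in>I. A u (fst p) (snd p)) \<in> measurable M (gaussN I)"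
    unfolding measurable_cong_sets[OF refl s] by (rule measurable_restrict) (rule rv)
qed

text \<open>
  The bound for finite sets of directions is uniform, so it survives the decreasing limit along an
  enumeration of a countable dense subset, and the event for the dense subset already covers the whole
  cone. This also supplies a measurable event.
\<close>
lemma gaussian_matrix_descent_sphere:
  fixes \<gamma> \<zeta> :: real and \<omega> :: "nat \<Rightarrow> real" and m N s :: nat
  assumes M: "prob_space M" and G: "gaussian_matrix M m N A" and ne: "m \<ge> 1" "N \<ge> 1"
    and s: "s \<ge> 1" and \<gamma>: "\<gamma> > 0"
    and w: "\<And>j. j \<in> {1..N} \<Longrightarrow> \<omega> j \<ge> max 1 (sqrt (2 * \<gamma> * ln (real j / real s)))"
    and S: "S \<subseteq> {1..N}" "(\<Sum>j\<in>S. (\<omega> j)\<^sup>2) \<le> s"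
  defines "\<tau> \<equiv> m / sqrt (m + 1) - sqrt (2 * s / \<gamma>) - sqrt (card S + 3 / 4 * (\<gamma> * s)) - \<zeta>"
  assumes \<tau>: "\<tau> \<ge> 0"
  obtains E where "E \<in> sets M" "measure M E \<ge> 1 - exp (- \<tau>\<^sup>2 / 2)" "E \<subseteq> space M"
    "\<And>u z. u \<in> E \<Longrightarrow> z \<in> descent_sphere N \<omega> S \<Longrightarrow> \<zeta> \<le> L2_set (mat_vec N (A u) z) {1..m}"
proof -
  interpret prob_space M by fact
  define I where "I = {1..m} \<times> {1..N}"
  let ?X = "\<lambda>u. \<lambda>p\<in>I. A u (fst p) (snd p)"
  note X = gaussian_matrix_distr[OF M G ne, folded I_def]
  have mv: "L2_set (\<lambda>i. \<Sum>j\<in>{1..N}. z j * ?X u (i, j)) {1..m} = L2_set (mat_vec N (A u) z) {1..m}" for z u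
    unfolding mat_vec_def by (intro L2_set_cong sum.cong refl) (auto simp: I_def mult.commute)
  have good: "{u \<in> space M. \<forall>z\<in>F. \<zeta> \<le> L2_set (mat_vec N (A u) z) {1..m}} \<in> sets M \<and>
      measure M {u \<in> space M. \<forall>z\<in>F. \<zeta> \<le> L2_set (mat_vec N (A u) z) {1..m}} \<ge> 1 - exp (- \<tau>\<^sup>2 / 2)"
    if F: "finite F" "F \<subseteq> descent_sphere N \<omega> S" for F
  proof -
    let ?B = "{\<xi> \<in> space (gaussN I). \<exists>z\<in>F. L2_set (\<lambda>i. \<Sum>j\<in>{1..N}. z j * \<xi> (i, j)) {1..m} < \<zeta>}"
    have B: "?B \<in> sets (gaussN I)"
    proof -
      have "(\<lambda>\<xi>. L2_set (\<lambda>i. \<Sum>j\<in>{1..N}. z j * \<xi> (i, j)) {1..m}) \<in> borel_measurable (gaussN I)" for z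
        unfolding L2_set_def
        by (intro measurable_compose[OF _ borel_measurable_sqrt] borel_measurable_sum borel_measurable_power
            borel_measurable_times borel_measurable_const borel_measurable_coordinate) (auto simp: I_def)
      then show ?thesis
        using F(1) by (intro sets.sets_Collect_finite_Ex borel_measurable_less borel_measurable_const) auto
    qed
    let ?V = "?X -` ?B \<inter> space M"
    have V: "?V \<in> sets M" using X(1) B by (rule measurable_sets)
    have "measure M ?V = measure (gaussN I) ?B"
      using measure_distr[OF X(1) B] X(2) by simp
    also have "\<dots> \<le> exp (- \<tau>\<^sup>2 / 2)"
      unfolding I_def \<tau>_def by (rule gaussian_descent_cone_prob[OF s \<gamma> w S F \<tau>[unfolded \<tau>_def]])
    finally have "measure M ?V \<le> exp (- \<tau>\<^sup>2 / 2)" .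
    moreover have "{u \<in> space M. \<forall>z\<in>F. \<zeta> \<le> L2_set (mat_vec N (A u) z) {1..m}} = space M - ?V"
    proof -
      have "?X u \<in> ?B \<longleftrightarrow> \<not> (\<forall>z\<in>F. \<zeta> \<le> L2_set (mat_vec N (A u) z) {1..m})" if "u \<in> space M" for u
        using measurable_space[OF X(1) that] unfolding mem_Collect_eq mv by (meson not_le)
      then show ?thesis by blast
    qed
    ultimately show ?thesis using V prob_compl[OF V] by auto
  qed
  obtain D where D: "countable D" "D \<subseteq> descent_sphere N \<omega> S" "descent_sphere N \<omega> S \<subseteq> closure D"
    by (rule countable_dense_subset)
  show thesis
  proof (cases "D = {}")
    case True
    then have "descent_sphere N \<omega> S = {}" using D by simp
    then show thesis by (intro that[of "space M"]) (auto simp: prob_space)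
  next
    case False
    define En where "En n = {u \<in> space M. \<forall>z\<in>from_nat_into D ` {..n}. \<zeta> \<le> L2_set (mat_vec N (A u) z) {1..m}}" for n :: nat
    have En: "En n \<in> sets M" "measure M (En n) \<ge> 1 - exp (- \<tau>\<^sup>2 / 2)" for n
      using good[of "from_nat_into D ` {..n}"] D(2) from_nat_into[OF False] unfolding En_def by auto
    have dec: "decseq En" unfolding En_def by (intro decseq_SucI) auto
    have "(\<lambda>n. measure M (En n)) \<longlonglongrightarrow> measure M (\<Inter>n. En n)"
      using En dec by (intro finite_Lim_measure_decseq) auto
    then have "measure M (\<Inter>n. En n) \<ge> 1 - exp (- \<tau>\<^sup>2 / 2)"
      using En(2) by (auto intro: LIMSEQ_le_const)
    moreover have "(\<Inter>n. En n) \<in> sets M" using En by auto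
    moreover have "\<zeta> \<le> L2_set (mat_vec N (A u) z) {1..m}" if u: "u \<in> (\<Inter>n. En n)" and z: "z \<in> descent_sphere N \<omega> S" for u z
    proof (rule cone_bound_extend[OF D(3) z])
      fix z assume "z \<in> D"
      then obtain n where "z = from_nat_into D n" using from_nat_into_surj[OF D(1)] by metis
      then show "\<zeta> \<le> L2_set (mat_vec N (A u) z) {1..m}" using u by (auto simp: En_def)
    qed
    moreover have "(\<Inter>n. En n) \<subseteq> space M" by (auto simp: En_def)
    ultimately show thesis by (intro that)
  qed
qed

section \<open>The recovery guarantee\<close>

theorem theorem4p1:
  fixes M :: "'a measure"
    and m N s k :: nat
    and \<omega> :: "nat \<Rightarrow> real"
    and \<gamma> \<zeta> \<eta> \<delta> :: real
    and A :: "'a \<Rightarrow> nat \<Rightarrow> nat \<Rightarrow> real"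
    and x :: "nat \<Rightarrow> real"
    and S :: "nat set"
    and e y :: "'a \<Rightarrow> nat \<Rightarrow> real"
  assumes "prob_space M"
    and "s \<ge> 1"
    and "\<gamma> > 0"
    and "\<And>j. j \<in> {1..N} \<Longrightarrow> \<omega> j \<ge> max 1 (sqrt (2 * \<gamma> * ln (real j / real s)))"
    and "gaussian_matrix M m N A"
    and "\<zeta> > 0"
    and "S \<subseteq> {1..N}"
    and "supported_on N x S"
    and "card S \<le> k"
    and "weighted_card \<omega> S \<le> real s"
    and "\<And>u i. u \<in> space M \<Longrightarrow> i \<in> {1..m} \<Longrightarrow> y u i = mat_vec N (A u) x i + e u i"
    and "\<And>u. u \<in> space M \<Longrightarrow> L2_set (e u) {1..m} \<le> \<eta>"
    and "0 < \<delta>" and "\<delta> < 1"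
    and "real m / sqrt (real m + 1) \<ge>
           sqrt (2 * real s / \<gamma>) + sqrt (real k) + sqrt (\<gamma> * real s) + sqrt (2 * ln (1 / \<delta>)) + \<zeta>"
  shows "\<exists>E \<in> sets M. measure M E > 1 - \<delta> \<and>
           (\<forall>u\<in>E. \<forall>xh. weighted_l1_solution m N \<omega> (A u) (y u) \<eta> xh \<longrightarrow>
              L2_set (\<lambda>j. xh j - x j) {1..N} \<le> 2 * \<eta> / \<zeta> \<and>
              weighted_l1 N \<omega> (\<lambda>j. xh j - x j) \<le> 4 * sqrt (real s) * \<eta> / \<zeta>)"
proof -
  interpret prob_space M by fact
  note s = assms(2) and \<gamma> = assms(3) and w = assms(4) and \<zeta> = assms(6) and S = assms(7)
  have w0: "\<omega> j \<ge> 0" if "j \<in> {1..N}" for j using w[OF that] by simp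
  have sp: "sqrt (2 * real s / \<gamma>) \<ge> 0" "sqrt (\<gamma> * real s) > 0" using s \<gamma> by auto
  \<comment> \<open>for \<open>m = 0\<close> the measurement condition reads \<open>0 \<ge> \<zeta> + \<dots>\<close>\<close>
  have m: "m \<ge> 1"
  proof (rule ccontr)
    assume "\<not> m \<ge> 1"
    then have "real m / sqrt (real m + 1) = 0" by simp
    moreover have "sqrt (2 * ln (1 / \<delta>)) \<ge> 0" using \<open>0 < \<delta>\<close> \<open>\<delta> < 1\<close> by simp
    ultimately show False using assms(15) sp \<zeta> real_sqrt_ge_zero[of "real k"] by linarith
  qed
  define \<tau> where "\<tau> = m / sqrt (m + 1) - sqrt (2 * s / \<gamma>) - sqrt (card S + 3 / 4 * (\<gamma> * s)) - \<zeta>"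
  have "sqrt (card S + 3 / 4 * (\<gamma> * s)) < sqrt k + sqrt (\<gamma> * s)"
  proof -
    have "sqrt (card S + 3 / 4 * (\<gamma> * s)) < sqrt (k + \<gamma> * s)"
      using assms(9) s \<gamma> by (intro real_sqrt_less_mono add_le_less_mono) auto
    also have "\<dots> \<le> sqrt k + sqrt (\<gamma> * s)"
      using s \<gamma> by (intro sqrt_add_le_add_sqrt) auto
    finally show ?thesis .
  qed
  then have \<tau>: "sqrt (2 * ln (1 / \<delta>)) < \<tau>" using assms(15) by (simp add: \<tau>_def add.commute)
  have ln: "2 * ln (1 / \<delta>) \<ge> 0" using \<open>0 < \<delta>\<close> \<open>\<delta> < 1\<close> by simp
  then have \<tau>0: "\<tau> \<ge> 0" using \<tau> real_sqrt_ge_zero[OF ln] by linarith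
  \<comment> \<open>\<open>\<tau>\<close> strictly exceeds \<open>sqrt (2 ln (1 / \<delta>))\<close> because only \<open>3/4\<close> of \<open>\<gamma> s\<close> is used\<close>
  have prob: "exp (- \<tau>\<^sup>2 / 2) < \<delta>"
  proof -
    have "(sqrt (2 * ln (1 / \<delta>)))\<^sup>2 < \<tau>\<^sup>2" using \<tau> ln by (intro power_strict_mono) auto
    then have "2 * ln (1 / \<delta>) < \<tau>\<^sup>2" using ln by simp
    then have "- \<tau>\<^sup>2 / 2 < ln \<delta>" using \<open>0 < \<delta>\<close> by (simp add: ln_div)
    then show ?thesis using \<open>0 < \<delta>\<close> by (metis exp_less_mono exp_ln)
  qed
  have wc: "(\<Sum>j\<in>S. (\<omega> j)\<^sup>2) \<le> s" using assms(10) by (simp add: weighted_card_def)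
  obtain E where E: "E \<in> sets M" "measure M E \<ge> 1 - exp (- \<tau>\<^sup>2 / 2)" "E \<subseteq> space M"
    "\<And>u z. u \<in> E \<Longrightarrow> z \<in> descent_sphere N \<omega> S \<Longrightarrow> \<zeta> \<le> L2_set (mat_vec N (A u) z) {1..m}"
  \<comment> \<open>for \<open>N = 0\<close> there are no unit vectors, and the index set of the product measure would be empty\<close>
  proof (cases "N = 0")
    case True
    then have "descent_sphere N \<omega> S = {}" by (simp add: descent_sphere_def)
    then show thesis using \<tau>0 by (intro that[of "space M"]) (auto simp: prob_space)
  next
    case False
    then show thesis
      using gaussian_matrix_descent_sphere[OF assms(1) assms(5) m _ s \<gamma> w S wc \<tau>0[unfolded \<tau>_def], folded \<tau>_def] that
      by (metis One_nat_def Suc_leI neq0_conv)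
  qed
  show ?thesis
  proof (intro bexI[OF _ E(1)] conjI ballI allI impI)
    show "measure M E > 1 - \<delta>" using E(2) prob by linarith
    fix u xh assume u: "u \<in> E" and sol: "weighted_l1_solution m N \<omega> (A u) (y u) \<eta> xh"
    have u': "u \<in> space M" using u E(3) by blast
    note rec = recovery_from_cone_bound[OF \<zeta> S assms(8) assms(10) w0 assms(11)[OF u'] assms(12)[OF u'] E(4)[OF u] sol]
    show "L2_set (\<lambda>j. xh j - x j) {1..N} \<le> 2 * \<eta> / \<zeta>"
      and "weighted_l1 N \<omega> (\<lambda>j. xh j - x j) \<le> 4 * sqrt (real s) * \<eta> / \<zeta>"
      by (rule rec; assumption)+
  qed
qed

end
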